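(* Let $k$ be a field, $S=k[x_1,\ldots,x_m]$, let $I\subseteq S$ be an ideal generated by monomials, and let $R=S/I$ be the corresponding monomial ring with minimal free resolution $F$ over $S$. Let $r\in\mathbb{N}$ and let $(\mu_n)_{n\ge1}$ be an $A_\infty$-structure on $F$ such that $F\otimes_S k$ (with the $A_\infty$-structure $\mu_n\otimes 1$) and the Koszul dga $K_R$ are quasi-isomorphic as $A_\infty$-algebras. Then $R$ satisfies condition $(B_r)$ if and only if $\mu_n$ is minimal for all $n\le r$.
   Context: **Koszul dga.** $K_S$ is the Koszul resolution of the base field $k$ over $S$, and $K_R=R\otimes_S K_S$, a dga with homology algebra $\operatorname{Tor}^S(R,k)$. **Minimality.** A free resolution $F\to R$ with differential $d$ is minimal if $d(F)\subseteq (x_1,\ldots,x_m)F$. A map $f\colon M\to N$ of $S$-modules is minimal if $f\otimes 1\colon M\otimes_S k\to N\otimes_S k$ is zero, equivalently if $f$ maps into $(x_1,\ldots,x_m)N$. This is applied to $\mu_n\colon F^{\otimes n}\to F$. **$A_\infty$-algebras.** Signs follow the Koszul convention $(f\otimes g)(x\otimes y)=(-1)^{|g||x|}fx\otimes gy$. An $A_\infty$-algebra structure on a $\mathbb{Z}$-graded free module $A$ over a commutative ring consists of linear maps $\mu_n\colon A^{\otimes n}\to A$ ($n\ge1$) of degree $n-2$ such that for every $n\ge 1$ $$\sum (-1)^{a+st}\mu_u(1^{\otimes a}\otimes\mu_s\otimes 1^{\otimes t})=0,$$ the sum over all $n=a+s+t$ with $a,t\ge0$, $s\ge1$, and $u=a+t+1$.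 An $A_\infty$-structure on the resolution $F$ is one over $S$ for which $\mu_1$ is the differential of $F$. A dga is an $A_\infty$-algebra with $\mu_1$ the differential, $\mu_2$ the product and $\mu_n=0$ for $n\ge3$. $A$ is strictly unital if there is $1\in A$ that is a unit for $\mu_2$ and such that, for all $n\ne2$, $\mu_n(a_1\otimes\cdots\otimes a_n)=0$ whenever some $a_i=1$. A morphism $f\colon (A,\mu_n)\to(B,\overline\mu_n)$ is a family of linear maps $f_n\colon A^{\otimes n}\to B$ of degree $n-1$ such that for every $n\ge1$ $$\sum(-1)^{a+st}f_u(1^{\otimes a}\otimes\mu_s\otimes1^{\otimes t})=\sum(-1)^w\overline\mu_q(f_{i_1}\otimes\cdots\otimes f_{i_q}),$$ the first sum over all $n=a+s+t$ with $a,t\ge0$, $s\ge1$, $u=a+t+1$, the second over all $1\le q\le n$ and $n=i_1+\cdots+i_q$ with all $i_p\ge1$, where $w=\sum_{p=1}^{q-1}(q-p)(i_p-1)$; if $A$ and $B$ are strictly unital one also requires $f_1(1)=1$ and, for $n\ge2$, $f_n(a_1\otimes\cdots\otimes a_n)=0$ if some $a_i=1$. A morphism is a quasi-isomorphism if $f_1$ is a quasi-isomorphism of complexes. Two $A_\infty$-algebras are quasi-isomorphic if they are connected by a finite zig-zag of $A_\infty$-quasi-isomorphisms. **Massey products.** Let $(A,d)$ be a dga and for $a\in A$ homogeneous write $\bar a=(-1)^{\deg(a)+1}a$. For $\alpha_1,\alpha_2\in H(A)$, the length $2$ Massey product $\langle\alpha_1,\alpha_2\rangle$ is the product $\alpha_1\alpha_2$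 in $H(A)$. For $n\ge3$, the length $n$ (or $n$-ary) Massey product $\langle\alpha_1,\ldots,\alpha_n\rangle$ is defined if each $\langle\alpha_i,\ldots,\alpha_j\rangle$ with $i<j$ and $j-i<n-1$ is defined and contains zero. A defining system $\{a_{ij}\}$ consists of cycles $a_{i-1,i}$ representing $\alpha_i$ ($i=1,\dots,n$) and, for $j>i+1$ with $(i,j)\ne(0,n)$, elements $a_{ij}$ with $da_{ij}=\sum_{i<l<j}\bar a_{il}a_{lj}$. Then $\langle\alpha_1,\ldots,\alpha_n\rangle$ is the set of classes $\big[\sum_{0<i<n}\bar a_{0i}a_{in}\big]$ over all defining systems. **Condition $(B_r)$.** A dga $A$ satisfies $(B_r)$ if all $n$-ary Massey products are defined and contain only zero for all $n\le r$. The monomial ring $R$ satisfies $(B_r)$ if the dga $K_R$ does. *)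

theory Defs
  imports Complex_Main "HOL-Library.Poly_Mapping"
begin

section \<open>Signs\<close>

(* sgn_pow e x is (-1)^e x; it is meaningful in any additive group, so that graded modules and
   rings without a chosen unit are covered. *)
definition sgn_pow :: "int \<Rightarrow> 'a::ab_group_add \<Rightarrow> 'a" where
  "sgn_pow e x = (if even e then x else - x)"


section \<open>Graded modules and \<open>A\<^sub>\<infinity>\<close>-algebras\<close>

(* The underlying module is the internal direct sum of the submodules comp A i inside the
   ambient module given by the type 'a and the scalar multiplication scl A.  The operation mu_n
   is the restriction of mul A to lists of length n: a linear map on the n-fold tensor power is
   given by an n-multilinear map.  Values of mul A on other lists are irrelevant. *)
record ('k, 'a) ainf =
  scl :: "'k \<Rightarrow> 'a \<Rightarrow> 'a"
  comp :: "int \<Rightarrow> 'a set"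
  mul :: "'a list \<Rightarrow> 'a"

definition total :: "('k::comm_ring_1, 'a::ab_group_add, 'z) ainf_scheme \<Rightarrow> 'a set" where
  "total A = module.span (scl A) (\<Union>i. comp A i)"

definition graded_free_module :: "('k::comm_ring_1, 'a::ab_group_add, 'z) ainf_scheme \<Rightarrow> bool" where
  "graded_free_module A \<longleftrightarrow>
     module (scl A) \<and>
     (\<forall>i. module.subspace (scl A) (comp A i)) \<and>
     (\<forall>i. \<exists>X. \<not> module.dependent (scl A) X \<and> module.span (scl A) X = comp A i) \<and>
     (\<forall>J x. finite J \<and> (\<forall>i\<in>J. x i \<in> comp A i) \<and> (\<Sum>i\<in>J. x i) = 0 \<longrightarrow> (\<forall>i\<in>J. x i = 0))"

definition multilinear_on ::
    "('k \<Rightarrow> 'a::ab_group_add \<Rightarrow> 'a) \<Rightarrow> ('k \<Rightarrow> 'b::ab_group_add \<Rightarrow> 'b) \<Rightarrow> 'a set \<Rightarrow> nat \<Rightarrow> ('a list \<Rightarrow> 'b) \<Rightarrow> bool" where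
  "multilinear_on s t V n f \<longleftrightarrow>
     (\<forall>xs ys x y c. Suc (length xs + length ys) = n \<and> set xs \<subseteq> V \<and> set ys \<subseteq> V \<and> x \<in> V \<and> y \<in> V \<longrightarrow>
        f (xs @ (x + y) # ys) = f (xs @ x # ys) + f (xs @ y # ys) \<and>
        f (xs @ s c x # ys) = t c (f (xs @ x # ys)))"

definition homogeneous :: "('k, 'a, 'z) ainf_scheme \<Rightarrow> int list \<Rightarrow> 'a list \<Rightarrow> bool" where
  "homogeneous A ps xs \<longleftrightarrow> list_all2 (\<lambda>p x. x \<in> comp A p) ps xs"

(* The sum over n = a + s + t of (-1)^(a + s t) g (1^a (x) mu_s (x) 1^t), evaluated at a tensor xs
   of homogeneous elements of degrees ps.  The second part of the exponent is the Koszul sign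
   for moving mu_s, of degree s - 2, past the first a factors. *)
definition stasheff_sum ::
    "('k, 'a, 'z) ainf_scheme \<Rightarrow> ('a list \<Rightarrow> 'b::ab_group_add) \<Rightarrow> int list \<Rightarrow> 'a list \<Rightarrow> 'b" where
  "stasheff_sum A g ps xs =
     (\<Sum>(a, s)\<in>{(a, s). 1 \<le> s \<and> a + s \<le> length xs}.
        sgn_pow (int a + int s * int (length xs - a - s) + (int s - 2) * sum_list (take a ps))
          (g (take a xs @ mul A (take s (drop a xs)) # drop (a + s) xs)))"

definition ainf_algebra :: "('k::comm_ring_1, 'a::ab_group_add, 'z) ainf_scheme \<Rightarrow> bool" where
  "ainf_algebra A \<longleftrightarrow>
     graded_free_module A \<and>
     (\<forall>n\<ge>1. multilinear_on (scl A) (scl A) (total A) n (mul A)) \<and>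
     (\<forall>ps xs. xs \<noteq> [] \<and> homogeneous A ps xs \<longrightarrow>
        mul A xs \<in> comp A (sum_list ps + int (length xs) - 2)) \<and>
     (\<forall>ps xs. xs \<noteq> [] \<and> homogeneous A ps xs \<longrightarrow> stasheff_sum A (mul A) ps xs = 0)"

definition strict_unit :: "('k::comm_ring_1, 'a::ab_group_add, 'z) ainf_scheme \<Rightarrow> 'a \<Rightarrow> bool" where
  "strict_unit A e \<longleftrightarrow>
     e \<in> total A \<and>
     (\<forall>x\<in>total A. mul A [e, x] = x \<and> mul A [x, e] = x) \<and>
     (\<forall>xs. xs \<noteq> [] \<and> length xs \<noteq> 2 \<and> set xs \<subseteq> total A \<and> e \<in> set xs \<longrightarrow> mul A xs = 0)"

fun blocks :: "nat list \<Rightarrow> 'a list \<Rightarrow> 'a list list" where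
  "blocks [] xs = []"
| "blocks (i # js) xs = take i xs # blocks js (drop i xs)"

definition compositions :: "nat \<Rightarrow> nat list set" where
  "compositions n = {js. js \<noteq> [] \<and> 0 \<notin> set js \<and> sum_list js = n}"

(* The exponent w = sum_{p<q} (q - p) (i_p - 1), with the parts numbered from 0. *)
definition comp_exponent :: "nat list \<Rightarrow> int" where
  "comp_exponent js = (\<Sum>p<length js. int (length js - 1 - p) * (int (js ! p) - 1))"

(* The Koszul exponent of f_{i_1} (x) ... (x) f_{i_q}: the p-th factor, of degree i_p - 1, moves
   past all arguments of the earlier factors. *)
definition koszul_exponent :: "nat list \<Rightarrow> int list \<Rightarrow> int" where
  "koszul_exponent js ps =
     (\<Sum>p<length js. (int (js ! p) - 1) * sum_list (take (sum_list (take p js)) ps))"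

definition ainf_morphism ::
    "('a list \<Rightarrow> 'b) \<Rightarrow> ('k::comm_ring_1, 'a::ab_group_add, 'y) ainf_scheme \<Rightarrow>
     ('k, 'b::ab_group_add, 'z) ainf_scheme \<Rightarrow> bool" where
  "ainf_morphism f A B \<longleftrightarrow>
     ainf_algebra A \<and> ainf_algebra B \<and>
     (\<forall>n\<ge>1. multilinear_on (scl A) (scl B) (total A) n f) \<and>
     (\<forall>ps xs. xs \<noteq> [] \<and> homogeneous A ps xs \<longrightarrow>
        f xs \<in> comp B (sum_list ps + int (length xs) - 1)) \<and>
     (\<forall>ps xs. xs \<noteq> [] \<and> homogeneous A ps xs \<longrightarrow>
        stasheff_sum A f ps xs =
        (\<Sum>js\<in>compositions (length xs).
           sgn_pow (comp_exponent js + koszul_exponent js ps) (mul B (map f (blocks js xs))))) \<and>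
     (\<forall>e e'. strict_unit A e \<and> strict_unit B e' \<longrightarrow>
        f [e] = e' \<and>
        (\<forall>xs. length xs \<ge> 2 \<and> set xs \<subseteq> total A \<and> e \<in> set xs \<longrightarrow> f xs = 0))"


section \<open>Homology and quasi-isomorphisms\<close>

definition cycles :: "('k, 'a::ab_group_add, 'z) ainf_scheme \<Rightarrow> int \<Rightarrow> 'a set" where
  "cycles A i = {x \<in> comp A i. mul A [x] = 0}"

definition homologous :: "('k, 'a::ab_group_add, 'z) ainf_scheme \<Rightarrow> int \<Rightarrow> ('a \<times> 'a) set" where
  "homologous A i = {(x, y). x \<in> cycles A i \<and> y \<in> cycles A i \<and>
     (\<exists>z\<in>comp A (i + 1). x - y = mul A [z])}"

definition homology :: "('k, 'a::ab_group_add, 'z) ainf_scheme \<Rightarrow> int \<Rightarrow> 'a set set" where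
  "homology A i = cycles A i // homologous A i"

definition hclass :: "('k, 'a::ab_group_add, 'z) ainf_scheme \<Rightarrow> int \<Rightarrow> 'a \<Rightarrow> 'a set" where
  "hclass A i x = homologous A i `` {x}"

definition ainf_quasi_iso ::
    "('a list \<Rightarrow> 'b) \<Rightarrow> ('k::comm_ring_1, 'a::ab_group_add, 'y) ainf_scheme \<Rightarrow>
     ('k, 'b::ab_group_add, 'z) ainf_scheme \<Rightarrow> bool" where
  "ainf_quasi_iso f A B \<longleftrightarrow>
     ainf_morphism f A B \<and>
     (\<forall>i. bij_betw (\<lambda>c. homologous B i `` ((\<lambda>x. f [x]) ` c)) (homology A i) (homology B i))"

definition ainf_step ::
    "('k::comm_ring_1, 'a::ab_group_add) ainf \<Rightarrow> ('k, 'b::ab_group_add) ainf \<Rightarrow> bool" where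
  "ainf_step A B \<longleftrightarrow> (\<exists>f. ainf_quasi_iso f A B) \<or> (\<exists>g. ainf_quasi_iso g B A)"

(* The intermediate algebras of the zig-zag are graded submodules of arbitrary modules on the
   type 'u.  A theorem that assumes this for a type variable 'u covers all zig-zags, since the
   finitely many intermediate algebras embed into one sufficiently large type. *)
definition ainf_quasi_isomorphic ::
    "'u::ab_group_add itself \<Rightarrow> ('k::comm_ring_1, 'a::ab_group_add) ainf \<Rightarrow>
     ('k, 'b::ab_group_add) ainf \<Rightarrow> bool" where
  "ainf_quasi_isomorphic _ A B \<longleftrightarrow>
     ainf_step A B \<or>
     (\<exists>C D :: ('k, 'u) ainf. ainf_step A C \<and> ainf_step\<^sup>*\<^sup>* C D \<and> ainf_step D B)"


section \<open>Massey products\<close>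

(* The dga A is regarded as an A_infinity-algebra: mul A [x] is the differential of x and
   mul A [x, y] the product.  Homogeneous homology classes are listed with their degrees, as
   pairs (p, c) with c in homology A p.  The entry a_{ij} of a defining system has degree
   massey_deg ws i j, the value forced by the differential. *)
definition massey_deg :: "(int \<times> 'a set) list \<Rightarrow> nat \<Rightarrow> nat \<Rightarrow> int" where
  "massey_deg ws i j = (\<Sum>l\<in>{i..<j}. fst (ws ! l)) + int (j - i) - 1"

definition bar :: "int \<Rightarrow> 'a::ab_group_add \<Rightarrow> 'a" where
  "bar p x = sgn_pow (p + 1) x"

definition massey_sum ::
    "('k, 'a::ab_group_add, 'z) ainf_scheme \<Rightarrow> (int \<times> 'a set) list \<Rightarrow> (nat \<Rightarrow> nat \<Rightarrow> 'a) \<Rightarrow> nat \<Rightarrow> nat \<Rightarrow> 'a" where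
  "massey_sum A ws a i j = (\<Sum>l\<in>{i<..<j}. mul A [bar (massey_deg ws i l) (a i l), a l j])"

definition defining_system ::
    "('k, 'a::ab_group_add, 'z) ainf_scheme \<Rightarrow> (int \<times> 'a set) list \<Rightarrow> (nat \<Rightarrow> nat \<Rightarrow> 'a) \<Rightarrow> bool" where
  "defining_system A ws a \<longleftrightarrow>
     (\<forall>i<length ws. a i (Suc i) \<in> snd (ws ! i)) \<and>
     (\<forall>i j. i + 1 < j \<and> j \<le> length ws \<and> (i, j) \<noteq> (0, length ws) \<longrightarrow>
        a i j \<in> comp A (massey_deg ws i j) \<and> mul A [a i j] = massey_sum A ws a i j)"

definition massey_product_deg :: "(int \<times> 'a set) list \<Rightarrow> int" where
  "massey_product_deg ws = (\<Sum>w\<leftarrow>ws. fst w) + int (length ws) - 2"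

definition massey_product ::
    "('k, 'a::ab_group_add, 'z) ainf_scheme \<Rightarrow> (int \<times> 'a set) list \<Rightarrow> 'a set set" where
  "massey_product A ws =
     (if length ws = 2
      then {hclass A (massey_product_deg ws) (mul A [x, y]) | x y. x \<in> snd (ws ! 0) \<and> y \<in> snd (ws ! 1)}
      else {hclass A (massey_product_deg ws) (massey_sum A ws a 0 (length ws)) | a. defining_system A ws a})"

function massey_defined ::
    "('k, 'a::ab_group_add, 'z) ainf_scheme \<Rightarrow> (int \<times> 'a set) list \<Rightarrow> bool" where
  "massey_defined A ws \<longleftrightarrow>
     (\<forall>i l. 2 \<le> l \<and> l < length ws \<and> i + l \<le> length ws \<longrightarrow>
        massey_defined A (take l (drop i ws)) \<and>
        hclass A (massey_product_deg (take l (drop i ws))) 0 \<in> massey_product A (take l (drop i ws)))"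
  by auto
termination
  by (relation "measure (\<lambda>(A, ws). length ws)") auto

declare massey_defined.simps [simp del]

definition condition_B_on ::
    "int set \<Rightarrow> ('k, 'a::ab_group_add, 'z) ainf_scheme \<Rightarrow> nat \<Rightarrow> bool" where
  "condition_B_on D A r \<longleftrightarrow>
     (\<forall>ws. 2 \<le> length ws \<and> length ws \<le> r \<and> (\<forall>(p, c)\<in>set ws. p \<in> D \<and> c \<in> homology A p) \<longrightarrow>
        massey_defined A ws \<and> massey_product A ws = {hclass A (massey_product_deg ws) 0})"

abbreviation condition_B :: "('k, 'a::ab_group_add, 'z) ainf_scheme \<Rightarrow> nat \<Rightarrow> bool" where
  "condition_B A r \<equiv> condition_B_on UNIV A r"

(* The class of the unit satisfies <1, 1> = {1}.  Massey products in Koszul homology are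
   therefore customarily restricted to classes of positive degree. *)
abbreviation condition_B_pos :: "('k, 'a::ab_group_add, 'z) ainf_scheme \<Rightarrow> nat \<Rightarrow> bool" where
  "condition_B_pos A r \<equiv> condition_B_on {0<..} A r"


section \<open>Polynomials, monomial rings and the Koszul dga\<close>

(* Polynomials over 'k in the variables indexed by 'v. *)
type_synonym ('v, 'k) polyn = "('v \<Rightarrow>\<^sub>0 nat) \<Rightarrow>\<^sub>0 'k"

definition Const :: "'k::zero \<Rightarrow> ('v, 'k) polyn" where
  "Const c = Poly_Mapping.single 0 c"

definition Monom :: "('v \<Rightarrow>\<^sub>0 nat) \<Rightarrow> ('v, 'k::zero_neq_one) polyn" where
  "Monom e = Poly_Mapping.single e 1"

definition Var :: "'v \<Rightarrow> ('v, 'k::zero_neq_one) polyn" where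
  "Var v = Monom (Poly_Mapping.single v 1)"

definition monomial_ideal :: "('v, 'k::field) polyn set \<Rightarrow> bool" where
  "monomial_ideal I \<longleftrightarrow> (\<exists>E. I = module.span (*) (Monom ` E))"

(* phi exhibits the ring on the type 'r as S/I; the class comm_ring admits the zero ring. *)
definition quotient_map :: "'s::comm_ring_1 set \<Rightarrow> ('s \<Rightarrow> 'r::comm_ring) \<Rightarrow> bool" where
  "quotient_map I \<phi> \<longleftrightarrow>
     (\<forall>a b. \<phi> (a + b) = \<phi> a + \<phi> b) \<and> (\<forall>a b. \<phi> (a * b) = \<phi> a * \<phi> b) \<and>
     surj \<phi> \<and> {a. \<phi> a = 0} = I"

(* Scalar multiplication on the free module of finitely supported functions. *)
definition pm_scale :: "'r::mult_zero \<Rightarrow> ('b \<Rightarrow>\<^sub>0 'r) \<Rightarrow> ('b \<Rightarrow>\<^sub>0 'r)" where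
  "pm_scale c x = Poly_Mapping.map ((*) c) x"

(* For a ring homomorphism phi from S to R', the type 'v set \<Rightarrow>\<^sub>0 'r represents the exterior
   algebra of R' tensored over S with K_S: the basis element e_T, for T = {t_1 < ... < t_p}, is
   the product e_{t_1} ... e_{t_p} of the degree-one generators with d(e_t) = phi(x_t). *)
definition koszul_diff ::
    "(('v::{finite,linorder}, 'k::field) polyn \<Rightarrow> 'r::comm_ring) \<Rightarrow> ('v set \<Rightarrow>\<^sub>0 'r) \<Rightarrow> ('v set \<Rightarrow>\<^sub>0 'r)" where
  "koszul_diff \<phi> x =
     (\<Sum>T\<in>Poly_Mapping.keys x. \<Sum>t\<in>T.
        sgn_pow (int (card {s\<in>T. s < t}))
          (Poly_Mapping.single (T - {t}) (\<phi> (Var t) * Poly_Mapping.lookup x T)))"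

definition koszul_mult ::
    "('v::{finite,linorder} set \<Rightarrow>\<^sub>0 'r::comm_ring) \<Rightarrow> ('v set \<Rightarrow>\<^sub>0 'r) \<Rightarrow> ('v set \<Rightarrow>\<^sub>0 'r)" where
  "koszul_mult x y =
     (\<Sum>T\<in>Poly_Mapping.keys x. \<Sum>U\<in>Poly_Mapping.keys y.
        if T \<inter> U = {}
        then sgn_pow (int (card {(t, u). t \<in> T \<and> u \<in> U \<and> u < t}))
               (Poly_Mapping.single (T \<union> U) (Poly_Mapping.lookup x T * Poly_Mapping.lookup y U))
        else 0)"

definition koszul_dga ::
    "(('v::{finite,linorder}, 'k::field) polyn \<Rightarrow> 'r::comm_ring) \<Rightarrow> ('k, 'v set \<Rightarrow>\<^sub>0 'r) ainf" where
  "koszul_dga \<phi> =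
     \<lparr>scl = (\<lambda>c. pm_scale (\<phi> (Const c))),
      comp = (\<lambda>i. {x. \<forall>T\<in>Poly_Mapping.keys x. int (card T) = i}),
      mul = (\<lambda>xs. case xs of [x] \<Rightarrow> koszul_diff \<phi> x | [x, y] \<Rightarrow> koszul_mult x y | _ \<Rightarrow> 0)\<rparr>"


section \<open>Resolutions\<close>

(* The free module with basis B, graded by the degrees of the basis elements, with operations mu.
   The base ring is S for the resolution F and k for its reduction. *)
definition based_ainf :: "'b set \<Rightarrow> ('b \<Rightarrow> nat) \<Rightarrow> (('b \<Rightarrow>\<^sub>0 's) list \<Rightarrow> ('b \<Rightarrow>\<^sub>0 's)) \<Rightarrow> ('s::comm_ring_1, 'b \<Rightarrow>\<^sub>0 's) ainf" where
  "based_ainf B deg \<mu> =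
     \<lparr>scl = pm_scale,
      comp = (\<lambda>i. {x. \<forall>b\<in>Poly_Mapping.keys x. b \<in> B \<and> int (deg b) = i}),
      mul = \<mu>\<rparr>"

definition free_on :: "'b set \<Rightarrow> ('b \<Rightarrow>\<^sub>0 's::zero) set" where
  "free_on B = {x. Poly_Mapping.keys x \<subseteq> B}"

definition free_deg :: "'b set \<Rightarrow> ('b \<Rightarrow> nat) \<Rightarrow> nat \<Rightarrow> ('b \<Rightarrow>\<^sub>0 's::zero) set" where
  "free_deg B deg i = free_on {b\<in>B. deg b = i}"

definition free_pos :: "'b set \<Rightarrow> ('b \<Rightarrow> nat) \<Rightarrow> ('b \<Rightarrow>\<^sub>0 's::zero) set" where
  "free_pos B deg = free_on {b\<in>B. 0 < deg b}"

(* The submodule (x_1, ..., x_m) F of the free module F on B. *)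
definition vars_submodule :: "'b set \<Rightarrow> ('b \<Rightarrow>\<^sub>0 ('v, 'k::field) polyn) set" where
  "vars_submodule B = module.span pm_scale {pm_scale (Var v) x | v x. x \<in> free_on B}"

definition free_resolution ::
    "'b set \<Rightarrow> ('b \<Rightarrow> nat) \<Rightarrow> (('b \<Rightarrow>\<^sub>0 's::comm_ring_1) \<Rightarrow> ('b \<Rightarrow>\<^sub>0 's)) \<Rightarrow>
     (('b \<Rightarrow>\<^sub>0 's) \<Rightarrow> 'r::comm_ring) \<Rightarrow> ('s \<Rightarrow> 'r) \<Rightarrow> bool" where
  "free_resolution B deg d \<epsilon> \<phi> \<longleftrightarrow>
     (\<forall>x\<in>free_on B. \<forall>y\<in>free_on B. d (x + y) = d x + d y) \<and>
     (\<forall>c. \<forall>x\<in>free_on B. d (pm_scale c x) = pm_scale c (d x)) \<and>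
     (\<forall>x\<in>free_deg B deg 0. d x = 0) \<and>
     (\<forall>i. \<forall>x\<in>free_deg B deg (Suc i). d x \<in> free_deg B deg i) \<and>
     (\<forall>x\<in>free_deg B deg 0. \<forall>y\<in>free_deg B deg 0. \<epsilon> (x + y) = \<epsilon> x + \<epsilon> y) \<and>
     (\<forall>c. \<forall>x\<in>free_deg B deg 0. \<epsilon> (pm_scale c x) = \<phi> c * \<epsilon> x) \<and>
     \<epsilon> ` free_deg B deg 0 = UNIV \<and>
     {x\<in>free_deg B deg 0. \<epsilon> x = 0} = d ` free_deg B deg 1 \<and>
     (\<forall>i. {x\<in>free_deg B deg (Suc i). d x = 0} = d ` free_deg B deg (Suc (Suc i)))"

definition minimal_free_resolution ::
    "'b set \<Rightarrow> ('b \<Rightarrow> nat) \<Rightarrow> (('b \<Rightarrow>\<^sub>0 ('v, 'k::field) polyn) \<Rightarrow> ('b \<Rightarrow>\<^sub>0 ('v, 'k) polyn)) \<Rightarrow>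
     (('b \<Rightarrow>\<^sub>0 ('v, 'k) polyn) \<Rightarrow> 'r::comm_ring) \<Rightarrow> (('v, 'k) polyn \<Rightarrow> 'r) \<Rightarrow> bool" where
  "minimal_free_resolution B deg d \<epsilon> \<phi> \<longleftrightarrow>
     free_resolution B deg d \<epsilon> \<phi> \<and> d ` free_on B \<subseteq> vars_submodule B"

definition ainf_structure_on ::
    "'b set \<Rightarrow> ('b \<Rightarrow> nat) \<Rightarrow> (('b \<Rightarrow>\<^sub>0 's::comm_ring_1) \<Rightarrow> ('b \<Rightarrow>\<^sub>0 's)) \<Rightarrow>
     (('b \<Rightarrow>\<^sub>0 's) list \<Rightarrow> ('b \<Rightarrow>\<^sub>0 's)) \<Rightarrow> bool" where
  "ainf_structure_on B deg d \<mu> \<longleftrightarrow>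
     ainf_algebra (based_ainf B deg \<mu>) \<and> (\<forall>x\<in>free_on B. \<mu> [x] = d x)"

(* F tensored over S with k = S/(x_1, ..., x_m) is the free k-module on the same basis.  By
   S-multilinearity mu_n (x) 1 may be computed on any lifts along the constant-term map. *)
definition reduce :: "('b \<Rightarrow>\<^sub>0 ('v, 'k::field) polyn) \<Rightarrow> ('b \<Rightarrow>\<^sub>0 'k)" where
  "reduce x = Poly_Mapping.map (\<lambda>p. Poly_Mapping.lookup p 0) x"

definition const_lift :: "('b \<Rightarrow>\<^sub>0 'k::field) \<Rightarrow> ('b \<Rightarrow>\<^sub>0 ('v, 'k) polyn)" where
  "const_lift x = Poly_Mapping.map Const x"

definition tensor_k ::
    "'b set \<Rightarrow> ('b \<Rightarrow> nat) \<Rightarrow> (('b \<Rightarrow>\<^sub>0 ('v, 'k::field) polyn) list \<Rightarrow> ('b \<Rightarrow>\<^sub>0 ('v, 'k) polyn)) \<Rightarrow>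
     ('k, 'b \<Rightarrow>\<^sub>0 'k) ainf" where
  "tensor_k B deg \<mu> = based_ainf B deg (\<lambda>xs. reduce (\<mu> (map const_lift xs)))"

(* Minimality of mu_n on V^(x n), for a submodule V of F: since (x_1, ..., x_m) F is a submodule, it
   suffices that mu_n maps all pure tensors into it. *)
definition minimal_op ::
    "'b set \<Rightarrow> ('b \<Rightarrow>\<^sub>0 ('v, 'k::field) polyn) set \<Rightarrow>
     (('b \<Rightarrow>\<^sub>0 ('v, 'k) polyn) list \<Rightarrow> ('b \<Rightarrow>\<^sub>0 ('v, 'k) polyn)) \<Rightarrow> nat \<Rightarrow> bool" where
  "minimal_op B V \<mu> n \<longleftrightarrow> (\<forall>xs. length xs = n \<and> set xs \<subseteq> V \<longrightarrow> \<mu> xs \<in> vars_submodule B)"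

end

(* A defining system for a Massey product is a strictly upper triangular Maurer-Cartan matrix whose
   corner entry is missing, and this notion makes sense in every A_infinity-algebra.  Condition
   (B_r) says that the corner can always be filled in when the matrix has size at most r.  This
   property is invariant under A_infinity-quasi-isomorphisms f: C -> D: the image under f of a
   Maurer-Cartan matrix is Maurer-Cartan, and a Maurer-Cartan matrix over D can be lifted to C, entry
   by entry and up to homotopy, because f is bijective on homology.  Over the algebra F (x) k, whose
   differential vanishes, the corner can always be filled in if and only if the operations mu_n (x) 1
   with n <= r vanish. *)
theory Submission
  imports Defs
begin

text \<open>Signs are absorbed by suspension: rescaled by \<open>shift_exponent\<close>, operations
  act as maps of degree -1 and morphisms as maps of degree 0. A matrix is indexed by an abstract
  relation with a potential \<rho>, its (u, v) entry having degree \<rho> v - \<rho> u - 1; then the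
  values of the operations along all paths from x to y lie in one degree, and the Maurer-Cartan
  expression is a sum over paths. The relation stays abstract because a homotopy is again a block of
  such a matrix, over two copies of the natural numbers. The delicate point is the lift along f.
  Whether the obstruction at an entry maps to a boundary is visible only through the homotopies at
  the smaller entries, so lift and homotopy are built together. Injectivity on homology then solves
  the Maurer-Cartan equation at the entry, and surjectivity corrects the solution by a cycle so that
  the homotopy extends. A set D of degrees treats classes of all degrees and of positive degree
  alike. Its closure under p + q + 1 keeps all entries of a matrix within D once those next to the
  diagonal are.\<close>

lemma sgn_pow_0 [simp]: "sgn_pow e (0::'a::ab_group_add) = 0"
  by (simp add: sgn_pow_def)

lemma sgn_pow_add: "sgn_pow e (x + y) = sgn_pow e x + sgn_pow e (y::'a::ab_group_add)"
  by (simp add: sgn_pow_def)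

lemma sgn_pow_diff: "sgn_pow e (x - y) = sgn_pow e x - sgn_pow e (y::'a::ab_group_add)"
  by (simp add: sgn_pow_def)

lemma sgn_pow_sum: "sgn_pow e (\<Sum>i\<in>I. f i) = (\<Sum>i\<in>I. sgn_pow e (f i :: 'a::ab_group_add))"
  by (simp add: sgn_pow_def sum_negf)

lemma sgn_pow_sgn_pow: "sgn_pow e (sgn_pow e' x) = sgn_pow (e + e') (x::'a::ab_group_add)"
  by (simp add: sgn_pow_def)

lemma sgn_pow_cong: "even (e - e') \<Longrightarrow> sgn_pow e x = sgn_pow e' (x::'a::ab_group_add)"
  by (auto simp: sgn_pow_def)

lemma sgn_pow_zero_exp [simp]: "sgn_pow 0 x = (x::'a::ab_group_add)"
  by (simp add: sgn_pow_def)

lemma sgn_pow_twice: "sgn_pow e (sgn_pow e x) = (x::'a::ab_group_add)"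
  by (simp add: sgn_pow_def)

lemma sgn_pow_eq_0_iff [simp]: "sgn_pow e x = 0 \<longleftrightarrow> (x::'a::ab_group_add) = 0"
  by (simp add: sgn_pow_def)

lemma sgn_pow_Suc: "sgn_pow (e + 1) x = - sgn_pow e (x::'a::ab_group_add)"
  by (simp add: sgn_pow_def)


section \<open>Graded components and multiadditive maps\<close>

lemma total_subspace:
  assumes "graded_free_module A"
  shows "module.subspace (scl A) (total A)"
  using assms unfolding graded_free_module_def total_def by (simp add: module.subspace_span)

lemma comp_subset_total:
  assumes "graded_free_module A"
  shows "comp A i \<subseteq> total A"
  using assms unfolding graded_free_module_def total_def by (metis UN_upper UNIV_I module.span_superset order_trans)

lemma comp_subspace: "graded_free_module A \<Longrightarrow> module.subspace (scl A) (comp A i)"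
  by (simp add: graded_free_module_def)

text \<open>Path sums have only signs as coefficients, so an abelian group version of a submodule
  serves for the components and for the whole graded module alike.\<close>

definition add_closed :: "'a::ab_group_add set \<Rightarrow> bool" where
  "add_closed V \<longleftrightarrow> 0 \<in> V \<and> (\<forall>x\<in>V. \<forall>y\<in>V. x + y \<in> V) \<and> (\<forall>x\<in>V. - x \<in> V)"

lemma add_closedD:
  assumes "add_closed V"
  shows "0 \<in> V" "x \<in> V \<Longrightarrow> y \<in> V \<Longrightarrow> x + y \<in> V" "x \<in> V \<Longrightarrow> - x \<in> V"
    "x \<in> V \<Longrightarrow> y \<in> V \<Longrightarrow> x - y \<in> V" "x \<in> V \<Longrightarrow> sgn_pow e x \<in> V"
  using assms unfolding add_closed_def sgn_pow_def
      apply simp_all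
  by (metis diff_conv_add_uminus)

lemma add_closed_sum:
  assumes "add_closed V" "\<And>i. i \<in> I \<Longrightarrow> f i \<in> V"
  shows "(\<Sum>i\<in>I. f i) \<in> V"
  using assms(2) by (induction I rule: infinite_finite_induct) (simp_all add: add_closedD[OF assms(1)])

lemma add_closed_subspace:
  assumes "module s" "module.subspace s V"
  shows "add_closed V"
  using assms unfolding add_closed_def
  by (auto simp: module.subspace_0 module.subspace_add module.subspace_neg)

lemma add_closed_total: "graded_free_module A \<Longrightarrow> add_closed (total A)"
  by (rule add_closed_subspace[OF _ total_subspace]) (auto simp: graded_free_module_def)

lemma add_closed_comp: "graded_free_module A \<Longrightarrow> add_closed (comp A i)"
  by (rule add_closed_subspace[OF _ comp_subspace]) (auto simp: graded_free_module_def)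

text \<open>No arity occurs: operations of all arities form one function on lists, and path sums mix
  words of different lengths.\<close>

definition multiadd :: "'a::ab_group_add set \<Rightarrow> ('a list \<Rightarrow> 'b::ab_group_add) \<Rightarrow> bool" where
  "multiadd V f \<longleftrightarrow>
     (\<forall>xs ys x y. set xs \<subseteq> V \<and> set ys \<subseteq> V \<and> x \<in> V \<and> y \<in> V \<longrightarrow>
        f (xs @ (x + y) # ys) = f (xs @ x # ys) + f (xs @ y # ys))"

lemma multilinear_multiadd:
  assumes "\<forall>n\<ge>1. multilinear_on s t V n f"
  shows "multiadd V f"
  unfolding multiadd_def
proof (intro allI impI)
  fix xs ys x y
  assume *: "set xs \<subseteq> V \<and> set ys \<subseteq> V \<and> x \<in> V \<and> y \<in> V"
  have "multilinear_on s t V (Suc (length xs + length ys)) f" using assms by simp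
  then show "f (xs @ (x + y) # ys) = f (xs @ x # ys) + f (xs @ y # ys)"
    using * unfolding multilinear_on_def by blast
qed

lemma multiadd_add:
  assumes "multiadd V f" "set xs \<subseteq> V" "set ys \<subseteq> V" "x \<in> V" "y \<in> V"
  shows "f (xs @ (x + y) # ys) = f (xs @ x # ys) + f (xs @ y # ys)"
  using assms unfolding multiadd_def by blast

lemma multiadd_zero:
  assumes "multiadd V f" "add_closed V" "set xs \<subseteq> V" "set ys \<subseteq> V"
  shows "f (xs @ 0 # ys) = 0"
proof -
  have "f (xs @ (0 + 0) # ys) = f (xs @ 0 # ys) + f (xs @ 0 # ys)"
    by (rule multiadd_add[OF assms(1,3,4)]) (simp_all add: add_closedD[OF assms(2)])
  then show ?thesis by simp
qed

lemma multiadd_minus: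
  assumes "multiadd V f" "add_closed V" "set xs \<subseteq> V" "set ys \<subseteq> V" "x \<in> V"
  shows "f (xs @ (- x) # ys) = - f (xs @ x # ys)"
proof -
  have "f (xs @ (x + - x) # ys) = f (xs @ x # ys) + f (xs @ (- x) # ys)"
    by (rule multiadd_add[OF assms(1,3,4)]) (simp_all add: add_closedD[OF assms(2)] assms)
  then have "f (xs @ x # ys) + f (xs @ (- x) # ys) = 0"
    using multiadd_zero[OF assms(1-4)] by simp
  then show ?thesis by (metis add.inverse_unique)
qed

lemma multiadd_diff:
  assumes "multiadd V f" "add_closed V" "set xs \<subseteq> V" "set ys \<subseteq> V" "x \<in> V" "y \<in> V"
  shows "f (xs @ (x - y) # ys) = f (xs @ x # ys) - f (xs @ y # ys)"
proof -
  have "f (xs @ (x + - y) # ys) = f (xs @ x # ys) + f (xs @ (- y) # ys)"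
    by (rule multiadd_add[OF assms(1,3,4)]) (simp_all add: add_closedD[OF assms(2)] assms)
  then show ?thesis using multiadd_minus[OF assms(1-4) assms(6)] by simp
qed

lemma multiadd_sgn_pow:
  assumes "multiadd V f" "add_closed V" "set xs \<subseteq> V" "set ys \<subseteq> V" "x \<in> V"
  shows "f (xs @ sgn_pow e x # ys) = sgn_pow e (f (xs @ x # ys))"
  using multiadd_minus[OF assms] by (simp add: sgn_pow_def)

lemma multiadd_sum:
  assumes "multiadd V f" "add_closed V" "set xs \<subseteq> V" "set ys \<subseteq> V" "\<And>i. i \<in> I \<Longrightarrow> h i \<in> V"
  shows "f (xs @ (\<Sum>i\<in>I. h i) # ys) = (\<Sum>i\<in>I. f (xs @ h i # ys))"
  using assms(5)
proof (induction I rule: infinite_finite_induct)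
  case (insert i I)
  have "(\<Sum>i\<in>I. h i) \<in> V" using insert by (intro add_closed_sum[OF assms(2)]) auto
  then show ?case using insert multiadd_add[OF assms(1,3,4), of "h i" "\<Sum>i\<in>I. h i"] by simp
qed (simp_all add: multiadd_zero[OF assms(1-4)])

text \<open>The full distributive law, one argument at a time from the left; \<open>xs\<close>
  collects the arguments already expanded. An element of the \<open>listset\<close> is a choice of
  one summand in each argument.\<close>

lemma multiadd_listset:
  assumes "multiadd V f" "add_closed V" "set xs \<subseteq> V"
    "\<And>e w. e \<in> set W \<Longrightarrow> w \<in> S e \<Longrightarrow> h w \<in> V"
    "\<And>e. e \<in> set W \<Longrightarrow> finite (S e)"
  shows "f (xs @ map (\<lambda>e. \<Sum>w\<in>S e. h w) W) = (\<Sum>ws\<in>listset (map S W). f (xs @ map h ws))"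
  using assms(3-5)
proof (induction W arbitrary: xs)
  case (Cons e W)
  have sumV: "(\<Sum>w\<in>S e'. h w) \<in> V" if "e' \<in> set (e # W)" for e'
    using Cons.prems(2)[OF that] by (rule add_closed_sum[OF assms(2)])
  have "f (xs @ map (\<lambda>e. \<Sum>w\<in>S e. h w) (e # W)) = (\<Sum>w\<in>S e. f (xs @ h w # map (\<lambda>e. \<Sum>w\<in>S e. h w) W))"
    using multiadd_sum[OF assms(1,2) Cons.prems(1), of "map (\<lambda>e. \<Sum>w\<in>S e. h w) W" "S e" h]
      sumV Cons.prems(2) by auto
  also have "\<dots> = (\<Sum>w\<in>S e. \<Sum>ws\<in>listset (map S W). f ((xs @ [h w]) @ map h ws))"
  proof (rule sum.cong[OF refl])
    fix w assume w: "w \<in> S e"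
    have "f ((xs @ [h w]) @ map (\<lambda>e. \<Sum>w\<in>S e. h w) W) = (\<Sum>ws\<in>listset (map S W). f ((xs @ [h w]) @ map h ws))"
      using Cons.prems w by (intro Cons.IH) auto
    then show "f (xs @ h w # map (\<lambda>e. \<Sum>w\<in>S e. h w) W) = (\<Sum>ws\<in>listset (map S W). f ((xs @ [h w]) @ map h ws))"
      by simp
  qed
  also have "\<dots> = (\<Sum>(w, ws)\<in>S e \<times> listset (map S W). f (xs @ map h (w # ws)))"
    by (simp add: sum.cartesian_product)
  also have "\<dots> = (\<Sum>ws\<in>listset (map S (e # W)). f (xs @ map h ws))"
    by (rule sum.reindex_bij_witness[where i="\<lambda>ws. (hd ws, tl ws)" and j="\<lambda>(w, ws). w # ws"])
       (auto simp: set_Cons_def)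
  finally show ?case .
qed simp


section \<open>Shifted signs\<close>

text \<open>For degrees p_1, ..., p_n this is the sum of (n - i) p_i, the exponent in the decalage
  isomorphism between the tensor power and the tensor power of the suspension.\<close>

fun shift_exponent :: "int list \<Rightarrow> int" where
  "shift_exponent [] = 0"
| "shift_exponent (p # ps) = int (length ps) * p + shift_exponent ps"

lemma shift_exponent_append:
  "shift_exponent (ps @ qs) = shift_exponent ps + int (length qs) * sum_list ps + shift_exponent qs"
  by (induction ps) (simp_all add: algebra_simps)

(* The operation that g induces on the suspension of the graded module. *)
definition shifted :: "('a list \<Rightarrow> 'b::ab_group_add) \<Rightarrow> int list \<Rightarrow> 'a list \<Rightarrow> 'b" where
  "shifted g ps xs = sgn_pow (shift_exponent ps) (g xs)"

lemma homogeneous_total: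
  assumes "graded_free_module A" "homogeneous A ps xs"
  shows "set xs \<subseteq> total A"
  using assms(2) subsetD[OF comp_subset_total[OF assms(1)]] unfolding homogeneous_def
  by (fastforce simp: list_all2_conv_all_nth in_set_conv_nth)

lemma homogeneous_take: "homogeneous A ps xs \<Longrightarrow> homogeneous A (take a ps) (take a xs)"
  unfolding homogeneous_def by (rule list_all2_takeI)

lemma homogeneous_drop: "homogeneous A ps xs \<Longrightarrow> homogeneous A (drop a ps) (drop a xs)"
  unfolding homogeneous_def by (rule list_all2_dropI)

lemma ainf_algebraD:
  assumes "ainf_algebra A"
  shows "graded_free_module A" "multiadd (total A) (mul A)"
    "xs \<noteq> [] \<Longrightarrow> homogeneous A ps xs \<Longrightarrow> mul A xs \<in> comp A (sum_list ps + int (length xs) - 2)"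
    "xs \<noteq> [] \<Longrightarrow> homogeneous A ps xs \<Longrightarrow> stasheff_sum A (mul A) ps xs = 0"
proof -
  show "multiadd (total A) (mul A)"
    using assms unfolding ainf_algebra_def by (intro multilinear_multiadd) blast
qed (use assms in \<open>auto simp: ainf_algebra_def\<close>)

lemma ainf_morphismD:
  assumes "ainf_morphism f A B"
  shows "ainf_algebra A" "ainf_algebra B" "multiadd (total A) f"
    "xs \<noteq> [] \<Longrightarrow> homogeneous A ps xs \<Longrightarrow> f xs \<in> comp B (sum_list ps + int (length xs) - 1)"
    "xs \<noteq> [] \<Longrightarrow> homogeneous A ps xs \<Longrightarrow> stasheff_sum A f ps xs =
        (\<Sum>js\<in>compositions (length xs).
           sgn_pow (comp_exponent js + koszul_exponent js ps) (mul B (map f (blocks js xs))))"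
proof -
  show "multiadd (total A) f"
    using assms unfolding ainf_morphism_def by (intro multilinear_multiadd) blast
qed (use assms in \<open>auto simp: ainf_morphism_def\<close>)

text \<open>An operation has degree -1 on suspensions, where an element of degree p has degree p +
  1. So the only sign left is that of moving the operation past the first a arguments.\<close>

lemma stasheff_sum_shifted:
  assumes A: "ainf_algebra A" and g: "multiadd (total A) g" and xs: "homogeneous A ps xs"
  shows "sgn_pow (shift_exponent ps) (stasheff_sum A g ps xs) =
    (\<Sum>(a, s)\<in>{(a, s). 1 \<le> s \<and> a + s \<le> length xs}.
       sgn_pow (int a + sum_list (take a ps))
         (shifted g (take a ps @ (sum_list (take s (drop a ps)) + int s - 2) # drop (a + s) ps)
            (take a xs @ shifted (mul A) (take s (drop a ps)) (take s (drop a xs)) # drop (a + s) xs)))"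
  unfolding stasheff_sum_def sgn_pow_sum
proof (rule sum.cong[OF refl], clarify)
  fix a s assume as: "1 \<le> s" "a + s \<le> length xs"
  have len: "length ps = length xs" using xs by (simp add: homogeneous_def list_all2_lengthD)
  have gr: "graded_free_module A" using A ainf_algebraD(1) by blast
  define p1 p2 p3 where p: "p1 = take a ps" "p2 = take s (drop a ps)" "p3 = drop (a + s) ps"
  have l: "length p1 = a" "length p2 = s" "length p3 = length xs - a - s"
    using as len by (auto simp: p)
  have ps: "ps = p1 @ p2 @ p3"
    by (simp add: p) (metis add.commute append_take_drop_id drop_drop)
  have h1: "homogeneous A p1 (take a xs)" and h2: "homogeneous A p2 (take s (drop a xs))"
    and h3: "homogeneous A p3 (drop (a + s) xs)"
    unfolding p using xs by (auto intro: homogeneous_take homogeneous_drop)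
  have "take s (drop a xs) \<noteq> []" using as by auto
  from ainf_algebraD(3)[OF A this h2]
  have m: "mul A (take s (drop a xs)) \<in> total A" using comp_subset_total[OF gr] by blast
  have "shifted g (p1 @ (sum_list p2 + int s - 2) # p3) (take a xs @ shifted (mul A) p2 (take s (drop a xs)) # drop (a + s) xs)
     = sgn_pow (shift_exponent (p1 @ (sum_list p2 + int s - 2) # p3) + shift_exponent p2)
         (g (take a xs @ mul A (take s (drop a xs)) # drop (a + s) xs))"
    unfolding shifted_def
    using multiadd_sgn_pow[OF g add_closed_total[OF gr] homogeneous_total[OF gr h1] homogeneous_total[OF gr h3] m]
    by (simp add: sgn_pow_sgn_pow)
  \<comment> \<open>Let t be the length of \<open>p3\<close>. Contracting the middle block to one
    entry changes \<open>shift_exponent\<close>, apart from the exponent of the block itself, by s t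
    plus s - 1 times the degree sum of \<open>p1\<close>, modulo 2. This cancels s t and leaves a
    plus that degree sum.\<close>
  moreover have "sgn_pow (shift_exponent ps) (sgn_pow (int a + int s * int (length xs - a - s) + (int s - 2) * sum_list p1) X)
     = sgn_pow (int a + sum_list p1) (sgn_pow (shift_exponent (p1 @ (sum_list p2 + int s - 2) # p3) + shift_exponent p2) X)" for X
    unfolding sgn_pow_sgn_pow
    by (rule sgn_pow_cong) (simp add: ps shift_exponent_append l algebra_simps)
  ultimately show "sgn_pow (shift_exponent ps) (sgn_pow (int a + int s * int (length xs - a - s) + (int s - 2) * sum_list (take a ps))
          (g (take a xs @ mul A (take s (drop a xs)) # drop (a + s) xs))) =
      sgn_pow (int a + sum_list (take a ps))
         (shifted g (take a ps @ (sum_list (take s (drop a ps)) + int s - 2) # drop (a + s) ps)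
            (take a xs @ shifted (mul A) (take s (drop a ps)) (take s (drop a xs)) # drop (a + s) xs))"
    by (simp add: p)
qed

lemma comp_exponent_Cons: "comp_exponent (i # js) = int (length js) * (int i - 1) + comp_exponent js"
  unfolding comp_exponent_def by (simp add: sum.lessThan_Suc_shift del: sum.lessThan_Suc)

text \<open>All later factors, whose degrees add up to the sum of \<open>js\<close> minus its
  length, move past the arguments of the first one.\<close>

lemma koszul_exponent_Cons:
  "koszul_exponent (i # js) ps =
     (int (sum_list js) - int (length js)) * sum_list (take i ps) + koszul_exponent js (drop i ps)"
proof -
  have "koszul_exponent (i # js) ps =
      (\<Sum>p<length js. (int (js ! p) - 1) * (sum_list (take i ps) + sum_list (take (sum_list (take p js)) (drop i ps))))"
    unfolding koszul_exponent_def by (simp add: sum.lessThan_Suc_shift take_add del: sum.lessThan_Suc)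
  also have "\<dots> = (\<Sum>p<length js. int (js ! p) - 1) * sum_list (take i ps) + koszul_exponent js (drop i ps)"
    by (simp add: koszul_exponent_def distrib_left sum.distrib sum_distrib_right)
  also have "(\<Sum>p<length js. int (js ! p) - 1) = int (sum_list js) - int (length js)"
    by (simp add: sum_subtractf sum_list_sum_nth atLeast0LessThan)
  finally show ?thesis .
qed

lemma length_blocks [simp]: "length (blocks js xs) = length js"
  by (induction js arbitrary: xs) auto

text \<open>A morphism has degree 0 on suspensions, so the right-hand side of its equation must lose
  all signs there. This is the parity count behind it: the last two terms are the exponents of the
  outer operation and of the inner components.\<close>

lemma blocks_exponent:
  assumes "sum_list js = length ps"
  shows "even (shift_exponent ps + comp_exponent js + koszul_exponent js ps
     - shift_exponent (map (\<lambda>qs. sum_list qs + int (length qs) - 1) (blocks js ps))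
     - (\<Sum>qs\<leftarrow>blocks js ps. shift_exponent qs))"
  using assms
proof (induction js arbitrary: ps)
  case Nil
  then show ?case by (simp add: comp_exponent_def koszul_exponent_def)
next
  case (Cons i js)
  define p1 p2 where p: "p1 = take i ps" "p2 = drop i ps"
  have ps: "ps = p1 @ p2" and l: "length p1 = i" "sum_list js = length p2"
    using Cons.prems by (auto simp: p)
  have t: "take i (p1 @ p2) = p1" "drop i (p1 @ p2) = p2" using l by auto
  show ?case using Cons.IH[OF l(2)] l
    unfolding ps blocks.simps t koszul_exponent_Cons comp_exponent_Cons
    by (simp add: shift_exponent_append algebra_simps)
qed

section \<open>Path sums\<close>

fun path :: "('n \<Rightarrow> 'n \<Rightarrow> bool) \<Rightarrow> 'n \<Rightarrow> ('n \<times> 'n) list \<Rightarrow> 'n \<Rightarrow> bool" where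
  "path E x [] y \<longleftrightarrow> x = y"
| "path E x (e # w) y \<longleftrightarrow> fst e = x \<and> E x (snd e) \<and> path E (snd e) w y"

definition paths :: "('n \<Rightarrow> 'n \<Rightarrow> bool) \<Rightarrow> 'n \<Rightarrow> 'n \<Rightarrow> ('n \<times> 'n) list set" where
  "paths E x y = {w. path E x w y}"

text \<open>The edge (u, v) is the place where a Stasheff sum inserts the value of an inner
  operation; \<open>w1\<close> and \<open>w3\<close> carry the untouched arguments.\<close>

definition marked :: "('n \<Rightarrow> 'n \<Rightarrow> bool) \<Rightarrow> 'n \<Rightarrow> 'n \<Rightarrow> (('n \<times> 'n) list \<times> 'n \<times> 'n \<times> ('n \<times> 'n) list) set" where
  "marked E x y = {(w1, u, v, w3). path E x w1 u \<and> E u v \<and> path E v w3 y}"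

lemma path_append: "path E x (w1 @ w2) y \<longleftrightarrow> (\<exists>u. path E x w1 u \<and> path E u w2 y)"
  by (induction w1 arbitrary: x) auto

lemma path_hd: "path E x w y \<Longrightarrow> w \<noteq> [] \<Longrightarrow> fst (hd w) = x"
  by (cases w) auto

lemma path_last: "path E x w y \<Longrightarrow> w \<noteq> [] \<Longrightarrow> snd (last w) = y"
  by (induction w arbitrary: x) (auto split: if_splits)

text \<open>The -1 balances the degree n - 2 of mu_n: along n edges from x to y the degrees add up
  to \<rho> y - \<rho> x - n, so the value of mu_n lies in degree \<rho> y - \<rho> x - 2 for every
  n.\<close>

definition edge_deg :: "('n \<Rightarrow> int) \<Rightarrow> 'n \<times> 'n \<Rightarrow> int" where
  "edge_deg \<rho> e = \<rho> (snd e) - \<rho> (fst e) - 1"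

lemma sum_edge_deg:
  "path E x w y \<Longrightarrow> sum_list (map (edge_deg \<rho>) w) = \<rho> y - \<rho> x - int (length w)"
  by (induction w arbitrary: x) (auto simp: edge_deg_def)

definition weight :: "('a list \<Rightarrow> 'b::ab_group_add) \<Rightarrow> ('n \<Rightarrow> int) \<Rightarrow> ('n \<times> 'n \<Rightarrow> 'a) \<Rightarrow> ('n \<times> 'n) list \<Rightarrow> 'b" where
  "weight g \<rho> a w = shifted g (map (edge_deg \<rho>) w) (map a w)"

definition graded :: "('k, 'a, 'z) ainf_scheme \<Rightarrow> ('n \<Rightarrow> 'n \<Rightarrow> bool) \<Rightarrow> ('n \<Rightarrow> int) \<Rightarrow> ('n \<times> 'n \<Rightarrow> 'a) \<Rightarrow> bool" where
  "graded A E \<rho> a \<longleftrightarrow> (\<forall>u v. E u v \<longrightarrow> a (u, v) \<in> comp A (edge_deg \<rho> (u, v)))"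

(* For g = mul A this is the (x, y) entry of the Maurer-Cartan expression of the matrix a,
   whose (u, v) entry has degree rho v - rho u - 1; for a morphism g it is the (x, y) entry of
   the image of a under g. *)
definition path_sum ::
    "('a list \<Rightarrow> 'b::ab_group_add) \<Rightarrow> ('n \<Rightarrow> 'n \<Rightarrow> bool) \<Rightarrow> ('n \<Rightarrow> int) \<Rightarrow> ('n \<times> 'n \<Rightarrow> 'a) \<Rightarrow> 'n \<times> 'n \<Rightarrow> 'b" where
  "path_sum g E \<rho> a e = (\<Sum>w\<in>paths E (fst e) (snd e). weight g \<rho> a w)"

lemma homogeneous_path:
  "graded A E \<rho> a \<Longrightarrow> path E x w y \<Longrightarrow> homogeneous A (map (edge_deg \<rho>) w) (map a w)"
  by (induction w arbitrary: x) (auto simp: homogeneous_def graded_def)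

text \<open>The constant c is -2 for the operations of an algebra and -1 for the components of a
  morphism.\<close>

lemma weight_comp:
  assumes "graded_free_module B" "graded A E \<rho> a" "path E x w y" "w \<noteq> []"
    "\<And>ps xs. xs \<noteq> [] \<Longrightarrow> homogeneous A ps xs \<Longrightarrow> g xs \<in> comp B (sum_list ps + int (length xs) + c)"
  shows "weight g \<rho> a w \<in> comp B (\<rho> y - \<rho> x + c)"
proof -
  have "g (map a w) \<in> comp B (sum_list (map (edge_deg \<rho>) w) + int (length (map a w)) + c)"
    using assms(4) homogeneous_path[OF assms(2,3)] by (intro assms(5)) auto
  then have "g (map a w) \<in> comp B (\<rho> y - \<rho> x + c)"
    using sum_edge_deg[OF assms(3), of \<rho>] by simp
  then show ?thesis
    unfolding weight_def shifted_def by (rule add_closedD(5)[OF add_closed_comp[OF assms(1)]])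
qed

definition span_word :: "('n \<times> 'n) list \<Rightarrow> 'n \<times> 'n" where
  "span_word w = (fst (hd w), snd (last w))"

lemma span_word_path: "path E x w y \<Longrightarrow> w \<noteq> [] \<Longrightarrow> span_word w = (x, y)"
  by (simp add: span_word_def path_hd path_last)

text \<open>There are two instances: the order of the natural numbers for matrices, and
  \<open>layered\<close> for homotopies between them. Irreflexivity makes every path between related
  vertices nonempty, so that mu_0 never enters.\<close>

locale path_order =
  fixes E :: "'n \<Rightarrow> 'n \<Rightarrow> bool"
  assumes trans: "E x y \<Longrightarrow> E y z \<Longrightarrow> E x z"
    and irrefl: "\<not> E x x"
    and finite_paths: "finite (paths E x y)"
begin

lemma path_rel: "path E x w y \<Longrightarrow> w \<noteq> [] \<Longrightarrow> E x y"
proof (induction w arbitrary: x)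
  case (Cons e w)
  then show ?case by (cases "w = []") (auto intro: trans)
qed simp

lemma path_refl: "path E x w x \<longleftrightarrow> w = []"
  using path_rel irrefl by (metis path.simps(1))

lemma path_edge:
  assumes "path E x w y" "e \<in> set w"
  shows "E (fst e) (snd e)" "fst e = x \<or> E x (fst e)" "snd e = y \<or> E (snd e) y"
    "w \<noteq> [(x, y)] \<Longrightarrow> e \<noteq> (x, y)"
proof -
  obtain w1 w3 where w: "w = w1 @ e # w3" using assms(2) by (metis split_list)
  have p: "path E x w1 (fst e)" "E (fst e) (snd e)" "path E (snd e) w3 y"
    using assms(1) by (auto simp: w path_append)
  show "E (fst e) (snd e)" by (rule p)
  show "fst e = x \<or> E x (fst e)" using p(1) path_rel by (metis path.simps(1))
  show "snd e = y \<or> E (snd e) y" using p(3) path_rel by (metis path.simps(1))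
  show "w \<noteq> [(x, y)] \<Longrightarrow> e \<noteq> (x, y)" using p path_refl by (auto simp: w)
qed

lemma marked_edge:
  assumes "(w1, u, v, w3) \<in> marked E x y"
  shows "E u v" "u = x \<or> E x u" "v = y \<or> E v y" "(u, v) = (x, y) \<longleftrightarrow> w1 = [] \<and> w3 = []"
proof -
  have p: "path E x (w1 @ (u, v) # w3) y" using assms by (auto simp: marked_def path_append)
  have e: "(u, v) \<in> set (w1 @ (u, v) # w3)" by simp
  show "E u v" "u = x \<or> E x u" "v = y \<or> E v y" using path_edge(1-3)[OF p e] by auto
  show "(u, v) = (x, y) \<longleftrightarrow> w1 = [] \<and> w3 = []"
    using assms path_refl by (auto simp: marked_def)
qed

lemma finite_marked: "finite (marked E x y)"
proof (rule finite_subset)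
  show "marked E x y \<subseteq> (\<lambda>(w, k). (take k w, fst (w ! k), snd (w ! k), drop (Suc k) w)) `
      (SIGMA w:paths E x y. {..<length w})"
  proof clarify
    fix w1 u v w3 assume "(w1, u, v, w3) \<in> marked E x y"
    then have "path E x (w1 @ (u, v) # w3) y" by (auto simp: marked_def path_append)
    then show "(w1, u, v, w3) \<in> (\<lambda>(w, k). (take k w, fst (w ! k), snd (w ! k), drop (Suc k) w)) `
      (SIGMA w:paths E x y. {..<length w})"
      by (intro image_eqI[where x="(w1 @ (u, v) # w3, length w1)"]) (auto simp: paths_def)
  qed
qed (auto intro: finite_paths)

lemma sum_marked:
  fixes G :: "('n \<times> 'n) list \<Rightarrow> 'n \<times> 'n \<Rightarrow> ('n \<times> 'n) list \<Rightarrow> 'c::comm_monoid_add"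
  shows "(\<Sum>(w1, u, v, w3)\<in>marked E x y. G w1 (u, v) w3) =
    (\<Sum>w\<in>paths E x y. \<Sum>k<length w. G (take k w) (w ! k) (drop (Suc k) w))"
proof -
  have "(\<Sum>w\<in>paths E x y. \<Sum>k<length w. G (take k w) (w ! k) (drop (Suc k) w)) =
    (\<Sum>(w, k)\<in>(SIGMA w:paths E x y. {..<length w}). G (take k w) (w ! k) (drop (Suc k) w))"
    by (rule sum.Sigma) (auto intro: finite_paths)
  also have "\<dots> = (\<Sum>(w1, u, v, w3)\<in>marked E x y. G w1 (u, v) w3)"
  proof (rule sum.reindex_bij_witness[where i="\<lambda>(w1, u, v, w3). (w1 @ (u, v) # w3, length w1)"
        and j="\<lambda>(w, k). (take k w, fst (w ! k), snd (w ! k), drop (Suc k) w)"], goal_cases)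
    case (2 p)
    then obtain w k where p: "p = (w, k)" "path E x w y" "k < length w" by (auto simp: paths_def)
    have "path E x (take k w @ w ! k # drop (Suc k) w) y" using p by (simp add: id_take_nth_drop[symmetric])
    then show ?case using p(1) by (auto simp: marked_def path_append)
  qed (auto simp: marked_def paths_def path_append id_take_nth_drop[symmetric])
  finally show ?thesis by simp
qed

text \<open>Cutting a nonempty piece out of the middle of a path amounts to marking the edge between
  its endpoints, which exists by transitivity, and choosing a path that refines this edge.\<close>

lemma sum_subwords:
  fixes G :: "('n \<times> 'n) list \<Rightarrow> ('n \<times> 'n) list \<Rightarrow> ('n \<times> 'n) list \<Rightarrow> 'c::comm_monoid_add"
  shows "(\<Sum>w\<in>paths E x y. \<Sum>(a, s)\<in>{(a, s). 1 \<le> s \<and> a + s \<le> length w}.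
      G (take a w) (take s (drop a w)) (drop (a + s) w)) =
    (\<Sum>(w1, u, v, w3)\<in>marked E x y. \<Sum>w2\<in>paths E u v. G w1 w2 w3)"
proof -
  have fin: "finite {(a, s). 1 \<le> s \<and> a + s \<le> n}" for n :: nat
    by (rule finite_subset[of _ "{..n} \<times> {..n}"]) auto
  have "(\<Sum>w\<in>paths E x y. \<Sum>(a, s)\<in>{(a, s). 1 \<le> s \<and> a + s \<le> length w}.
      G (take a w) (take s (drop a w)) (drop (a + s) w)) =
    (\<Sum>(w, as)\<in>(SIGMA w:paths E x y. {(a, s). 1 \<le> s \<and> a + s \<le> length w}).
      G (take (fst as) w) (take (snd as) (drop (fst as) w)) (drop (fst as + snd as) w))"
    using fin by (subst sum.Sigma) (auto intro: finite_paths sum.cong)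
  also have "\<dots> = (\<Sum>((w1, u, v, w3), w2)\<in>(SIGMA m:marked E x y. paths E (fst (snd m)) (fst (snd (snd m)))). G w1 w2 w3)"
  proof (rule sum.reindex_bij_witness[where i="\<lambda>((w1, u, v, w3), w2). (w1 @ w2 @ w3, length w1, length w2)"
        and j="\<lambda>(w, a, s). ((take a w, fst (hd (take s (drop a w))), snd (last (take s (drop a w))), drop (a + s) w),
          take s (drop a w))"], goal_cases)
    case (1 p)
    then obtain w a s where p: "p = (w, a, s)" by (cases p) auto
    have "take a w @ take s (drop a w) @ drop (a + s) w = w"
      by (metis add.commute append_take_drop_id drop_drop)
    then show ?case using 1 by (auto simp: p)
  next
    case (2 p)
    then obtain w a s where p: "p = (w, a, s)" "path E x w y" "1 \<le> s" "a + s \<le> length w"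
      by (cases p) (auto simp: paths_def)
    define w1 w2 w3 where w: "w1 = take a w" "w2 = take s (drop a w)" "w3 = drop (a + s) w"
    have "path E x (w1 @ w2 @ w3) y"
      using p(2) unfolding w by (metis add.commute append_take_drop_id drop_drop)
    then obtain u v where uv: "path E x w1 u" "path E u w2 v" "path E v w3 y" by (auto simp: path_append)
    have ne: "w2 \<noteq> []" using p by (auto simp: w)
    have "fst (hd w2) = u" "snd (last w2) = v" "E u v"
      using uv(2) ne by (auto dest: path_hd path_last path_rel)
    then show ?case using uv unfolding p(1) by (simp add: w[symmetric] marked_def paths_def)
  next
    case (3 q)
    then obtain w1 u v w3 w2 where q: "q = ((w1, u, v, w3), w2)" by (cases q) auto
    with 3 have p: "E u v" "path E u w2 v" by (auto simp: marked_def paths_def)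
    then have "w2 \<noteq> []" using irrefl by auto
    then show ?case using path_hd[OF p(2)] path_last[OF p(2)] by (simp add: q)
  next
    case (4 q)
    then obtain w1 u v w3 w2 where q: "q = ((w1, u, v, w3), w2)" by (cases q) auto
    with 4 have p: "path E x w1 u" "E u v" "path E u w2 v" "path E v w3 y" by (auto simp: marked_def paths_def)
    then have "w2 \<noteq> []" using irrefl by auto
    then show ?case using p by (auto simp: q path_append paths_def Suc_le_eq)
  next
    case (5 p)
    then show ?case by auto
  qed
  also have "\<dots> = (\<Sum>m\<in>marked E x y. \<Sum>w2\<in>paths E (fst (snd m)) (fst (snd (snd m))). G (fst m) w2 (snd (snd (snd m))))"
    by (subst sum.Sigma) (auto intro: finite_paths finite_marked sum.cong)
  also have "\<dots> = (\<Sum>(w1, u, v, w3)\<in>marked E x y. \<Sum>w2\<in>paths E u v. G w1 w2 w3)"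
    by (rule sum.cong) auto
  finally show ?thesis .
qed

lemma path_sum_comp:
  assumes "graded_free_module B" "graded A E \<rho> a" "E x y"
    "\<And>ps xs. xs \<noteq> [] \<Longrightarrow> homogeneous A ps xs \<Longrightarrow> g xs \<in> comp B (sum_list ps + int (length xs) + c)"
  shows "path_sum g E \<rho> a (x, y) \<in> comp B (\<rho> y - \<rho> x + c)"
  unfolding path_sum_def
proof (rule add_closed_sum[OF add_closed_comp[OF assms(1)]])
  fix w assume "w \<in> paths E (fst (x, y)) (snd (x, y))"
  then have w: "path E x w y" by (simp add: paths_def)
  then have "w \<noteq> []" using assms(3) irrefl by auto
  then show "weight g \<rho> a w \<in> comp B (\<rho> y - \<rho> x + c)"
    using weight_comp[OF assms(1,2) w _ assms(4)] by blast
qed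

lemma path_sum_mul_comp:
  assumes "ainf_algebra A" "graded A E \<rho> a" "E x y"
  shows "path_sum (mul A) E \<rho> a (x, y) \<in> comp A (\<rho> y - \<rho> x - 2)"
  using path_sum_comp[OF ainf_algebraD(1)[OF assms(1)] assms(2,3), of "mul A" "-2"]
    ainf_algebraD(3)[OF assms(1)] by simp

lemma graded_path_sum_morphism:
  assumes "ainf_morphism f A B" "graded A E \<rho> a"
  shows "graded B E \<rho> (path_sum f E \<rho> a)"
  unfolding graded_def
  using path_sum_comp[OF ainf_algebraD(1)[OF ainf_morphismD(2)[OF assms(1)]] assms(2), of _ _ f "-1"]
    ainf_morphismD(4)[OF assms(1)] by (simp add: edge_deg_def)

text \<open>The terms are regrouped by the endpoints u and v of the inner word; by additivity of g
  the inner values add up to a path sum. The sign is uniform in each group, because the degrees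
  along \<open>w1\<close> plus its length give \<rho> u - \<rho> x.\<close>

lemma path_sum_stasheff:
  assumes A: "ainf_algebra A" and g: "multiadd (total A) g" and a: "graded A E \<rho> a"
  shows "(\<Sum>w\<in>paths E x y. sgn_pow (shift_exponent (map (edge_deg \<rho>) w))
            (stasheff_sum A g (map (edge_deg \<rho>) w) (map a w))) =
    (\<Sum>(w1, u, v, w3)\<in>marked E x y. sgn_pow (\<rho> u - \<rho> x)
       (shifted g (map (edge_deg \<rho>) w1 @ (\<rho> v - \<rho> u - 2) # map (edge_deg \<rho>) w3)
          (map a w1 @ path_sum (mul A) E \<rho> a (u, v) # map a w3)))"
proof -
  let ?d = "map (edge_deg \<rho>)"
  let ?G = "\<lambda>w1 w2 w3. sgn_pow (int (length w1) + sum_list (?d w1))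
        (shifted g (?d w1 @ (sum_list (?d w2) + int (length w2) - 2) # ?d w3)
          (map a w1 @ weight (mul A) \<rho> a w2 # map a w3))"
  have gr: "graded_free_module A" using A ainf_algebraD(1) by blast
  have tot: "set (map a w) \<subseteq> total A" if "path E u w v" for u v w
    using homogeneous_total[OF gr homogeneous_path[OF a that]] .
  have "(\<Sum>w\<in>paths E x y. sgn_pow (shift_exponent (?d w)) (stasheff_sum A g (?d w) (map a w))) =
    (\<Sum>w\<in>paths E x y. \<Sum>(b, s)\<in>{(b, s). 1 \<le> s \<and> b + s \<le> length w}.
      ?G (take b w) (take s (drop b w)) (drop (b + s) w))"
  proof (rule sum.cong[OF refl])
    fix w assume "w \<in> paths E x y"
    then have "homogeneous A (?d w) (map a w)" using homogeneous_path[OF a] by (auto simp: paths_def)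
    moreover have "length (take b w) = b \<and> length (take s (drop b w)) = s" if "b + s \<le> length w" for b s
      using that by auto
    ultimately show "sgn_pow (shift_exponent (?d w)) (stasheff_sum A g (?d w) (map a w)) =
      (\<Sum>(b, s)\<in>{(b, s). 1 \<le> s \<and> b + s \<le> length w}. ?G (take b w) (take s (drop b w)) (drop (b + s) w))"
      using stasheff_sum_shifted[OF A g]
      by (auto simp: weight_def take_map drop_map simp del: length_take intro!: sum.cong)
  qed
  also have "\<dots> = (\<Sum>(w1, u, v, w3)\<in>marked E x y. \<Sum>w2\<in>paths E u v. ?G w1 w2 w3)"
    by (rule sum_subwords)
  also have "\<dots> = (\<Sum>(w1, u, v, w3)\<in>marked E x y. sgn_pow (\<rho> u - \<rho> x)
       (shifted g (?d w1 @ (\<rho> v - \<rho> u - 2) # ?d w3)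
          (map a w1 @ path_sum (mul A) E \<rho> a (u, v) # map a w3)))"
  proof (rule sum.cong[OF refl], clarify)
    fix w1 u v w3 assume m: "(w1, u, v, w3) \<in> marked E x y"
    then have p: "path E x w1 u" "path E v w3 y" "E u v" by (auto simp: marked_def)
    have W: "weight (mul A) \<rho> a w2 \<in> total A" if "w2 \<in> paths E u v" for w2
    proof -
      have w2: "path E u w2 v" using that by (simp add: paths_def)
      have "w2 \<noteq> []" using w2 p(3) irrefl by auto
      have "weight (mul A) \<rho> a w2 \<in> comp A (\<rho> v - \<rho> u + (-2))"
        by (rule weight_comp[OF gr a w2 \<open>w2 \<noteq> []\<close>]) (use ainf_algebraD(3)[OF A] in auto)
      then show ?thesis using comp_subset_total[OF gr] by blast
    qed
    have "(\<Sum>w2\<in>paths E u v. ?G w1 w2 w3) = (\<Sum>w2\<in>paths E u v. sgn_pow (\<rho> u - \<rho> x)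
       (shifted g (?d w1 @ (\<rho> v - \<rho> u - 2) # ?d w3) (map a w1 @ weight (mul A) \<rho> a w2 # map a w3)))"
      by (rule sum.cong[OF refl]) (auto simp: paths_def sum_edge_deg[OF p(1)] sum_edge_deg[where x=u and y=v])
    also have "\<dots> = sgn_pow (\<rho> u - \<rho> x)
       (shifted g (?d w1 @ (\<rho> v - \<rho> u - 2) # ?d w3) (map a w1 @ path_sum (mul A) E \<rho> a (u, v) # map a w3))"
      unfolding shifted_def sgn_pow_sum[symmetric] path_sum_def
      using multiadd_sum[OF g add_closed_total[OF gr] tot[OF p(1)] tot[OF p(2)], of "paths E u v" "weight (mul A) \<rho> a"] W
      by simp
    finally show "(\<Sum>w2\<in>paths E u v. ?G w1 w2 w3) = sgn_pow (\<rho> u - \<rho> x)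
       (shifted g (?d w1 @ (\<rho> v - \<rho> u - 2) # ?d w3) (map a w1 @ path_sum (mul A) E \<rho> a (u, v) # map a w3))" .
  qed
  finally show ?thesis .
qed

text \<open>The Bianchi identity of the Maurer-Cartan expression. It holds for every matrix of the
  right degrees, Maurer-Cartan or not.\<close>

lemma path_sum_stasheff_zero:
  assumes A: "ainf_algebra A" and a: "graded A E \<rho> a" and xy: "E x y"
  shows "(\<Sum>(w1, u, v, w3)\<in>marked E x y. sgn_pow (\<rho> u - \<rho> x)
       (shifted (mul A) (map (edge_deg \<rho>) w1 @ (\<rho> v - \<rho> u - 2) # map (edge_deg \<rho>) w3)
          (map a w1 @ path_sum (mul A) E \<rho> a (u, v) # map a w3))) = 0"
  unfolding path_sum_stasheff[OF A ainf_algebraD(2)[OF A] a, symmetric]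
proof (rule sum.neutral, rule ballI)
  fix w assume "w \<in> paths E x y"
  then have w: "path E x w y" by (simp add: paths_def)
  then have "w \<noteq> []" using xy irrefl by auto
  then show "sgn_pow (shift_exponent (map (edge_deg \<rho>) w))
            (stasheff_sum A (mul A) (map (edge_deg \<rho>) w) (map a w)) = 0"
    using ainf_algebraD(4)[OF A] homogeneous_path[OF a w] by simp
qed

end

section \<open>Path sums under a morphism\<close>

lemma multiadd_map_sgn_pow:
  assumes "multiadd V f" "add_closed V" "set xs \<subseteq> V" "\<And>w. w \<in> set ws \<Longrightarrow> h w \<in> V"
  shows "f (xs @ map (\<lambda>w. sgn_pow (e w) (h w)) ws) = sgn_pow (\<Sum>w\<leftarrow>ws. e w) (f (xs @ map h ws))"
  using assms(3,4)
proof (induction ws arbitrary: xs)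
  case (Cons w ws)
  have hw: "h w \<in> V" using Cons.prems by simp
  have "f ((xs @ [sgn_pow (e w) (h w)]) @ map (\<lambda>w. sgn_pow (e w) (h w)) ws) =
      sgn_pow (\<Sum>w\<leftarrow>ws. e w) (f ((xs @ [sgn_pow (e w) (h w)]) @ map h ws))"
    using Cons.prems add_closedD(5)[OF assms(2)] by (intro Cons.IH) auto
  moreover have "f (xs @ sgn_pow (e w) (h w) # map h ws) = sgn_pow (e w) (f (xs @ h w # map h ws))"
    using Cons.prems by (intro multiadd_sgn_pow[OF assms(1,2)]) auto
  ultimately show ?case by (simp add: sgn_pow_sgn_pow add.commute)
qed simp

lemma blocks_map: "blocks js (map g xs) = map (map g) (blocks js xs)"
  by (induction js arbitrary: xs) (auto simp: take_map drop_map)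

lemma concat_blocks: "sum_list js = length xs \<Longrightarrow> concat (blocks js xs) = xs"
  by (induction js arbitrary: xs) auto

lemma blocks_concat: "blocks (map length ws) (concat ws) = ws"
  by (induction ws) auto

lemma length_in_blocks: "sum_list js = length xs \<Longrightarrow> map length (blocks js xs) = js"
  by (induction js arbitrary: xs) auto

lemma Nil_notin_blocks: "sum_list js = length xs \<Longrightarrow> 0 \<notin> set js \<Longrightarrow> [] \<notin> set (blocks js xs)"
  by (induction js arbitrary: xs) auto

lemma finite_listset: "(\<And>S. S \<in> set Ss \<Longrightarrow> finite S) \<Longrightarrow> finite (listset Ss)"
proof (induction Ss)
  case (Cons S Ss)
  have "set_Cons S (listset Ss) = (\<lambda>(x, xs). x # xs) ` (S \<times> listset Ss)"
    by (auto simp: set_Cons_def)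
  then show ?case using Cons by simp
qed simp

lemma finite_compositions: "finite (compositions n)"
proof (rule finite_subset)
  have "length js \<le> sum_list js" if "0 \<notin> set js" for js :: "nat list"
    using that by (induction js) auto
  then show "compositions n \<subseteq> {js. set js \<subseteq> {..n} \<and> length js \<le> n}"
    by (auto simp: compositions_def intro: member_le_sum_list)
qed (rule finite_lists_length_le, simp)

context path_order
begin

text \<open>Two descriptions of the same data: a coarse path \<open>W\<close> with a refinement of
  each of its edges, or a fine path cut into nonempty blocks \<open>ws\<close>. The edges of
  \<open>W\<close> join the endpoints of the blocks.\<close>

lemma listset_paths_iff:
  "path E x W y \<and> ws \<in> listset (map (\<lambda>e. paths E (fst e) (snd e)) W) \<longleftrightarrow>
   path E x (concat ws) y \<and> [] \<notin> set ws \<and> W = map span_word ws"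
proof (induction ws arbitrary: x W)
  case Nil
  then show ?case by (cases W) (auto simp: set_Cons_def)
next
  case (Cons w ws)
  show ?case
  proof
    assume L: "path E x W y \<and> w # ws \<in> listset (map (\<lambda>e. paths E (fst e) (snd e)) W)"
    then obtain v W' where W: "W = (x, v) # W'" "E x v" "path E v W' y" "path E x w v"
        "ws \<in> listset (map (\<lambda>e. paths E (fst e) (snd e)) W')"
      by (cases W) (auto simp: set_Cons_def paths_def)
    moreover have "w \<noteq> []" using W irrefl by auto
    ultimately show "path E x (concat (w # ws)) y \<and> [] \<notin> set (w # ws) \<and> W = map span_word (w # ws)"
      using Cons.IH[of v W'] span_word_path[OF W(4)] by (auto simp: path_append)
  next
    assume R: "path E x (concat (w # ws)) y \<and> [] \<notin> set (w # ws) \<and> W = map span_word (w # ws)"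
    then obtain v where v: "path E x w v" "path E v (concat ws) y" "w \<noteq> []" by (auto simp: path_append)
    then show "path E x W y \<and> w # ws \<in> listset (map (\<lambda>e. paths E (fst e) (snd e)) W)"
      using R Cons.IH[of v "map span_word ws"] span_word_path[OF v(1,3)] path_rel[OF v(1,3)]
      by (auto simp: set_Cons_def paths_def)
  qed
qed

text \<open>The sum of the morphism equations over all paths from x to y. Their left-hand sides are
  handled by \<open>path_sum_stasheff\<close>; on the right, a path with a composition of its length
  is a coarse path with refined edges, which is what distributing mu over the entries of the image
  matrix produces.\<close>

lemma path_sum_morphism:
  assumes f: "ainf_morphism f A B" and a: "graded A E \<rho> a" and xy: "E x y"
  shows "path_sum (mul B) E \<rho> (path_sum f E \<rho> a) (x, y) =
    (\<Sum>(w1, u, v, w3)\<in>marked E x y. sgn_pow (\<rho> u - \<rho> x)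
       (shifted f (map (edge_deg \<rho>) w1 @ (\<rho> v - \<rho> u - 2) # map (edge_deg \<rho>) w3)
          (map a w1 @ path_sum (mul A) E \<rho> a (u, v) # map a w3)))"
proof -
  let ?d = "map (edge_deg \<rho>)"
  let ?P = "\<lambda>e. paths E (fst e) (snd e)"
  let ?V = "\<lambda>ws. shifted (mul B) (map (\<lambda>w. sum_list (?d w) + int (length w) - 1) ws) (map (weight f \<rho> a) ws)"
  note A = ainf_morphismD(1)[OF f] and B = ainf_morphismD(2)[OF f]
  note grB = ainf_algebraD(1)[OF B] and mB = ainf_algebraD(2)[OF B]
  have ne: "w \<noteq> []" if "path E u w v" "E u v" for u v w using that irrefl by auto
  have ftot: "f (map a w) \<in> total B" if "path E u w v" "w \<noteq> []" for u v w
    using ainf_morphismD(4)[OF f _ homogeneous_path[OF a that(1)]] that(2) comp_subset_total[OF grB] by blast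
  have term_eq: "sgn_pow (shift_exponent (?d w)) (stasheff_sum A f (?d w) (map a w)) =
      (\<Sum>js\<in>compositions (length w). ?V (blocks js w))" if w: "path E x w y" for w
  proof -
    have "stasheff_sum A f (?d w) (map a w) = (\<Sum>js\<in>compositions (length w).
         sgn_pow (comp_exponent js + koszul_exponent js (?d w)) (mul B (map f (blocks js (map a w)))))"
      using ainf_morphismD(5)[OF f _ homogeneous_path[OF a w]] ne[OF w xy] by simp
    moreover have "sgn_pow (shift_exponent (?d w)) (sgn_pow (comp_exponent js + koszul_exponent js (?d w))
        (mul B (map f (blocks js (map a w))))) = ?V (blocks js w)" if js: "js \<in> compositions (length w)" for js
    proof -
      have sl: "sum_list js = length w" "0 \<notin> set js" using js by (auto simp: compositions_def)
      have nb: "[] \<notin> set (blocks js w)" using sl by (rule Nil_notin_blocks)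
      have pc: "path E x (concat (blocks js w)) y" using concat_blocks[OF sl(1)] w by simp
      have tb: "f (map a b) \<in> total B" if b: "b \<in> set (blocks js w)" for b
      proof -
        obtain ws1 ws2 where "blocks js w = ws1 @ b # ws2" using split_list[OF b] by blast
        then obtain u v where "path E u b v" using pc by (auto simp: path_append)
        then show ?thesis using ftot[of u b v] b nb by auto
      qed
      have "mul B (map (weight f \<rho> a) (blocks js w)) =
          sgn_pow (\<Sum>b\<leftarrow>blocks js w. shift_exponent (?d b)) (mul B (map (\<lambda>b. f (map a b)) (blocks js w)))"
        using multiadd_map_sgn_pow[OF mB add_closed_total[OF grB], of "[]" "blocks js w" "\<lambda>b. f (map a b)"
          "\<lambda>b. shift_exponent (?d b)"] tb by (simp add: weight_def[abs_def] shifted_def)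
      then have "?V (blocks js w) = sgn_pow (shift_exponent (map (\<lambda>w. sum_list (?d w) + int (length w) - 1) (blocks js w))
          + (\<Sum>b\<leftarrow>blocks js w. shift_exponent (?d b))) (mul B (map f (blocks js (map a w))))"
        unfolding shifted_def by (simp add: sgn_pow_sgn_pow blocks_map o_def)
      also have "\<dots> = sgn_pow (shift_exponent (?d w) + (comp_exponent js + koszul_exponent js (?d w))) (mul B (map f (blocks js (map a w))))"
      proof (rule sgn_pow_cong)
        have "even (shift_exponent (?d w) + comp_exponent js + koszul_exponent js (?d w)
          - shift_exponent (map (\<lambda>w. sum_list (?d w) + int (length w) - 1) (blocks js w))
          - (\<Sum>b\<leftarrow>blocks js w. shift_exponent (?d b)))"
          using blocks_exponent[of js "?d w"] sl(1) by (simp add: blocks_map o_def)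
        then show "even (shift_exponent (map (\<lambda>w. sum_list (?d w) + int (length w) - 1) (blocks js w))
          + (\<Sum>b\<leftarrow>blocks js w. shift_exponent (?d b)) - (shift_exponent (?d w) + (comp_exponent js + koszul_exponent js (?d w))))"
          by (auto simp: algebra_simps)
      qed
      finally show ?thesis by (simp add: sgn_pow_sgn_pow)
    qed
    ultimately show ?thesis by (simp add: sgn_pow_sum)
  qed
  have "(\<Sum>(w1, u, v, w3)\<in>marked E x y. sgn_pow (\<rho> u - \<rho> x)
       (shifted f (?d w1 @ (\<rho> v - \<rho> u - 2) # ?d w3)
          (map a w1 @ path_sum (mul A) E \<rho> a (u, v) # map a w3))) =
    (\<Sum>w\<in>paths E x y. \<Sum>js\<in>compositions (length w). ?V (blocks js w))"
    unfolding path_sum_stasheff[OF A ainf_morphismD(3)[OF f] a, symmetric]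
    by (rule sum.cong[OF refl], rule term_eq) (simp add: paths_def)
  also have "\<dots> = (\<Sum>(w, js)\<in>(SIGMA w:paths E x y. compositions (length w)). ?V (blocks js w))"
    by (rule sum.Sigma) (auto intro: finite_paths finite_compositions)
  also have "\<dots> = (\<Sum>(W, ws)\<in>(SIGMA W:paths E x y. listset (map ?P W)). ?V ws)"
  proof (rule sum.reindex_bij_witness[where i="\<lambda>(W, ws). (concat ws, map length ws)"
        and j="\<lambda>(w, js). (map span_word (blocks js w), blocks js w)"], goal_cases)
    case (1 p)
    then show ?case by (auto simp: compositions_def concat_blocks length_in_blocks)
  next
    case (2 p)
    then obtain w js where p: "p = (w, js)" "path E x w y" "sum_list js = length w" "0 \<notin> set js"
      by (auto simp: compositions_def paths_def)
    have "[] \<notin> set (blocks js w)"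
      using p by (intro Nil_notin_blocks)
    then show ?case
      using listset_paths_iff[of x "map span_word (blocks js w)" y "blocks js w"] p
      by (simp add: concat_blocks paths_def)
  next
    case (3 q)
    then obtain W ws where q: "q = (W, ws)" "path E x W y" "ws \<in> listset (map ?P W)" by (auto simp: paths_def)
    then show ?case using listset_paths_iff[of x W y ws] by (simp add: blocks_concat)
  next
    case (4 q)
    then obtain W ws where q: "q = (W, ws)" "path E x W y" "ws \<in> listset (map ?P W)" by (auto simp: paths_def)
    then have c: "path E x (concat ws) y" "[] \<notin> set ws" using listset_paths_iff[of x W y ws] by auto
    then have "ws \<noteq> []" using ne[OF c(1) xy] by auto
    then show ?case using c by (auto simp: q paths_def compositions_def length_concat)
  next
    case (5 p)
    then show ?case by auto
  qed
  also have "\<dots> = (\<Sum>W\<in>paths E x y. \<Sum>ws\<in>listset (map ?P W). ?V ws)"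
    by (rule sum.Sigma[symmetric]) (auto intro!: finite_listset finite_paths)
  also have "\<dots> = (\<Sum>W\<in>paths E x y. weight (mul B) \<rho> (path_sum f E \<rho> a) W)"
  proof (rule sum.cong[OF refl])
    fix W assume "W \<in> paths E x y"
    then have W: "path E x W y" by (simp add: paths_def)
    have deg: "map (\<lambda>w. sum_list (?d w) + int (length w) - 1) ws = ?d W" if ws: "ws \<in> listset (map ?P W)" for ws
    proof -
      have c: "path E x (concat ws) y" "[] \<notin> set ws" "W = map span_word ws"
        using listset_paths_iff[of x W y ws] W ws by auto
      have "sum_list (?d w) + int (length w) - 1 = edge_deg \<rho> (span_word w)" if "w \<in> set ws" for w
      proof -
        obtain ws1 ws2 where "ws = ws1 @ w # ws2" using \<open>w \<in> set ws\<close> by (metis split_list)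
        then obtain u v where uv: "path E u w v" using c(1) by (auto simp: path_append)
        have "w \<noteq> []" using \<open>w \<in> set ws\<close> c(2) by auto
        from span_word_path[OF uv this] sum_edge_deg[OF uv, of \<rho>] show ?thesis by (simp add: edge_deg_def)
      qed
      then show ?thesis unfolding c(3) by simp
    qed
    have "mul B ([] @ map (\<lambda>e. \<Sum>w\<in>?P e. weight f \<rho> a w) W) = (\<Sum>ws\<in>listset (map ?P W). mul B ([] @ map (weight f \<rho> a) ws))"
    proof (rule multiadd_listset[OF mB add_closed_total[OF grB]])
      fix e w assume e: "e \<in> set W" "w \<in> ?P e"
      then have "path E (fst e) w (snd e)" "E (fst e) (snd e)" using path_edge(1)[OF W] by (auto simp: paths_def)
      then show "weight f \<rho> a w \<in> total B"
        using ftot[of "fst e" w "snd e"] ne[of "fst e" w "snd e"] add_closedD(5)[OF add_closed_total[OF grB]]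
        by (simp add: weight_def shifted_def)
    qed (auto intro: finite_paths)
    then show "(\<Sum>ws\<in>listset (map ?P W). ?V ws) = weight (mul B) \<rho> (path_sum f E \<rho> a) W"
      using deg by (simp add: weight_def[of "mul B"] shifted_def sgn_pow_sum[symmetric] path_sum_def[abs_def])
  qed
  finally show ?thesis by (simp add: path_sum_def)
qed

end

section \<open>The two index orders and the linear term of a path sum\<close>

text \<open>Every step raises the rank, so a path into y has bounded length and visits only the
  finitely many vertices of rank at most that of y.\<close>

lemma path_orderI:
  fixes rank :: "'n \<Rightarrow> nat"
  assumes "\<And>x y z. E x y \<Longrightarrow> E y z \<Longrightarrow> E x z" and rank: "\<And>x y. E x y \<Longrightarrow> rank x < rank y"
    and fin: "\<And>n. finite {z. rank z \<le> n}"
  shows "path_order E"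
proof
  fix x y
  have "length w \<le> rank y - rank x \<and> rank x \<le> rank y \<and> set w \<subseteq> {z. rank z \<le> rank y} \<times> {z. rank z \<le> rank y}"
    if "path E x w y" for w
    using that
  proof (induction w arbitrary: x)
    case (Cons e w)
    then have "E x (snd e)" "fst e = x" and IH: "length w \<le> rank y - rank (snd e) \<and> rank (snd e) \<le> rank y \<and>
        set w \<subseteq> {z. rank z \<le> rank y} \<times> {z. rank z \<le> rank y}"
      by auto
    then show ?case using rank[of x "snd e"] by (cases e) auto
  qed simp
  then have "paths E x y \<subseteq> {w. set w \<subseteq> {z. rank z \<le> rank y} \<times> {z. rank z \<le> rank y} \<and> length w \<le> rank y - rank x}"
    by (auto simp: paths_def)
  then show "finite (paths E x y)"
    by (rule finite_subset) (intro finite_lists_length_le finite_cartesian_product fin)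
qed (use assms in \<open>auto dest: rank\<close>)

interpretation nat_order: path_order "(<) :: nat \<Rightarrow> nat \<Rightarrow> bool"
  by (rule path_orderI[where rank=id]) auto

text \<open>Steps never lead back to the layer \<open>False\<close>, which makes the matrices over
  this order block triangular. Steps between layers must also raise the number: one from (False, i)
  to (True, i) would carry a unit, which the algebra need not have, and the difference of the two
  diagonal blocks takes the place of its contribution.\<close>

definition layered :: "bool \<times> nat \<Rightarrow> bool \<times> nat \<Rightarrow> bool" where
  "layered x y \<longleftrightarrow> fst x \<le> fst y \<and> snd x < snd y"

interpretation layer_order: path_order layered
proof (rule path_orderI[where rank=snd])
  show "finite {z :: bool \<times> nat. snd z \<le> n}" for n
    by (rule finite_subset[of _ "UNIV \<times> {..n}"]) auto
qed (auto simp: layered_def)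

text \<open>For an operation the omitted path contributes the differential of the entry at e. Thus
  the Maurer-Cartan equation at e prescribes this differential in terms of the other
  entries.\<close>

definition higher_sum ::
    "('a list \<Rightarrow> 'b::ab_group_add) \<Rightarrow> ('n \<Rightarrow> 'n \<Rightarrow> bool) \<Rightarrow> ('n \<Rightarrow> int) \<Rightarrow> ('n \<times> 'n \<Rightarrow> 'a) \<Rightarrow> 'n \<times> 'n \<Rightarrow> 'b" where
  "higher_sum g E \<rho> a e = (\<Sum>w\<in>paths E (fst e) (snd e) - {[e]}. weight g \<rho> a w)"

lemma graded_path_total:
  assumes "ainf_algebra A" "graded A E \<rho> a" "path E x w y"
  shows "set (map a w) \<subseteq> total A"
  using homogeneous_total[OF ainf_algebraD(1)[OF assms(1)] homogeneous_path[OF assms(2,3)]] .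

lemma graded_total:
  assumes "ainf_algebra A" "graded A E \<rho> a" "E u v"
  shows "a (u, v) \<in> total A"
  using comp_subset_total[OF ainf_algebraD(1)[OF assms(1)]] assms(2,3) unfolding graded_def by blast

context path_order
begin

lemma path_sum_split:
  assumes "E x y"
  shows "path_sum g E \<rho> a (x, y) = g [a (x, y)] + higher_sum g E \<rho> a (x, y)"
proof -
  have "[(x, y)] \<in> paths E x y" using assms by (simp add: paths_def)
  then have "path_sum g E \<rho> a (x, y) = weight g \<rho> a [(x, y)] + higher_sum g E \<rho> a (x, y)"
    unfolding path_sum_def higher_sum_def by (simp add: sum.remove finite_paths)
  then show ?thesis by (simp add: weight_def shifted_def)
qed

lemma higher_sum_cong:
  assumes "\<And>u v. E u v \<Longrightarrow> u = x \<or> E x u \<Longrightarrow> v = y \<or> E v y \<Longrightarrow> (u, v) \<noteq> (x, y) \<Longrightarrow> a (u, v) = a' (u, v)"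
  shows "higher_sum g E \<rho> a (x, y) = higher_sum g E \<rho> a' (x, y)"
  unfolding higher_sum_def
proof (rule sum.cong[OF refl])
  fix w assume "w \<in> paths E (fst (x, y)) (snd (x, y)) - {[(x, y)]}"
  then have w: "path E x w y" "w \<noteq> [(x, y)]" by (auto simp: paths_def)
  have "a e = a' e" if e: "e \<in> set w" for e
    using assms[of "fst e" "snd e"] path_edge[OF w(1) e] w(2) by auto
  then have "map a w = map a' w" by simp
  then show "weight g \<rho> a w = weight g \<rho> a' w" unfolding weight_def by (simp only:)
qed

lemma path_sum_cong:
  assumes "\<And>u v. E u v \<Longrightarrow> u = x \<or> E x u \<Longrightarrow> v = y \<or> E v y \<Longrightarrow> a (u, v) = a' (u, v)"
  shows "path_sum g E \<rho> a (x, y) = path_sum g E \<rho> a' (x, y)"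
  unfolding path_sum_def
proof (rule sum.cong[OF refl])
  fix w assume "w \<in> paths E (fst (x, y)) (snd (x, y))"
  then have w: "path E x w y" by (auto simp: paths_def)
  have "a e = a' e" if e: "e \<in> set w" for e
    using assms[of "fst e" "snd e"] path_edge[OF w e] by auto
  then have "map a w = map a' w" by simp
  then show "weight g \<rho> a w = weight g \<rho> a' w" unfolding weight_def by (simp only:)
qed

text \<open>Only the path consisting of the marked edge alone survives, and for it all signs are
  trivial.\<close>

lemma marked_sum_corner:
  fixes \<rho> :: "'n \<Rightarrow> int"
  assumes A: "ainf_algebra A" and g: "multiadd (total A) g" and a: "graded A E \<rho> a" and xy: "E x y"
    and zero: "\<And>u v. E u v \<Longrightarrow> u = x \<or> E x u \<Longrightarrow> v = y \<or> E v y \<Longrightarrow> (u, v) \<noteq> (x, y) \<Longrightarrow> c (u, v) = 0"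
  shows "(\<Sum>(w1, u, v, w3)\<in>marked E x y. sgn_pow (\<rho> u - \<rho> x)
       (shifted g (map (edge_deg \<rho>) w1 @ (\<rho> v - \<rho> u - 2) # map (edge_deg \<rho>) w3)
          (map a w1 @ c (u, v) # map a w3))) = g [c (x, y)]"
    (is "(\<Sum>m\<in>_. ?T m) = _")
proof -
  have "([], x, y, []) \<in> marked E x y" using xy by (simp add: marked_def)
  then have "(\<Sum>m\<in>marked E x y. ?T m) = ?T ([], x, y, []) + (\<Sum>m\<in>marked E x y - {([], x, y, [])}. ?T m)"
    by (rule sum.remove[OF finite_marked])
  also have "(\<Sum>m\<in>marked E x y - {([], x, y, [])}. ?T m) = 0"
  proof (rule sum.neutral, rule ballI)
    fix m assume "m \<in> marked E x y - {([], x, y, [])}"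
    then obtain w1 u v w3 where m': "m = (w1, u, v, w3)"
        and m: "(w1, u, v, w3) \<in> marked E x y" "(w1, u, v, w3) \<noteq> ([], x, y, [])"
      by (cases m) auto
    have p: "path E x w1 u" "path E v w3 y" using m(1) by (auto simp: marked_def)
    have "c (u, v) = 0" using zero marked_edge[OF m(1)] m(2) by auto
    then have "g (map a w1 @ c (u, v) # map a w3) = 0"
      using multiadd_zero[OF g add_closed_total[OF ainf_algebraD(1)[OF A]]
        graded_path_total[OF A a p(1)] graded_path_total[OF A a p(2)]] by simp
    then show "?T m = 0"
      by (simp add: shifted_def m')
  qed
  finally show ?thesis by (simp add: shifted_def)
qed

text \<open>In the Bianchi identity every term but the corner vanishes. This is the reason why a
  Massey product consists of homology classes.\<close>

lemma path_sum_cycle: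
  assumes A: "ainf_algebra A" and a: "graded A E \<rho> a" and xy: "E x y"
    and zero: "\<And>u v. E u v \<Longrightarrow> u = x \<or> E x u \<Longrightarrow> v = y \<or> E v y \<Longrightarrow> (u, v) \<noteq> (x, y) \<Longrightarrow>
       path_sum (mul A) E \<rho> a (u, v) = 0"
  shows "mul A [path_sum (mul A) E \<rho> a (x, y)] = 0"
  using marked_sum_corner[where c="path_sum (mul A) E \<rho> a", OF A ainf_algebraD(2)[OF A] a xy zero] path_sum_stasheff_zero[OF A a xy] by simp

lemma path_sum_morphism_corner:
  assumes f: "ainf_morphism f A B" and a: "graded A E \<rho> a" and xy: "E x y"
    and zero: "\<And>u v. E u v \<Longrightarrow> u = x \<or> E x u \<Longrightarrow> v = y \<or> E v y \<Longrightarrow> (u, v) \<noteq> (x, y) \<Longrightarrow>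
       path_sum (mul A) E \<rho> a (u, v) = 0"
  shows "path_sum (mul B) E \<rho> (path_sum f E \<rho> a) (x, y) = f [path_sum (mul A) E \<rho> a (x, y)]"
  unfolding path_sum_morphism[OF f a xy]
  using marked_sum_corner[where c="path_sum (mul A) E \<rho> a", OF ainf_morphismD(1)[OF f] ainf_morphismD(3)[OF f] a xy zero] by simp

text \<open>Along each path the entries of \<open>b1\<close> are exchanged for those of
  \<open>b0\<close> one edge at a time, beginning on the left; each summand is the difference of two
  consecutive hybrids \<open>?Z\<close>.\<close>

lemma path_sum_telescope:
  assumes A: "ainf_algebra A" and b0: "graded A E \<rho> b0" and b1: "graded A E \<rho> b1"
  shows "(\<Sum>(w1, u, v, w3)\<in>marked E x y. shifted (mul A) (map (edge_deg \<rho>) (w1 @ (u, v) # w3))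
      (map b0 w1 @ (b1 (u, v) - b0 (u, v)) # map b1 w3)) =
    path_sum (mul A) E \<rho> b1 (x, y) - path_sum (mul A) E \<rho> b0 (x, y)"
proof -
  let ?Y = "\<lambda>w1 e w3. shifted (mul A) (map (edge_deg \<rho>) (w1 @ e # w3)) (map b0 w1 @ (b1 e - b0 e) # map b1 w3)"
  have "(\<Sum>(w1, u, v, w3)\<in>marked E x y. ?Y w1 (u, v) w3) =
     (\<Sum>w\<in>paths E x y. \<Sum>k<length w. ?Y (take k w) (w ! k) (drop (Suc k) w))"
    by (rule sum_marked)
  also have "\<dots> = (\<Sum>w\<in>paths E x y. weight (mul A) \<rho> b1 w - weight (mul A) \<rho> b0 w)"
  proof (rule sum.cong[OF refl])
    fix w assume "w \<in> paths E x y"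
    then have w: "path E x w y" by (simp add: paths_def)
    let ?Z = "\<lambda>k. shifted (mul A) (map (edge_deg \<rho>) w) (map b0 (take k w) @ map b1 (drop k w))"
    have "(\<Sum>k<length w. ?Y (take k w) (w ! k) (drop (Suc k) w)) = (\<Sum>k<length w. ?Z k - ?Z (Suc k))"
    proof (rule sum.cong[OF refl])
      fix k assume "k \<in> {..<length w}"
      then have k: "k < length w" by simp
      have id: "take k w @ w ! k # drop (Suc k) w = w" using id_take_nth_drop[OF k] by simp
      have "path E x (take k w @ w ! k # drop (Suc k) w) y" using w by (simp add: id)
      then obtain u where p: "path E x (take k w) u" "E u (snd (w ! k))" "fst (w ! k) = u"
          "path E (snd (w ! k)) (drop (Suc k) w) y"
        by (auto simp: path_append)
      then have e: "E (fst (w ! k)) (snd (w ! k))" by simp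
      have "mul A (map b0 (take k w) @ (b1 (w ! k) - b0 (w ! k)) # map b1 (drop (Suc k) w)) =
        mul A (map b0 (take k w) @ b1 (w ! k) # map b1 (drop (Suc k) w)) -
        mul A (map b0 (take k w) @ b0 (w ! k) # map b1 (drop (Suc k) w))"
        using graded_total[OF A b1 e] graded_total[OF A b0 e]
        by (intro multiadd_diff[OF ainf_algebraD(2)[OF A] add_closed_total[OF ainf_algebraD(1)[OF A]]
           graded_path_total[OF A b0 p(1)] graded_path_total[OF A b1 p(4)]]) auto
      moreover have "map b1 (drop k w) = b1 (w ! k) # map b1 (drop (Suc k) w)"
        using k by (simp add: Cons_nth_drop_Suc[symmetric])
      moreover have "map b0 (take (Suc k) w) = map b0 (take k w) @ [b0 (w ! k)]"
        using k by (simp add: take_Suc_conv_app_nth)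
      ultimately show "?Y (take k w) (w ! k) (drop (Suc k) w) = ?Z k - ?Z (Suc k)"
        unfolding id shifted_def by (simp add: sgn_pow_diff)
    qed
    also have "\<dots> = ?Z 0 - ?Z (length w)" by (rule sum_lessThan_telescope')
    finally show "(\<Sum>k<length w. ?Y (take k w) (w ! k) (drop (Suc k) w)) = weight (mul A) \<rho> b1 w - weight (mul A) \<rho> b0 w"
      by (simp add: weight_def)
  qed
  finally show ?thesis by (simp add: path_sum_def sum_subtractf)
qed

end

section \<open>Homotopies\<close>

(* A homotopy h between Maurer-Cartan matrices b0 and b1 is encoded as the off-diagonal block of
   the Maurer-Cartan matrix ((b0, h), (0, b1)). *)
definition cylinder :: "(nat \<times> nat \<Rightarrow> 'a) \<Rightarrow> (nat \<times> nat \<Rightarrow> 'a) \<Rightarrow> (nat \<times> nat \<Rightarrow> 'a) \<Rightarrow> (bool \<times> nat) \<times> (bool \<times> nat) \<Rightarrow> 'a" where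
  "cylinder b0 h b1 e = (if fst (fst e) = fst (snd e) then if fst (fst e) then b1 else b0 else h)
     (snd (fst e), snd (snd e))"

text \<open>Raising the layer \<open>True\<close> by 1 puts \<open>h (u, v)\<close> into degree
  \<rho> v - \<rho> u, one above the entries of the diagonal blocks, as befits a homotopy.\<close>

definition cylinder_pot :: "(nat \<Rightarrow> int) \<Rightarrow> bool \<times> nat \<Rightarrow> int" where
  "cylinder_pot \<rho> x = \<rho> (snd x) + (if fst x then 1 else 0)"

definition layer :: "bool \<Rightarrow> (nat \<times> nat) list \<Rightarrow> ((bool \<times> nat) \<times> (bool \<times> nat)) list" where
  "layer c = map (\<lambda>e. ((c, fst e), (c, snd e)))"

lemma path_layer_iff:
  "path layered (c, i) w (c, j) \<longleftrightarrow> (\<exists>w'. w = layer c w' \<and> path (<) i w' j)"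
proof (induction w arbitrary: i)
  case Nil
  then show ?case by (auto simp: layer_def)
next
  case (Cons e w)
  show ?case
  proof
    assume L: "path layered (c, i) (e # w) (c, j)"
    obtain c' k where k: "snd e = (c', k)" by (cases "snd e")
    have e: "fst e = (c, i)" "c \<le> c'" "i < k" "path layered (c', k) w (c, j)"
      using L by (auto simp: k layered_def)
    have "c' \<le> c" using e(4) layer_order.path_rel[OF e(4)] by (cases "w = []") (auto simp: layered_def)
    then have "c' = c" using e(2) by auto
    then obtain w' where "w = layer c w'" "path (<) k w' j" using Cons.IH[of k] e(4) by auto
    then show "\<exists>w'. e # w = layer c w' \<and> path (<) i w' j"
      using e k \<open>c' = c\<close> by (intro exI[of _ "(i, k) # w'"]) (auto simp: layer_def prod_eq_iff)
  next
    assume "\<exists>w'. e # w = layer c w' \<and> path (<) i w' j"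
    then obtain e' w' where e: "e = ((c, fst e'), (c, snd e'))" and w: "w = layer c w'" "path (<) i (e' # w') j"
      by (auto simp: layer_def map_eq_Cons_conv)
    have "path layered (c, snd e') w (c, j)" using Cons.IH[of "snd e'"] w by auto
    moreover have "layered (c, i) (c, snd e')" using w by (simp add: layered_def)
    ultimately show "path layered (c, i) (e # w) (c, j)" using e w by simp
  qed
qed

lemma layer_inj: "layer c w = layer c w' \<longleftrightarrow> w = w'"
  unfolding layer_def by (rule inj_map_eq_map) (auto simp: inj_def prod_eq_iff)

lemma layer_edge_deg: "map (edge_deg (cylinder_pot \<rho>)) (layer c w) = map (edge_deg \<rho>) w"
  by (simp add: layer_def edge_deg_def cylinder_pot_def)

lemma layer_cylinder: "map (cylinder b0 h b1) (layer c w) = map (if c then b1 else b0) w"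
  by (simp add: layer_def cylinder_def)

lemma path_sum_layer:
  "path_sum g layered (cylinder_pot \<rho>) (cylinder b0 h b1) ((c, i), (c, j)) =
   path_sum g (<) \<rho> (if c then b1 else b0) (i, j)"
  unfolding path_sum_def
proof (rule sum.reindex_cong[where l="layer c"])
  show "inj_on (layer c) (paths (<) (fst (i, j)) (snd (i, j)))" by (simp add: inj_on_def layer_inj)
  show "paths layered (fst ((c, i), c, j)) (snd ((c, i), c, j)) = layer c ` paths (<) (fst (i, j)) (snd (i, j))"
    using path_layer_iff by (auto simp: paths_def)
qed (simp add: weight_def layer_edge_deg layer_cylinder)

lemma graded_cylinder:
  assumes "graded A (<) \<rho> b0" "graded A (<) \<rho> b1" "\<And>u v. u < v \<Longrightarrow> h (u, v) \<in> comp A (\<rho> v - \<rho> u)"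
  shows "graded A layered (cylinder_pot \<rho>) (cylinder b0 h b1)"
  using assms by (auto simp: graded_def layered_def cylinder_def cylinder_pot_def edge_deg_def)

text \<open>The equation of a homotopy reads \<open>b1 - b0 = homotopy_sum\<close>. The sign cancels
  the dependence on u of the sign \<rho> u - \<rho> x in the Bianchi identity, so that the latter
  can be compared with \<open>path_sum_telescope\<close>, which has no such sign.\<close>

definition homotopy_sum ::
    "('k, 'a::ab_group_add, 'z) ainf_scheme \<Rightarrow> (nat \<Rightarrow> int) \<Rightarrow> (nat \<times> nat \<Rightarrow> 'a) \<Rightarrow> (nat \<times> nat \<Rightarrow> 'a) \<Rightarrow> (nat \<times> nat \<Rightarrow> 'a) \<Rightarrow> nat \<times> nat \<Rightarrow> 'a" where
  "homotopy_sum A \<rho> b0 h b1 e = sgn_pow (\<rho> (fst e))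
     (path_sum (mul A) layered (cylinder_pot \<rho>) (cylinder b0 h b1) ((False, fst e), (True, snd e)))"

lemma homotopy_sum_comp:
  assumes "ainf_algebra A" "graded A (<) \<rho> b0" "graded A (<) \<rho> b1"
    "\<And>u v. u < v \<Longrightarrow> h (u, v) \<in> comp A (\<rho> v - \<rho> u)" "i < j"
  shows "homotopy_sum A \<rho> b0 h b1 (i, j) \<in> comp A (edge_deg \<rho> (i, j))"
proof -
  have "path_sum (mul A) layered (cylinder_pot \<rho>) (cylinder b0 h b1) ((False, i), (True, j)) \<in>
      comp A (cylinder_pot \<rho> (True, j) - cylinder_pot \<rho> (False, i) - 2)"
    by (rule layer_order.path_sum_mul_comp[OF assms(1) graded_cylinder[OF assms(2-4)]])
       (auto simp: layered_def assms)
  then show ?thesis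
    unfolding homotopy_sum_def
    using add_closedD(5)[OF add_closed_comp[OF ainf_algebraD(1)[OF assms(1)]]]
    by (simp add: cylinder_pot_def edge_deg_def)
qed

text \<open>The Bianchi identity of the cylinder says that inserting \<open>homotopy_sum\<close>
  between entries of \<open>b0\<close> and of \<open>b1\<close> gives 0, while inserting
  \<open>b1 - b0\<close> gives the left-hand side by telescoping. The two insertions agree away from
  the corner, so only the differential of their difference at the corner remains.\<close>

lemma homotopy_corner:
  assumes A: "ainf_algebra A" and b0: "graded A (<) \<rho> b0" and b1: "graded A (<) \<rho> b1"
    and h: "\<And>u v. u < v \<Longrightarrow> h (u, v) \<in> comp A (\<rho> v - \<rho> u)" and ij: "i < j"
    and zero: "\<And>u v. i \<le> u \<Longrightarrow> u < v \<Longrightarrow> v \<le> j \<Longrightarrow> (u, v) \<noteq> (i, j) \<Longrightarrow>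
        path_sum (mul A) (<) \<rho> b0 (u, v) = 0 \<and> path_sum (mul A) (<) \<rho> b1 (u, v) = 0 \<and>
        b1 (u, v) - b0 (u, v) = homotopy_sum A \<rho> b0 h b1 (u, v)"
  shows "path_sum (mul A) (<) \<rho> b1 (i, j) - path_sum (mul A) (<) \<rho> b0 (i, j) =
    mul A [b1 (i, j) - b0 (i, j) - homotopy_sum A \<rho> b0 h b1 (i, j)]"
proof -
  let ?c = "homotopy_sum A \<rho> b0 h b1"
  let ?C = "cylinder b0 h b1" and ?\<rho> = "cylinder_pot \<rho>"
  let ?d = "map (edge_deg \<rho>)" and ?D = "map (edge_deg (cylinder_pot \<rho>))"
  let ?M = "marked (<) i j"
  let ?lift = "\<lambda>(w1, u, v, w3). (layer False w1, (False, u), (True, v), layer True w3)"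
  let ?T = "\<lambda>(w1, x, y, w3). sgn_pow (?\<rho> x - ?\<rho> (False, i))
       (shifted (mul A) (?D w1 @ (?\<rho> y - ?\<rho> x - 2) # ?D w3)
          (map ?C w1 @ path_sum (mul A) layered ?\<rho> ?C (x, y) # map ?C w3))"
  let ?X = "\<lambda>(w1, u, v, w3). shifted (mul A) (?d (w1 @ (u, v) # w3)) (map b0 w1 @ ?c (u, v) # map b1 w3)"
  let ?Y = "\<lambda>(w1, u, v, w3). shifted (mul A) (?d (w1 @ (u, v) # w3)) (map b0 w1 @ (b1 (u, v) - b0 (u, v)) # map b1 w3)"
  note gr = ainf_algebraD(1)[OF A] and mA = ainf_algebraD(2)[OF A]
  note clT = add_closed_total[OF gr]
  have C: "graded A layered ?\<rho> ?C" by (rule graded_cylinder[OF b0 b1 h])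
  have ctot: "?c (u, v) \<in> total A" if "u < v" for u v
    using homotopy_sum_comp[OF A b0 b1 h that] comp_subset_total[OF gr] by blast
  have lift: "?lift m \<in> marked layered (False, i) (True, j)" if "m \<in> ?M" for m
    using that path_layer_iff by (auto simp: marked_def layered_def)
  have "(\<Sum>m\<in>marked layered (False, i) (True, j). ?T m) = 0"
    by (rule layer_order.path_sum_stasheff_zero[OF A C]) (simp add: layered_def ij)
  also have "(\<Sum>m\<in>marked layered (False, i) (True, j). ?T m) = (\<Sum>m\<in>?lift ` ?M. ?T m)"
  proof (rule sum.mono_neutral_right)
    show "finite (marked layered (False, i) (True, j))" by (rule layer_order.finite_marked)
    show "?lift ` ?M \<subseteq> marked layered (False, i) (True, j)" using lift by blast
    show "\<forall>m\<in>marked layered (False, i) (True, j) - ?lift ` ?M. ?T m = 0"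
    proof
      fix m assume m: "m \<in> marked layered (False, i) (True, j) - ?lift ` ?M"
      obtain w1 cx u cy v w3 where m': "m = (w1, (cx, u), (cy, v), w3)" by (cases m) auto
      have p: "path layered (False, i) w1 (cx, u)" "layered (cx, u) (cy, v)" "path layered (cy, v) w3 (True, j)"
        using m by (auto simp: m' marked_def)
      have iu: "(False, i) = (cx, u) \<or> layered (False, i) (cx, u)" and vj: "(cy, v) = (True, j) \<or> layered (cy, v) (True, j)"
        using p(1,3) layer_order.path_rel by (metis path.simps(1))+
      have cc: "cx = cy"
      proof (rule ccontr)
        assume "cx \<noteq> cy"
        then have c: "cx = False" "cy = True" using p(2) by (auto simp: layered_def)
        then obtain w1' w3' where "w1 = layer False w1'" "path (<) i w1' u" "w3 = layer True w3'" "path (<) v w3' j"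
          using p path_layer_iff by blast
        then have "m = ?lift (w1', u, v, w3')" "(w1', u, v, w3') \<in> ?M"
          using p(2) by (auto simp: m' c marked_def layered_def)
        then show False using m by blast
      qed
      \<comment> \<open>A marked edge inside one layer does not stretch from i to j, since the path
        also has to change layers, by a step that raises the number. So the Maurer-Cartan equations
        away from the corner apply.\<close>
      have "path_sum (mul A) layered ?\<rho> ?C ((cx, u), (cy, v)) = 0"
        using zero[of u v] iu vj p(2) unfolding cc path_sum_layer by (cases cy) (auto simp: layered_def)
      then show "?T m = 0"
        using multiadd_zero[OF mA clT graded_path_total[OF A C p(1)] graded_path_total[OF A C p(3)]]
        by (simp add: m' shifted_def)
    qed
  qed
  also have "\<dots> = (\<Sum>m\<in>?M. ?T (?lift m))"
    by (subst sum.reindex) (auto simp: inj_on_def layer_inj)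
  also have "\<dots> = (\<Sum>m\<in>?M. sgn_pow (\<rho> i) (?X m))"
  proof (rule sum.cong[OF refl])
    fix m assume "m \<in> ?M"
    then obtain w1 u v w3 where m: "m = (w1, u, v, w3)" and p: "path (<) i w1 u" "u < v" "path (<) v w3 j"
      by (cases m) (auto simp: marked_def)
    have "path_sum (mul A) layered ?\<rho> ?C ((False, u), (True, v)) = sgn_pow (\<rho> u) (?c (u, v))"
      by (simp add: homotopy_sum_def sgn_pow_twice)
    then have "mul A (map b0 w1 @ path_sum (mul A) layered ?\<rho> ?C ((False, u), (True, v)) # map b1 w3) =
        sgn_pow (\<rho> u) (mul A (map b0 w1 @ ?c (u, v) # map b1 w3))"
      using multiadd_sgn_pow[OF mA clT graded_path_total[OF A b0 p(1)] graded_path_total[OF A b1 p(3)] ctot[OF p(2)]]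
      by simp
    moreover have "?\<rho> (True, v) - ?\<rho> (False, u) - 2 = edge_deg \<rho> (u, v)"
      by (simp add: cylinder_pot_def edge_deg_def)
    ultimately show "?T (?lift m) = sgn_pow (\<rho> i) (?X m)"
      by (simp add: m layer_edge_deg layer_cylinder shifted_def sgn_pow_sgn_pow)
         (rule sgn_pow_cong, simp add: cylinder_pot_def)
  qed
  finally have X: "(\<Sum>m\<in>?M. ?X m) = 0" by (simp add: sgn_pow_sum[symmetric])
  have Y: "(\<Sum>m\<in>?M. ?Y m) = path_sum (mul A) (<) \<rho> b1 (i, j) - path_sum (mul A) (<) \<rho> b0 (i, j)"
    by (rule nat_order.path_sum_telescope[OF A b0 b1])
  have m0: "([], i, j, []) \<in> ?M" using ij by (simp add: marked_def)
  have "(\<Sum>m\<in>?M. ?Y m - ?X m) = (?Y ([], i, j, []) - ?X ([], i, j, [])) + (\<Sum>m\<in>?M - {([], i, j, [])}. ?Y m - ?X m)"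
    by (rule sum.remove[OF nat_order.finite_marked m0])
  also have "(\<Sum>m\<in>?M - {([], i, j, [])}. ?Y m - ?X m) = 0"
  proof (rule sum.neutral, rule ballI)
    fix m assume "m \<in> ?M - {([], i, j, [])}"
    then obtain w1 u v w3 where m': "m = (w1, u, v, w3)"
        and m: "(w1, u, v, w3) \<in> ?M" "(w1, u, v, w3) \<noteq> ([], i, j, [])"
      by (cases m) auto
    have "i \<le> u" "u < v" "v \<le> j" "(u, v) \<noteq> (i, j)"
      using nat_order.marked_edge[OF m(1)] m(2) by auto
    then have "b1 (u, v) - b0 (u, v) = ?c (u, v)" using zero by blast
    then show "?Y m - ?X m = 0" by (simp add: m')
  qed
  also have "?Y ([], i, j, []) - ?X ([], i, j, []) + 0 = mul A [b1 (i, j) - b0 (i, j)] - mul A [?c (i, j)]"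
    by (simp add: shifted_def)
  also have "\<dots> = mul A [b1 (i, j) - b0 (i, j) - ?c (i, j)]"
    using multiadd_diff[OF mA clT, of "[]" "[]" "b1 (i, j) - b0 (i, j)" "?c (i, j)"]
      ctot[OF ij] graded_total[OF A b0, of i j] graded_total[OF A b1, of i j] ij add_closedD(4)[OF clT] by simp
  finally show ?thesis using X Y by (simp add: sum_subtractf)
qed

section \<open>Quasi-isomorphisms\<close>

lemma mul_single_comp:
  assumes "ainf_algebra A" "x \<in> comp A p"
  shows "mul A [x] \<in> comp A (p - 1)"
  using ainf_algebraD(3)[OF assms(1), of "[x]" "[p]"] assms(2) by (simp add: homogeneous_def)

lemma morphism_single_comp:
  assumes "ainf_morphism f A B" "x \<in> comp A p"
  shows "f [x] \<in> comp B p"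
  using ainf_morphismD(4)[OF assms(1), of "[x]" "[p]"] assms(2) by (simp add: homogeneous_def)

lemma multiadd_single:
  assumes "multiadd V f" "add_closed V"
  shows "f [0] = 0" "x \<in> V \<Longrightarrow> y \<in> V \<Longrightarrow> f [x + y] = f [x] + f [y]" "x \<in> V \<Longrightarrow> y \<in> V \<Longrightarrow> f [x - y] = f [x] - f [y]"
    "x \<in> V \<Longrightarrow> f [- x] = - f [x]" "x \<in> V \<Longrightarrow> f [sgn_pow k x] = sgn_pow k (f [x])"
  using multiadd_zero[OF assms, of "[]" "[]"] multiadd_add[OF assms(1), of "[]" "[]" x y]
    multiadd_diff[OF assms, of "[]" "[]" x y] multiadd_minus[OF assms, of "[]" "[]" x]
    multiadd_sgn_pow[OF assms, of "[]" "[]" x k]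
  by simp_all

lemma comp_in_total: "ainf_algebra A \<Longrightarrow> x \<in> comp A p \<Longrightarrow> x \<in> total A"
  using comp_subset_total ainf_algebraD(1) by blast

lemma mul_single:
  assumes "ainf_algebra A"
  shows "mul A [0] = 0" "x \<in> comp A p \<Longrightarrow> y \<in> comp A p \<Longrightarrow> mul A [x + y] = mul A [x] + mul A [y]"
    "x \<in> comp A p \<Longrightarrow> y \<in> comp A p \<Longrightarrow> mul A [x - y] = mul A [x] - mul A [y]"
    "x \<in> comp A p \<Longrightarrow> mul A [- x] = - mul A [x]" "x \<in> comp A p \<Longrightarrow> mul A [sgn_pow k x] = sgn_pow k (mul A [x])"
  using multiadd_single[OF ainf_algebraD(2)[OF assms] add_closed_total[OF ainf_algebraD(1)[OF assms]]]
    comp_in_total[OF assms] by auto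

lemma morphism_single:
  assumes "ainf_morphism f A B"
  shows "f [0] = 0" "x \<in> comp A p \<Longrightarrow> y \<in> comp A p \<Longrightarrow> f [x + y] = f [x] + f [y]"
    "x \<in> comp A p \<Longrightarrow> y \<in> comp A p \<Longrightarrow> f [x - y] = f [x] - f [y]"
  using multiadd_single[OF ainf_morphismD(3)[OF assms] add_closed_total[OF ainf_algebraD(1)[OF ainf_morphismD(1)[OF assms]]]]
    comp_in_total[OF ainf_morphismD(1)[OF assms]] by auto

lemmas comp_closed = add_closedD[OF add_closed_comp[OF ainf_algebraD(1)]]

lemma compositions_1: "compositions (Suc 0) = {[Suc 0]}"
proof -
  have "js = []" if "0 \<notin> set js" "sum_list js = 0" for js :: "nat list"
    using that by (cases js) auto
  then have "js = [Suc 0]" if "js \<in> compositions (Suc 0)" for js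
    using that unfolding compositions_def by (cases js) (auto simp: add_is_1)
  then show ?thesis by (auto simp: compositions_def)
qed

lemma morphism_chain:
  assumes f: "ainf_morphism f A B" and x: "x \<in> comp A p"
  shows "f [mul A [x]] = mul B [f [x]]"
proof -
  have "{(a, s). 1 \<le> s \<and> a + s \<le> length [x]} = {(0, Suc 0)}" by auto
  then have "stasheff_sum A f [p] [x] = f [mul A [x]]" by (simp add: stasheff_sum_def)
  then show ?thesis
    using ainf_morphismD(5)[OF f, of "[x]" "[p]"] x
    by (simp add: homogeneous_def compositions_1 comp_exponent_def koszul_exponent_def)
qed

lemma cycles_closed:
  assumes "ainf_algebra A"
  shows "0 \<in> cycles A i" "x \<in> cycles A i \<Longrightarrow> y \<in> cycles A i \<Longrightarrow> x - y \<in> cycles A i"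
  using mul_single[OF assms] comp_closed[OF assms] by (auto simp: cycles_def)

lemma hclass_eq_iff:
  assumes A: "ainf_algebra A" and x: "x \<in> cycles A i" and y: "y \<in> cycles A i"
  shows "hclass A i x = hclass A i y \<longleftrightarrow> (\<exists>z\<in>comp A (i + 1). x - y = mul A [z])"
proof
  assume "hclass A i x = hclass A i y"
  moreover have "y \<in> hclass A i y"
    unfolding hclass_def homologous_def using y mul_single(1)[OF A] comp_closed(1)[OF A] by force
  ultimately have "y \<in> hclass A i x" by simp
  then show "\<exists>z\<in>comp A (i + 1). x - y = mul A [z]" by (auto simp: hclass_def homologous_def)
next
  assume "\<exists>z\<in>comp A (i + 1). x - y = mul A [z]"
  then obtain z where z: "z \<in> comp A (i + 1)" "x - y = mul A [z]" by blast
  have "(\<exists>z'\<in>comp A (i + 1). x - w = mul A [z']) \<longleftrightarrow> (\<exists>z'\<in>comp A (i + 1). y - w = mul A [z'])" for w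
  proof
    assume "\<exists>z'\<in>comp A (i + 1). x - w = mul A [z']"
    then obtain z' where z': "z' \<in> comp A (i + 1)" "x - w = mul A [z']" by blast
    have "y - w = mul A [z' - z]"
      unfolding mul_single(3)[OF A z'(1) z(1)] z(2)[symmetric] z'(2)[symmetric] by simp
    then show "\<exists>z'\<in>comp A (i + 1). y - w = mul A [z']" using comp_closed(4)[OF A z'(1) z(1)] by blast
  next
    assume "\<exists>z'\<in>comp A (i + 1). y - w = mul A [z']"
    then obtain z' where z': "z' \<in> comp A (i + 1)" "y - w = mul A [z']" by blast
    have "x - w = mul A [z' + z]"
      unfolding mul_single(2)[OF A z'(1) z(1)] z(2)[symmetric] z'(2)[symmetric] by simp
    then show "\<exists>z'\<in>comp A (i + 1). x - w = mul A [z']" using comp_closed(2)[OF A z'(1) z(1)] by blast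
  qed
  then show "hclass A i x = hclass A i y"
    using x y by (auto simp: hclass_def homologous_def)
qed

lemma hclass_self:
  assumes "ainf_algebra A" "x \<in> cycles A i"
  shows "x \<in> hclass A i x"
  unfolding hclass_def homologous_def using assms(2) mul_single(1)[OF assms(1)] comp_closed(1)[OF assms(1)] by force

lemma hclass_in_homology: "x \<in> cycles A i \<Longrightarrow> hclass A i x \<in> homology A i"
  by (auto simp: homology_def hclass_def quotient_def)

lemma homologyE:
  assumes "c \<in> homology A i"
  obtains x where "x \<in> cycles A i" "c = hclass A i x"
  using assms by (auto simp: homology_def hclass_def quotient_def)

lemma hclassD: "y \<in> hclass A i x \<Longrightarrow> y \<in> cycles A i"
  by (auto simp: hclass_def homologous_def)

lemma morphism_cycles:
  assumes "ainf_morphism f A B" "x \<in> cycles A i"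
  shows "f [x] \<in> cycles B i"
  using morphism_chain[OF assms(1)] morphism_single_comp[OF assms(1)] morphism_single(1)[OF assms(1)] assms(2)
  by (force simp: cycles_def)

lemma morphism_hclass:
  assumes f: "ainf_morphism f A B" and x: "x \<in> cycles A i"
  shows "homologous B i `` ((\<lambda>x. f [x]) ` hclass A i x) = hclass B i (f [x])"
proof -
  note A = ainf_morphismD(1)[OF f] and B = ainf_morphismD(2)[OF f]
  have "hclass B i (f [y]) = hclass B i (f [x])" if y: "y \<in> hclass A i x" for y
  proof -
    obtain z where z: "z \<in> comp A (i + 1)" "x - y = mul A [z]" and yc: "y \<in> cycles A i"
      using y by (auto simp: hclass_def homologous_def)
    have "f [x] - f [y] = mul B [f [z]]"
      using morphism_single(3)[OF f, of x i y] morphism_chain[OF f z(1)] x yc z(2) by (simp add: cycles_def)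
    then have "\<exists>z\<in>comp B (i + 1). f [x] - f [y] = mul B [z]" using morphism_single_comp[OF f z(1)] by (rule bexI)
    then show ?thesis
      unfolding hclass_eq_iff[OF B morphism_cycles[OF f x] morphism_cycles[OF f yc], symmetric] by (rule sym)
  qed
  then have "(\<Union>y\<in>hclass A i x. hclass B i (f [y])) = (\<Union>y\<in>hclass A i x. hclass B i (f [x]))" by simp
  also have "\<dots> = hclass B i (f [x])" using hclass_self[OF A x] by blast
  also have "(\<Union>y\<in>hclass A i x. hclass B i (f [y])) = homologous B i `` ((\<lambda>x. f [x]) ` hclass A i x)"
    unfolding hclass_def by blast
  finally show ?thesis .
qed

lemma quasi_iso_injD:
  assumes f: "ainf_quasi_iso f A B" and x: "x \<in> cycles A i" and z: "z \<in> comp B (i + 1)" "f [x] = mul B [z]"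
  shows "\<exists>z'\<in>comp A (i + 1). x = mul A [z']"
proof -
  have m: "ainf_morphism f A B" and bij: "bij_betw (\<lambda>c. homologous B i `` ((\<lambda>x. f [x]) ` c)) (homology A i) (homology B i)"
    using f by (auto simp: ainf_quasi_iso_def)
  note A = ainf_morphismD(1)[OF m] and B = ainf_morphismD(2)[OF m]
  have "hclass B i (f [x]) = hclass B i (f [0])"
    using hclass_eq_iff[OF B morphism_cycles[OF m x] morphism_cycles[OF m cycles_closed(1)[OF A]]] z
      morphism_single(1)[OF m] by auto
  then have "hclass A i x = hclass A i 0"
    using bij_betw_imp_inj_on[OF bij] hclass_in_homology[OF x] hclass_in_homology[OF cycles_closed(1)[OF A]]
      morphism_hclass[OF m x] morphism_hclass[OF m cycles_closed(1)[OF A]]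
    by (metis (no_types, lifting) inj_onD)
  then show ?thesis using hclass_eq_iff[OF A x cycles_closed(1)[OF A]] by simp
qed

lemma quasi_iso_surjD:
  assumes f: "ainf_quasi_iso f A B" and y: "y \<in> cycles B i"
  shows "\<exists>x\<in>cycles A i. \<exists>z\<in>comp B (i + 1). y - f [x] = mul B [z]"
proof -
  have m: "ainf_morphism f A B" and bij: "bij_betw (\<lambda>c. homologous B i `` ((\<lambda>x. f [x]) ` c)) (homology A i) (homology B i)"
    using f by (auto simp: ainf_quasi_iso_def)
  note B = ainf_morphismD(2)[OF m]
  have "hclass B i y \<in> (\<lambda>c. homologous B i `` ((\<lambda>x. f [x]) ` c)) ` homology A i"
    unfolding bij_betw_imp_surj_on[OF bij] by (rule hclass_in_homology[OF y])
  then obtain c where c: "c \<in> homology A i" "hclass B i y = homologous B i `` ((\<lambda>x. f [x]) ` c)" by (rule imageE)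
  from c(1) obtain x where x: "x \<in> cycles A i" "c = hclass A i x" by (rule homologyE)
  have "hclass B i y = hclass B i (f [x])" using c(2) morphism_hclass[OF m x(1)] x(2) by simp
  then show ?thesis using hclass_eq_iff[OF B y morphism_cycles[OF m x(1)]] x(1) by blast
qed


section \<open>Extension of Maurer-Cartan matrices\<close>

text \<open>Only the block between s and e is constrained and the corner entry itself is arbitrary,
  so that subintervals are treated without renumbering the matrix.\<close>

definition mc_off_corner :: "('k, 'a::ab_group_add, 'z) ainf_scheme \<Rightarrow> (nat \<Rightarrow> int) \<Rightarrow> (nat \<times> nat \<Rightarrow> 'a) \<Rightarrow> nat \<Rightarrow> nat \<Rightarrow> bool" where
  "mc_off_corner A \<rho> a s e \<longleftrightarrow>
     (\<forall>u v. s \<le> u \<and> u < v \<and> v \<le> e \<and> (u, v) \<noteq> (s, e) \<longrightarrow> path_sum (mul A) (<) \<rho> a (u, v) = 0)"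

(* A form of condition (B_r), for classes with degrees in D, that makes sense in every
   A_infinity-algebra: the corner entry of a defining system can always be filled in. *)
definition mc_extendable :: "int set \<Rightarrow> ('k, 'a::ab_group_add, 'z) ainf_scheme \<Rightarrow> nat \<Rightarrow> bool" where
  "mc_extendable D A r \<longleftrightarrow>
     (\<forall>\<rho> s e a. s + 2 \<le> e \<and> e \<le> s + r \<and> (\<forall>l\<in>{s..<e}. edge_deg \<rho> (l, Suc l) \<in> D) \<and>
        graded A (<) \<rho> a \<and> mc_off_corner A \<rho> a s e \<longrightarrow>
        (\<exists>z\<in>comp A (edge_deg \<rho> (s, e)). mul A [z] + higher_sum (mul A) (<) \<rho> a (s, e) = 0))"

lemma graded_upd:
  "graded A E \<rho> a \<Longrightarrow> z \<in> comp A (edge_deg \<rho> (i, j)) \<Longrightarrow> graded A E \<rho> (a((i, j) := z))"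
  by (auto simp: graded_def)

lemma higher_sum_upd: "higher_sum g (<) \<rho> (a((i, j) := z)) (i, j) = higher_sum g (<) \<rho> a (i, j :: nat)"
  by (rule nat_order.higher_sum_cong) auto

lemma path_sum_upd:
  "i < j \<Longrightarrow> path_sum g (<) \<rho> (a((i, j) := z)) (i, j) = g [z] + higher_sum g (<) \<rho> a (i, j :: nat)"
  using nat_order.path_sum_split[of i j g \<rho> "a((i, j) := z)"] by (simp add: higher_sum_upd)

lemma path_sum_upd_other:
  assumes "i \<le> u" "v \<le> j" "(u, v) \<noteq> (i, j)"
  shows "path_sum g (<) \<rho> (a((i, j) := z)) (u, v) = path_sum g (<) \<rho> a (u, v :: nat)"
  by (rule nat_order.path_sum_cong) (use assms in auto)

lemma path_sum_morphism_nat: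
  assumes f: "ainf_morphism f A B" and a: "graded A (<) \<rho> a" and ij: "i < j"
    and zero: "mc_off_corner A \<rho> a i j"
  shows "path_sum (mul B) (<) \<rho> (path_sum f (<) \<rho> a) (i, j) = f [path_sum (mul A) (<) \<rho> a (i, j)]"
  using zero by (intro nat_order.path_sum_morphism_corner[OF f a ij]) (auto simp: mc_off_corner_def)

lemma mc_off_corner_mono:
  assumes "mc_off_corner A \<rho> a s e" "s \<le> i" "j \<le> e"
  shows "mc_off_corner A \<rho> a i j"
  unfolding mc_off_corner_def
proof (intro allI impI)
  fix u v assume "i \<le> u \<and> u < v \<and> v \<le> j \<and> (u, v) \<noteq> (i, j)"
  with assms show "path_sum (mul A) (<) \<rho> a (u, v) = 0"
    unfolding mc_off_corner_def by (metis le_antisym le_trans prod.inject)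
qed

lemma mc_off_corner_morphism:
  assumes f: "ainf_morphism f A B" and a: "graded A (<) \<rho> a" and zero: "mc_off_corner A \<rho> a s e"
  shows "mc_off_corner B \<rho> (path_sum f (<) \<rho> a) s e"
  unfolding mc_off_corner_def
proof (intro allI impI)
  fix u v assume uv: "s \<le> u \<and> u < v \<and> v \<le> e \<and> (u, v) \<noteq> (s, e)"
  then have "path_sum (mul B) (<) \<rho> (path_sum f (<) \<rho> a) (u, v) = f [path_sum (mul A) (<) \<rho> a (u, v)]"
    by (intro path_sum_morphism_nat[OF f a] mc_off_corner_mono[OF zero]) auto
  also have "path_sum (mul A) (<) \<rho> a (u, v) = 0" using zero uv by (simp add: mc_off_corner_def)
  finally show "path_sum (mul B) (<) \<rho> (path_sum f (<) \<rho> a) (u, v) = 0"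
    by (simp add: morphism_single(1)[OF f])
qed

lemma path_sum_in_cycles:
  assumes A: "ainf_algebra A" and a: "graded A (<) \<rho> a" and ij: "i < j" and zero: "mc_off_corner A \<rho> a i j"
  shows "path_sum (mul A) (<) \<rho> a (i, j) \<in> cycles A (\<rho> j - \<rho> i - 2)"
proof -
  have "mul A [path_sum (mul A) (<) \<rho> a (i, j)] = 0"
    using zero by (intro nat_order.path_sum_cycle[OF A a ij]) (auto simp: mc_off_corner_def)
  then show ?thesis using nat_order.path_sum_mul_comp[OF A a ij] by (simp add: cycles_def)
qed

text \<open>The obstruction at the corner maps to that of the image matrix, which is a boundary by
  hypothesis; by injectivity on homology it was a boundary already.\<close>

lemma mc_extendable_reflect:
  assumes q: "ainf_quasi_iso f A B" and ext: "mc_extendable D B r"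
  shows "mc_extendable D A r"
  unfolding mc_extendable_def
proof (intro allI impI, elim conjE)
  fix \<rho> s e a
  assume se: "s + 2 \<le> e" "e \<le> s + r" and D: "\<forall>l\<in>{s..<e}. edge_deg \<rho> (l, Suc l) \<in> D"
    and a: "graded A (<) \<rho> a" and zero: "mc_off_corner A \<rho> a s e"
  have f: "ainf_morphism f A B" using q by (simp add: ainf_quasi_iso_def)
  note A = ainf_morphismD(1)[OF f] and B = ainf_morphismD(2)[OF f]
  let ?b = "path_sum f (<) \<rho> a" and ?P = "path_sum (mul A) (<) \<rho> a (s, e)"
  have lt: "s < e" using se by simp
  have b: "graded B (<) \<rho> ?b" by (rule nat_order.graded_path_sum_morphism[OF f a])
  obtain z where z: "z \<in> comp B (edge_deg \<rho> (s, e))" "mul B [z] + higher_sum (mul B) (<) \<rho> ?b (s, e) = 0"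
    using ext se D b mc_off_corner_morphism[OF f a zero] unfolding mc_extendable_def by blast
  have bse: "?b (s, e) \<in> comp B (edge_deg \<rho> (s, e))" using b lt by (simp add: graded_def)
  have "f [?P] = path_sum (mul B) (<) \<rho> ?b (s, e)" using path_sum_morphism_nat[OF f a lt zero] by (rule sym)
  also have "\<dots> = mul B [?b (s, e)] + higher_sum (mul B) (<) \<rho> ?b (s, e)" by (rule nat_order.path_sum_split[OF lt])
  also have "higher_sum (mul B) (<) \<rho> ?b (s, e) = - mul B [z]" using z(2) by (rule minus_unique[symmetric])
  finally have fP: "f [?P] = mul B [?b (s, e) - z]" unfolding mul_single(3)[OF B bse z(1)] by simp
  have "?b (s, e) - z \<in> comp B (\<rho> e - \<rho> s - 2 + 1)"
    using comp_closed(4)[OF B bse z(1)] by (simp add: edge_deg_def)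
  from quasi_iso_injD[OF q path_sum_in_cycles[OF A a lt zero] this fP]
  obtain z' where z': "z' \<in> comp A (edge_deg \<rho> (s, e))" "?P = mul A [z']" by (auto simp: edge_deg_def)
  have ase: "a (s, e) \<in> comp A (edge_deg \<rho> (s, e))" using a lt by (simp add: graded_def)
  \<comment> \<open>The path sum \<open>?P\<close> still contains the differential of the given
    corner entry, hence the filling is that entry corrected by \<open>z'\<close>.\<close>
  have "mul A [a (s, e) - z'] + higher_sum (mul A) (<) \<rho> a (s, e) = 0"
    using z'(2) mul_single(3)[OF A ase z'(1)] nat_order.path_sum_split[OF lt, of "mul A" \<rho> a]
    by (simp add: diff_add_eq)
  then show "\<exists>z\<in>comp A (edge_deg \<rho> (s, e)). mul A [z] + higher_sum (mul A) (<) \<rho> a (s, e) = 0"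
    using comp_closed(4)[OF A ase z'(1)] by blast
qed

section \<open>Lifting Maurer-Cartan matrices along a quasi-isomorphism\<close>

definition homotopy_higher ::
    "('k, 'a::ab_group_add, 'z) ainf_scheme \<Rightarrow> (nat \<Rightarrow> int) \<Rightarrow> (nat \<times> nat \<Rightarrow> 'a) \<Rightarrow> (nat \<times> nat \<Rightarrow> 'a) \<Rightarrow> (nat \<times> nat \<Rightarrow> 'a) \<Rightarrow> nat \<times> nat \<Rightarrow> 'a" where
  "homotopy_higher A \<rho> b0 h b1 e = sgn_pow (\<rho> (fst e))
     (higher_sum (mul A) layered (cylinder_pot \<rho>) (cylinder b0 h b1) ((False, fst e), (True, snd e)))"

lemma homotopy_sum_split:
  assumes "i < j"
  shows "homotopy_sum A \<rho> b0 h b1 (i, j) = sgn_pow (\<rho> i) (mul A [h (i, j)]) + homotopy_higher A \<rho> b0 h b1 (i, j)"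
  unfolding homotopy_sum_def homotopy_higher_def
  using layer_order.path_sum_split[of "(False, i)" "(True, j)" "mul A" "cylinder_pot \<rho>" "cylinder b0 h b1"] assms
  by (simp add: sgn_pow_add layered_def cylinder_def)

text \<open>A path from (False, i) to (True, j) with at least two edges has no edge lying over (i,
  j), because each edge raises the number. So this part of the homotopy equation is known before any
  of the three corner entries is chosen.\<close>

lemma homotopy_higher_cong:
  assumes "\<And>u v. i \<le> u \<Longrightarrow> u < v \<Longrightarrow> v \<le> j \<Longrightarrow> (u, v) \<noteq> (i, j) \<Longrightarrow>
     b0 (u, v) = b0' (u, v) \<and> h (u, v) = h' (u, v) \<and> b1 (u, v) = b1' (u, v)"
  shows "homotopy_higher A \<rho> b0 h b1 (i, j) = homotopy_higher A \<rho> b0' h' b1' (i, j)"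
proof -
  have "higher_sum (mul A) layered (cylinder_pot \<rho>) (cylinder b0 h b1) ((False, i), (True, j)) =
    higher_sum (mul A) layered (cylinder_pot \<rho>) (cylinder b0' h' b1') ((False, i), (True, j))"
  proof (rule layer_order.higher_sum_cong)
    fix x y assume xy: "layered x y" "x = (False, i) \<or> layered (False, i) x"
      "y = (True, j) \<or> layered y (True, j)" "(x, y) \<noteq> ((False, i), True, j)"
    obtain cx u cy v where xy': "x = (cx, u)" "y = (cy, v)" by (cases x, cases y)
    have "i \<le> u" "u < v" "v \<le> j" "(u, v) \<noteq> (i, j)" using xy by (auto simp: xy' layered_def)
    from assms[OF this] show "cylinder b0 h b1 (x, y) = cylinder b0' h' b1' (x, y)"
      by (simp add: xy' cylinder_def)
  qed
  then show ?thesis by (simp add: homotopy_higher_def)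
qed

(* The matrix a is a Maurer-Cartan lift of b at the entry e: its image under f is homotopic to b
   by means of h. *)
definition lifted ::
    "('a list \<Rightarrow> 'b) \<Rightarrow> ('k, 'a::ab_group_add, 'y) ainf_scheme \<Rightarrow> ('k, 'b::ab_group_add, 'z) ainf_scheme \<Rightarrow>
     (nat \<Rightarrow> int) \<Rightarrow> (nat \<times> nat \<Rightarrow> 'b) \<Rightarrow> (nat \<times> nat \<Rightarrow> 'a) \<Rightarrow> (nat \<times> nat \<Rightarrow> 'b) \<Rightarrow> nat \<times> nat \<Rightarrow> bool" where
  "lifted f A B \<rho> b a h e \<longleftrightarrow> path_sum (mul A) (<) \<rho> a e = 0 \<and>
     b e - path_sum f (<) \<rho> a e = homotopy_sum B \<rho> (path_sum f (<) \<rho> a) h b e"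

lemma lifted_cong:
  assumes uv: "u < v" and eq: "\<And>p q. u \<le> p \<Longrightarrow> p < q \<Longrightarrow> q \<le> v \<Longrightarrow> a (p, q) = a' (p, q) \<and> h (p, q) = h' (p, q)"
  shows "lifted f A B \<rho> b a h (u, v) \<longleftrightarrow> lifted f A B \<rho> b a' h' (u, v)"
proof -
  have F: "path_sum f (<) \<rho> a (p, q) = path_sum f (<) \<rho> a' (p, q)" if "u \<le> p" "q \<le> v" for p q
    by (rule nat_order.path_sum_cong) (use eq that in auto)
  have "homotopy_higher B \<rho> (path_sum f (<) \<rho> a) h b (u, v) = homotopy_higher B \<rho> (path_sum f (<) \<rho> a') h' b (u, v)"
    by (rule homotopy_higher_cong) (use eq F in auto)
  then have "homotopy_sum B \<rho> (path_sum f (<) \<rho> a) h b (u, v) = homotopy_sum B \<rho> (path_sum f (<) \<rho> a') h' b (u, v)"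
    using eq uv by (simp add: homotopy_sum_split)
  moreover have "path_sum (mul A) (<) \<rho> a (u, v) = path_sum (mul A) (<) \<rho> a' (u, v)"
    by (rule nat_order.path_sum_cong) (use eq in auto)
  ultimately show ?thesis using F unfolding lifted_def by simp
qed

lemma quasi_morphism: "ainf_quasi_iso f A B \<Longrightarrow> ainf_morphism f A B"
  by (simp add: ainf_quasi_iso_def)

context
  fixes f :: "'a::ab_group_add list \<Rightarrow> 'b::ab_group_add"
    and A :: "('k::comm_ring_1, 'a, 'y) ainf_scheme" and B :: "('k, 'b, 'z) ainf_scheme"
    and \<rho> :: "nat \<Rightarrow> int" and a h b and i j :: nat
  assumes q: "ainf_quasi_iso f A B" and a: "graded A (<) \<rho> a" and b: "graded B (<) \<rho> b"
    and h: "\<And>u v. u < v \<Longrightarrow> h (u, v) \<in> comp B (\<rho> v - \<rho> u)"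
    and ij: "i < j" and b_zero: "mc_off_corner B \<rho> b i j"
    and lifted: "\<And>u v. i \<le> u \<Longrightarrow> u < v \<Longrightarrow> v \<le> j \<Longrightarrow> (u, v) \<noteq> (i, j) \<Longrightarrow> lifted f A B \<rho> b a h (u, v)"
begin

text \<open>For a trial entry \<open>z\<close>, the element \<open>X\<close> measures the failure of
  the homotopy equation at the corner, and by \<open>homotopy_corner\<close> its differential
  compares the obstruction of \<open>b\<close> with the image of the obstruction of the trial
  matrix. Fillings and lifts both follow from this one formula.\<close>

lemma lift_corner:
  assumes z: "z \<in> comp A (edge_deg \<rho> (i, j))"
  defines "a1 \<equiv> a((i, j) := z)"
  defines "X \<equiv> b (i, j) - path_sum f (<) \<rho> a1 (i, j) - homotopy_higher B \<rho> (path_sum f (<) \<rho> a) h b (i, j)"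
  shows "mc_off_corner A \<rho> a1 i j" "graded A (<) \<rho> a1"
    "path_sum (mul A) (<) \<rho> a1 (i, j) \<in> cycles A (\<rho> j - \<rho> i - 2)"
    "X \<in> comp B (edge_deg \<rho> (i, j))"
    "path_sum (mul B) (<) \<rho> b (i, j) - f [path_sum (mul A) (<) \<rho> a1 (i, j)] = mul B [X]"
proof -
  note f = quasi_morphism[OF q]
  note A = ainf_morphismD(1)[OF f] and B = ainf_morphismD(2)[OF f]
  \<comment> \<open>With 0 as corner entry of the homotopy, \<open>homotopy_sum\<close> reduces to
    \<open>homotopy_higher\<close> at the corner.\<close>
  let ?b0 = "path_sum f (<) \<rho> a1" and ?h1 = "h((i, j) := 0)"
  show a1: "graded A (<) \<rho> a1" unfolding a1_def by (rule graded_upd[OF a z])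
  have L: "lifted f A B \<rho> b a1 ?h1 (u, v)" if "i \<le> u" "u < v" "v \<le> j" "(u, v) \<noteq> (i, j)" for u v
  proof -
    have "lifted f A B \<rho> b a1 ?h1 (u, v) \<longleftrightarrow> lifted f A B \<rho> b a h (u, v)"
      by (rule lifted_cong) (use that in \<open>auto simp: a1_def\<close>)
    then show ?thesis using lifted[OF that] by blast
  qed
  then show zero: "mc_off_corner A \<rho> a1 i j" by (auto simp: mc_off_corner_def lifted_def)
  show "path_sum (mul A) (<) \<rho> a1 (i, j) \<in> cycles A (\<rho> j - \<rho> i - 2)" by (rule path_sum_in_cycles[OF A a1 ij zero])
  have b0: "graded B (<) \<rho> ?b0" by (rule nat_order.graded_path_sum_morphism[OF f a1])
  have h1: "?h1 (u, v) \<in> comp B (\<rho> v - \<rho> u)" if "u < v" for u v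
    using h[OF that] comp_closed(1)[OF B] by auto
  have "homotopy_higher B \<rho> ?b0 ?h1 b (i, j) = homotopy_higher B \<rho> (path_sum f (<) \<rho> a) h b (i, j)"
    by (rule homotopy_higher_cong) (auto simp: a1_def path_sum_upd_other)
  then have X: "b (i, j) - ?b0 (i, j) - homotopy_sum B \<rho> ?b0 ?h1 b (i, j) = X"
    unfolding X_def by (simp add: homotopy_sum_split[OF ij] mul_single(1)[OF B])
  have "b (i, j) \<in> comp B (edge_deg \<rho> (i, j))" "?b0 (i, j) \<in> comp B (edge_deg \<rho> (i, j))"
    using b b0 ij by (auto simp: graded_def)
  then show "X \<in> comp B (edge_deg \<rho> (i, j))"
    unfolding X[symmetric] using homotopy_sum_comp[OF B b0 b h1 ij] comp_closed(4)[OF B] by metis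
  have "path_sum (mul B) (<) \<rho> b (i, j) - path_sum (mul B) (<) \<rho> ?b0 (i, j) =
     mul B [b (i, j) - ?b0 (i, j) - homotopy_sum B \<rho> ?b0 ?h1 b (i, j)]"
  proof (rule homotopy_corner[OF B b0 b h1 ij])
    fix u v assume uv: "i \<le> u" "u < v" "v \<le> j" "(u, v) \<noteq> (i, j)"
    show "path_sum (mul B) (<) \<rho> ?b0 (u, v) = 0 \<and> path_sum (mul B) (<) \<rho> b (u, v) = 0 \<and>
        b (u, v) - ?b0 (u, v) = homotopy_sum B \<rho> ?b0 ?h1 b (u, v)"
      using uv L[OF uv] b_zero mc_off_corner_morphism[OF f a1 zero]
      unfolding mc_off_corner_def lifted_def by blast
  qed
  then show "path_sum (mul B) (<) \<rho> b (i, j) - f [path_sum (mul A) (<) \<rho> a1 (i, j)] = mul B [X]"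
    unfolding X path_sum_morphism_nat[OF f a1 ij zero] .
qed

text \<open>A filling in A makes the obstruction of the trial matrix vanish, so that of
  \<open>b\<close> is the differential of \<open>X\<close>, and \<open>b (i, j) - X\<close> fills
  the corner in B.\<close>

lemma corner_fill_image:
  assumes z: "z \<in> comp A (edge_deg \<rho> (i, j))" "mul A [z] + higher_sum (mul A) (<) \<rho> a (i, j) = 0"
  shows "\<exists>w\<in>comp B (edge_deg \<rho> (i, j)). mul B [w] + higher_sum (mul B) (<) \<rho> b (i, j) = 0"
proof -
  note f = quasi_morphism[OF q]
  note A = ainf_morphismD(1)[OF f] and B = ainf_morphismD(2)[OF f]
  obtain X where X: "X \<in> comp B (edge_deg \<rho> (i, j))"
    "path_sum (mul B) (<) \<rho> b (i, j) - f [path_sum (mul A) (<) \<rho> (a((i, j) := z)) (i, j)] = mul B [X]"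
    using lift_corner(4,5)[OF z(1)] by blast
  have "path_sum (mul A) (<) \<rho> (a((i, j) := z)) (i, j) = 0" using path_sum_upd[OF ij] z(2) by metis
  then have "mul B [b (i, j)] + higher_sum (mul B) (<) \<rho> b (i, j) = mul B [X]"
    using X(2) nat_order.path_sum_split[OF ij, of "mul B" \<rho> b] by (simp add: morphism_single(1)[OF f])
  moreover have bij: "b (i, j) \<in> comp B (edge_deg \<rho> (i, j))" using b ij by (simp add: graded_def)
  ultimately have "mul B [b (i, j) - X] + higher_sum (mul B) (<) \<rho> b (i, j) = 0"
    using mul_single(3)[OF B bij X(1)] by (simp add: diff_add_eq)
  then show ?thesis using comp_closed(4)[OF B bij X(1)] by blast
qed

text \<open>Injectivity on homology yields an entry that satisfies the Maurer-Cartan equation;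
  surjectivity changes it by a cycle, which keeps that equation, until the remaining defect of the
  homotopy equation is a boundary.\<close>

lemma corner_lift:
  assumes bij: "path_sum (mul B) (<) \<rho> b (i, j) = 0"
  shows "\<exists>x\<in>comp A (edge_deg \<rho> (i, j)). \<exists>y\<in>comp B (\<rho> j - \<rho> i).
    lifted f A B \<rho> b (a((i, j) := x)) (h((i, j) := y)) (i, j)"
proof -
  note f = quasi_morphism[OF q]
  note A = ainf_morphismD(1)[OF f] and B = ainf_morphismD(2)[OF f]
  let ?d = "edge_deg \<rho> (i, j)"
  let ?F = "\<lambda>x. path_sum f (<) \<rho> (a((i, j) := x)) (i, j)"
  let ?P = "\<lambda>x. path_sum (mul A) (<) \<rho> (a((i, j) := x)) (i, j)"
  let ?K = "homotopy_higher B \<rho> (path_sum f (<) \<rho> a) h b (i, j)"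
  have d1: "\<rho> j - \<rho> i - 2 + 1 = ?d" "?d + 1 = \<rho> j - \<rho> i" by (auto simp: edge_deg_def)
  have F: "?F x = f [x] + higher_sum f (<) \<rho> a (i, j)" and P: "?P x = mul A [x] + higher_sum (mul A) (<) \<rho> a (i, j)" for x
    using path_sum_upd[OF ij] by metis+
  have 0: "0 \<in> comp A ?d" by (rule comp_closed(1)[OF A])
  let ?X0 = "b (i, j) - ?F 0 - ?K"
  \<comment> \<open>For the trial entry 0 the obstruction in A is a cycle whose image is a boundary,
    hence it is a boundary itself.\<close>
  have "- f [?P 0] = mul B [?X0]" using lift_corner(5)[OF 0] bij by simp
  then have "f [?P 0] = mul B [- ?X0]"
    unfolding mul_single(4)[OF B lift_corner(4)[OF 0]] by (metis add.inverse_inverse)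
  moreover have "- ?X0 \<in> comp B ?d" by (rule comp_closed(3)[OF B lift_corner(4)[OF 0]])
  ultimately obtain z0 where z0: "z0 \<in> comp A ?d" "?P 0 = mul A [z0]"
    using quasi_iso_injD[OF q lift_corner(3)[OF 0]] unfolding d1 by blast
  define z where "z = - z0"
  have z: "z \<in> comp A ?d" using z0(1) comp_closed(3)[OF A] by (simp add: z_def)
  have Pz: "?P z = 0" using z0 mul_single(1)[OF A] mul_single(4)[OF A z0(1)] P by (simp add: z_def)
  \<comment> \<open>Now the Maurer-Cartan equation holds for \<open>z\<close> and the defect
    \<open>?X\<close> is a cycle, but its class need not vanish. The cycle \<open>y\<close> of A
    represents this class up to the boundary of \<open>w\<close>.\<close>
  let ?X = "b (i, j) - ?F z - ?K"
  have "mul B [?X] = 0" using lift_corner(5)[OF z] bij Pz morphism_single(1)[OF f] by simp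
  then have "?X \<in> cycles B ?d" using lift_corner(4)[OF z] by (simp add: cycles_def)
  from quasi_iso_surjD[OF q this] obtain y w where y: "y \<in> cycles A ?d" "w \<in> comp B (\<rho> j - \<rho> i)" "?X - f [y] = mul B [w]"
    unfolding d1 by blast
  have yc: "y \<in> comp A ?d" "mul A [y] = 0" using y(1) by (auto simp: cycles_def)
  \<comment> \<open>The sign on \<open>w\<close> cancels the one that \<open>homotopy_sum\<close>
    puts in front of the differential of the entry of the homotopy.\<close>
  let ?a = "a((i, j) := z + y)" and ?h = "h((i, j) := sgn_pow (\<rho> i) w)"
  have "path_sum (mul A) (<) \<rho> ?a (i, j) = 0"
    using Pz P mul_single(2)[OF A z yc(1)] yc(2) by simp
  moreover have "b (i, j) - path_sum f (<) \<rho> ?a (i, j) = mul B [w] + ?K"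
    using y(3) F morphism_single(2)[OF f z yc(1)] by (simp add: algebra_simps)
  moreover have "homotopy_higher B \<rho> (path_sum f (<) \<rho> ?a) ?h b (i, j) = ?K"
    by (rule homotopy_higher_cong) (auto simp: path_sum_upd_other)
  then have "homotopy_sum B \<rho> (path_sum f (<) \<rho> ?a) ?h b (i, j) = mul B [w] + ?K"
    using mul_single(5)[OF B y(2)] by (simp add: homotopy_sum_split[OF ij] sgn_pow_twice)
  ultimately have "lifted f A B \<rho> b ?a ?h (i, j)" by (simp add: lifted_def)
  then show ?thesis using comp_closed(2)[OF A z yc(1)] comp_closed(5)[OF B y(2)] by blast
qed

end

text \<open>Induction on the distance of the entries from the diagonal. The condition at (u, v)
  involves only entries between u and v, so all entries on the next parallel to the diagonal are
  chosen independently and inserted at once.\<close>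

lemma lift_mc_matrix:
  fixes A :: "('k::comm_ring_1, 'a::ab_group_add, 'y) ainf_scheme" and B :: "('k, 'c::ab_group_add, 'z) ainf_scheme"
  assumes q: "ainf_quasi_iso f A B" and b: "graded B (<) \<rho> b" and zero: "mc_off_corner B \<rho> b s e"
  shows "\<exists>(a :: nat \<times> nat \<Rightarrow> 'a::ab_group_add) (h :: nat \<times> nat \<Rightarrow> 'c::ab_group_add). graded A (<) \<rho> a \<and> (\<forall>u v. u < v \<longrightarrow> h (u, v) \<in> comp B (\<rho> v - \<rho> u)) \<and>
    (\<forall>u v. s \<le> u \<and> u < v \<and> v \<le> e \<and> (u, v) \<noteq> (s, e) \<and> v - u \<le> n \<longrightarrow> lifted f A B \<rho> b a h (u, v))"
proof (induction n)
  case 0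
  note f = quasi_morphism[OF q]
  note A = ainf_morphismD(1)[OF f] and B = ainf_morphismD(2)[OF f]
  have "graded A (<) \<rho> (\<lambda>_. 0)" by (simp add: graded_def comp_closed(1)[OF A])
  moreover have "\<forall>u v. u < v \<longrightarrow> (\<lambda>_. 0) (u, v) \<in> comp B (\<rho> v - \<rho> u)" by (simp add: comp_closed(1)[OF B])
  ultimately show ?case by (intro exI[of _ "\<lambda>_. 0 :: 'a"] exI[of _ "\<lambda>_. 0 :: 'c"] conjI) auto
next
  case (Suc n)
  then obtain a h where a: "graded A (<) \<rho> a" and h': "\<forall>u v. u < v \<longrightarrow> h (u, v) \<in> comp B (\<rho> v - \<rho> u)"
    and L': "\<forall>u v. s \<le> u \<and> u < v \<and> v \<le> e \<and> (u, v) \<noteq> (s, e) \<and> v - u \<le> n \<longrightarrow> lifted f A B \<rho> b a h (u, v)"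
    by (elim exE conjE)
  have h: "h (u, v) \<in> comp B (\<rho> v - \<rho> u)" if "u < v" for u v using h' that by simp
  have L: "lifted f A B \<rho> b a h (u, v)" if "s \<le> u" "u < v" "v \<le> e" "(u, v) \<noteq> (s, e)" "v - u \<le> n" for u v
    using L' that by simp
  define ok where "ok i \<longleftrightarrow> s \<le> i \<and> i + Suc n \<le> e \<and> (i, i + Suc n) \<noteq> (s, e)" for i
  have "\<exists>xy. fst xy \<in> comp A (edge_deg \<rho> (i, i + Suc n)) \<and> snd xy \<in> comp B (\<rho> (i + Suc n) - \<rho> i) \<and>
      lifted f A B \<rho> b (a((i, i + Suc n) := fst xy)) (h((i, i + Suc n) := snd xy)) (i, i + Suc n)"
    if "ok i" for i
  proof -
    let ?j = "i + Suc n"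
    have "path_sum (mul B) (<) \<rho> b (i, ?j) = 0" using zero that by (auto simp: ok_def mc_off_corner_def)
    moreover have "lifted f A B \<rho> b a h (u, v)" if "i \<le> u" "u < v" "v \<le> ?j" "(u, v) \<noteq> (i, ?j)" for u v
      using that \<open>ok i\<close> by (intro L) (auto simp: ok_def)
    ultimately show ?thesis
      using corner_lift[OF q a b h, of i ?j] mc_off_corner_mono[OF zero, of i ?j] that
      by (auto simp: ok_def)
  qed
  then obtain xy where xy: "\<And>i. ok i \<Longrightarrow> fst (xy i) \<in> comp A (edge_deg \<rho> (i, i + Suc n)) \<and>
      snd (xy i) \<in> comp B (\<rho> (i + Suc n) - \<rho> i) \<and>
      lifted f A B \<rho> b (a((i, i + Suc n) := fst (xy i))) (h((i, i + Suc n) := snd (xy i))) (i, i + Suc n)"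
    by metis
  define a' where "a' = (\<lambda>(u, v). if ok u \<and> v = u + Suc n then fst (xy u) else a (u, v))"
  define h' where "h' = (\<lambda>(u, v). if ok u \<and> v = u + Suc n then snd (xy u) else h (u, v))"
  have "graded A (<) \<rho> a'" using a xy by (auto simp: graded_def a'_def)
  moreover have "h' (u, v) \<in> comp B (\<rho> v - \<rho> u)" if "u < v" for u v
    using h[OF that] xy by (auto simp: h'_def)
  moreover have "lifted f A B \<rho> b a' h' (u, v)"
    if uv: "s \<le> u" "u < v" "v \<le> e" "(u, v) \<noteq> (s, e)" "v - u \<le> Suc n" for u v
  proof (cases "v - u \<le> n")
    case True
    have "lifted f A B \<rho> b a' h' (u, v) \<longleftrightarrow> lifted f A B \<rho> b a h (u, v)"
      by (rule lifted_cong) (use uv True in \<open>auto simp: a'_def h'_def\<close>)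
    then show ?thesis using L uv True by blast
  next
    case False
    then have v: "v = u + Suc n" using uv by simp
    then have ok: "ok u" using uv by (auto simp: ok_def)
    have "lifted f A B \<rho> b a' h' (u, v) \<longleftrightarrow>
      lifted f A B \<rho> b (a((u, u + Suc n) := fst (xy u))) (h((u, u + Suc n) := snd (xy u))) (u, v)"
      by (rule lifted_cong) (use uv v ok in \<open>auto simp: a'_def h'_def\<close>)
    then show ?thesis using xy[OF ok] v by simp
  qed
  ultimately show ?case by (intro exI[of _ a'] exI[of _ h']) auto
qed

text \<open>The block of \<open>b\<close> without its corner lifts to A up to homotopy, the corner
  is filled there, and \<open>corner_fill_image\<close> carries the filling over to B.\<close>

lemma mc_extendable_preserve:
  assumes q: "ainf_quasi_iso f A B" and ext: "mc_extendable D A r"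
  shows "mc_extendable D B r"
  unfolding mc_extendable_def
proof (intro allI impI, elim conjE)
  fix \<rho> s e b
  assume se: "s + 2 \<le> e" "e \<le> s + r" and D: "\<forall>l\<in>{s..<e}. edge_deg \<rho> (l, Suc l) \<in> D"
    and b: "graded B (<) \<rho> b" and zero: "mc_off_corner B \<rho> b s e"
  have lt: "s < e" using se by simp
  \<comment> \<open>With n = e - s the bound on v - u holds for every pair in the block.\<close>
  obtain a h where a: "graded A (<) \<rho> a" and h': "\<forall>u v. u < v \<longrightarrow> h (u, v) \<in> comp B (\<rho> v - \<rho> u)"
    and L': "\<forall>u v. s \<le> u \<and> u < v \<and> v \<le> e \<and> (u, v) \<noteq> (s, e) \<and> v - u \<le> e - s \<longrightarrow> lifted f A B \<rho> b a h (u, v)"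
    using lift_mc_matrix[OF q b zero, of "e - s"] by (elim exE conjE)
  have h: "h (u, v) \<in> comp B (\<rho> v - \<rho> u)" if "u < v" for u v using h' that by simp
  have L: "lifted f A B \<rho> b a h (u, v)" if "s \<le> u" "u < v" "v \<le> e" "(u, v) \<noteq> (s, e)" for u v
    using L' that by simp
  then have "mc_off_corner A \<rho> a s e" by (auto simp: mc_off_corner_def lifted_def)
  then obtain z where "z \<in> comp A (edge_deg \<rho> (s, e))" "mul A [z] + higher_sum (mul A) (<) \<rho> a (s, e) = 0"
    using ext se D a unfolding mc_extendable_def by blast
  from corner_fill_image[OF q a b h lt zero L this]
  show "\<exists>z\<in>comp B (edge_deg \<rho> (s, e)). mul B [z] + higher_sum (mul B) (<) \<rho> b (s, e) = 0" .
qed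

section \<open>Invariance along zig-zags\<close>

lemma mc_extendable_step:
  assumes "ainf_step A B"
  shows "mc_extendable D A r \<longleftrightarrow> mc_extendable D B r"
  using assms unfolding ainf_step_def
proof (elim disjE exE)
  fix f assume "ainf_quasi_iso f A B"
  from mc_extendable_reflect[OF this] mc_extendable_preserve[OF this] show ?thesis by blast
next
  fix g assume "ainf_quasi_iso g B A"
  from mc_extendable_reflect[OF this] mc_extendable_preserve[OF this] show ?thesis by blast
qed

lemma mc_extendable_steps:
  fixes C C' :: "('k::comm_ring_1, 'u::ab_group_add) ainf"
  assumes "ainf_step\<^sup>*\<^sup>* C C'"
  shows "mc_extendable D C r \<longleftrightarrow> mc_extendable D C' r"
  using assms
proof induction
  case (step C' C'')
  then show ?case using mc_extendable_step[OF step(2)] by blast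
qed simp

lemma ainf_step_algebra:
  assumes "ainf_step A B"
  shows "ainf_algebra A" "ainf_algebra B"
  using assms by (auto simp: ainf_step_def ainf_quasi_iso_def ainf_morphism_def)

lemma mc_extendable_quasi_isomorphic:
  fixes A :: "('k::comm_ring_1, 'a::ab_group_add) ainf" and B :: "('k, 'b::ab_group_add) ainf"
  assumes "ainf_quasi_isomorphic TYPE('u::ab_group_add) A B"
  shows "ainf_algebra A" "ainf_algebra B" "mc_extendable D A r \<longleftrightarrow> mc_extendable D B r"
proof -
  consider "ainf_step A B"
    | C C' :: "('k, 'u) ainf" where "ainf_step A C" "ainf_step\<^sup>*\<^sup>* C C'" "ainf_step C' B"
    using assms unfolding ainf_quasi_isomorphic_def by (elim disjE exE conjE)
  then have "ainf_algebra A \<and> ainf_algebra B \<and> (mc_extendable D A r \<longleftrightarrow> mc_extendable D B r)"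
  proof cases
    case 1
    show ?thesis using ainf_step_algebra[OF 1] mc_extendable_step[OF 1] by blast
  next
    case 2
    show ?thesis
      using ainf_step_algebra[OF 2(1)] ainf_step_algebra[OF 2(3)] mc_extendable_step[OF 2(1)]
        mc_extendable_steps[OF 2(2)] mc_extendable_step[OF 2(3)] by blast
  qed
  then show "ainf_algebra A" "ainf_algebra B" "mc_extendable D A r \<longleftrightarrow> mc_extendable D B r" by blast+
qed

section \<open>Massey products of a dga\<close>

lemma greaterThanLessThan_Suc: "{l<..<Suc l} = {}"
  by auto

lemma mul_mul_single:
  assumes A: "ainf_algebra A" and x: "x \<in> comp A p"
  shows "mul A [mul A [x]] = 0"
proof -
  have "{(a, s). 1 \<le> s \<and> a + s \<le> length [x]} = {(0, Suc 0)}" by auto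
  then have "stasheff_sum A (mul A) [p] [x] = mul A [mul A [x]]" by (simp add: stasheff_sum_def)
  then show ?thesis using ainf_algebraD(4)[OF A, of "[x]" "[p]"] x by (simp add: homogeneous_def)
qed

lemma boundary_hclass:
  assumes A: "ainf_algebra A" and z: "z \<in> comp A (i + 1)"
  shows "hclass A i (mul A [z]) = hclass A i 0"
proof -
  have "mul A [z] \<in> cycles A i"
    using mul_single_comp[OF A z] mul_mul_single[OF A z] by (simp add: cycles_def)
  from hclass_eq_iff[OF A this cycles_closed(1)[OF A]] z show ?thesis by auto
qed

text \<open>In a dga only paths with two edges contribute. For degrees p and q the suspension sign
  is that of p and \<open>bar\<close> has that of p + 1, whence the minus sign. The Maurer-Cartan
  equations are therefore exactly those of a defining system.\<close>

lemma higher_sum_dga: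
  fixes \<rho> :: "nat \<Rightarrow> int"
  assumes A: "ainf_algebra A" and dga: "\<And>xs. 3 \<le> length xs \<Longrightarrow> mul A xs = 0"
    and a: "graded A (<) \<rho> a" and ij: "i < j"
  shows "higher_sum (mul A) (<) \<rho> a (i, j) =
    - (\<Sum>l\<in>{i<..<j}. mul A [bar (edge_deg \<rho> (i, l)) (a (i, l)), a (l, j)])"
proof -
  let ?w = "\<lambda>l. [(i, l), (l, j)]"
  have "higher_sum (mul A) (<) \<rho> a (i, j) = (\<Sum>w\<in>?w ` {i<..<j}. weight (mul A) \<rho> a w)"
    unfolding higher_sum_def
  proof (rule sum.mono_neutral_right)
    show "finite (paths (<) (fst (i, j)) (snd (i, j)) - {[(i, j)]})" by (simp add: nat_order.finite_paths)
    show "?w ` {i<..<j} \<subseteq> paths (<) (fst (i, j)) (snd (i, j)) - {[(i, j)]}" by (auto simp: paths_def)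
    show "\<forall>w\<in>paths (<) (fst (i, j)) (snd (i, j)) - {[(i, j)]} - ?w ` {i<..<j}. weight (mul A) \<rho> a w = 0"
    proof
      fix w assume w: "w \<in> paths (<) (fst (i, j)) (snd (i, j)) - {[(i, j)]} - ?w ` {i<..<j}"
      have "3 \<le> length w"
      proof (rule ccontr)
        assume "\<not> 3 \<le> length w"
        then consider "w = []" | e where "w = [e]" | e e' where "w = [e, e']"
          by (cases w; cases "tl w"; cases "tl (tl w)") auto
        then show False using w ij by cases (auto simp: paths_def image_iff prod_eq_iff)
      qed
      then show "weight (mul A) \<rho> a w = 0" by (simp add: weight_def shifted_def dga)
    qed
  qed
  also have "\<dots> = (\<Sum>l\<in>{i<..<j}. weight (mul A) \<rho> a (?w l))"
    by (rule sum.reindex_cong[where l="?w"]) (auto simp: inj_on_def)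
  also have "\<dots> = (\<Sum>l\<in>{i<..<j}. - mul A [bar (edge_deg \<rho> (i, l)) (a (i, l)), a (l, j)])"
  proof (rule sum.cong[OF refl])
    fix l assume l: "l \<in> {i<..<j}"
    have "mul A ([] @ sgn_pow (edge_deg \<rho> (i, l) + 1) (a (i, l)) # [a (l, j)]) =
        sgn_pow (edge_deg \<rho> (i, l) + 1) (mul A ([] @ a (i, l) # [a (l, j)]))"
      using graded_total[OF A a, of i l] graded_total[OF A a, of l j] l
      by (intro multiadd_sgn_pow[OF ainf_algebraD(2)[OF A] add_closed_total[OF ainf_algebraD(1)[OF A]]]) auto
    then show "weight (mul A) \<rho> a (?w l) = - mul A [bar (edge_deg \<rho> (i, l)) (a (i, l)), a (l, j)]"
      by (simp add: weight_def shifted_def bar_def sgn_pow_Suc)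
  qed
  finally show ?thesis by (simp add: sum_negf)
qed

lemma massey_deg_eq:
  assumes "\<And>l. l < length ws \<Longrightarrow> fst (ws ! l) = edge_deg \<rho> (s + l, Suc (s + l))" "i \<le> j" "j \<le> length ws"
  shows "massey_deg ws i j = edge_deg \<rho> (s + i, s + j)"
proof -
  have "massey_deg ws i j = (\<Sum>l\<in>{i..<j}. \<rho> (s + Suc l) - \<rho> (s + l) - 1) + int (j - i) - 1"
    unfolding massey_deg_def using assms by (auto simp: edge_deg_def)
  also have "(\<Sum>l\<in>{i..<j}. \<rho> (s + Suc l) - \<rho> (s + l) - 1) = \<rho> (s + j) - \<rho> (s + i) - int (j - i)"
    using sum_Suc_diff'[OF assms(2), of "\<lambda>l. \<rho> (s + l)"] by (simp add: sum_subtractf)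
  finally show ?thesis by (simp add: edge_deg_def)
qed

lemma massey_sum_higher_sum:
  assumes A: "ainf_algebra A" and dga: "\<And>xs. 3 \<le> length xs \<Longrightarrow> mul A xs = 0"
    and a: "graded A (<) \<rho> a"
    and ws: "\<And>l. l < length ws \<Longrightarrow> fst (ws ! l) = edge_deg \<rho> (s + l, Suc (s + l))"
    and ij: "i < j" "j \<le> length ws"
    and b: "\<And>u v. i \<le> u \<Longrightarrow> u < v \<Longrightarrow> v \<le> j \<Longrightarrow> (u, v) \<noteq> (i, j) \<Longrightarrow> b u v = a (s + u, s + v)"
  shows "massey_sum A ws b i j = - higher_sum (mul A) (<) \<rho> a (s + i, s + j)"
proof -
  have "massey_sum A ws b i j =
     (\<Sum>l\<in>{i<..<j}. mul A [bar (edge_deg \<rho> (s + i, s + l)) (a (s + i, s + l)), a (s + l, s + j)])"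
    unfolding massey_sum_def
  proof (rule sum.cong[OF refl])
    fix l assume l: "l \<in> {i<..<j}"
    have "massey_deg ws i l = edge_deg \<rho> (s + i, s + l)" using l ij by (intro massey_deg_eq ws) auto
    then show "mul A [bar (massey_deg ws i l) (b i l), b l j] =
        mul A [bar (edge_deg \<rho> (s + i, s + l)) (a (s + i, s + l)), a (s + l, s + j)]"
      using b[of i l] b[of l j] l by simp
  qed
  also have "\<dots> = (\<Sum>l\<in>{s + i<..<s + j}. mul A [bar (edge_deg \<rho> (s + i, l)) (a (s + i, l)), a (l, s + j)])"
    by (rule sum.reindex_bij_witness[where i="\<lambda>l. l - s" and j="\<lambda>l. s + l"]) auto
  finally show ?thesis using higher_sum_dga[OF A dga a, of "s + i" "s + j"] ij by simp
qed

lemma massey_product_deg_eq: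
  "ws \<noteq> [] \<Longrightarrow> massey_product_deg ws = massey_deg ws 0 (length ws) - 1"
  by (simp add: massey_product_deg_def massey_deg_def sum_list_sum_nth)

text \<open>A class of degree p raises the potential by p + 1, which makes \<open>edge_deg\<close>
  return p. Beyond the last class the potential is kept constant, because the entries of the list
  are unspecified there.\<close>

definition massey_pot :: "(int \<times> 'a set) list \<Rightarrow> nat \<Rightarrow> int" where
  "massey_pot ws l = (\<Sum>k<l. if k < length ws then fst (ws ! k) + 1 else 0)"

lemma massey_pot: "l < length ws \<Longrightarrow> fst (ws ! l) = edge_deg (massey_pot ws) (0 + l, Suc (0 + l))"
  by (simp add: massey_pot_def edge_deg_def)

context
  fixes A :: "('k::comm_ring_1, 'a::ab_group_add, 'z) ainf_scheme" and D :: "int set" and r :: nat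
  assumes A: "ainf_algebra A" and dga: "\<And>xs. 3 \<le> length xs \<Longrightarrow> mul A xs = 0"
begin

definition admissible :: "(int \<times> 'a set) list \<Rightarrow> bool" where
  "admissible ws \<longleftrightarrow> 2 \<le> length ws \<and> length ws \<le> r \<and> (\<forall>(p, c)\<in>set ws. p \<in> D \<and> c \<in> homology A p)"

lemma admissible_nth:
  assumes "admissible ws" "l < length ws"
  shows "fst (ws ! l) \<in> D" "snd (ws ! l) \<in> homology A (fst (ws ! l))"
  using assms nth_mem[OF assms(2)] unfolding admissible_def by (auto simp: case_prod_unfold)

lemma homology_cycles: "c \<in> homology A p \<Longrightarrow> x \<in> c \<Longrightarrow> x \<in> cycles A p"
  by (metis hclassD homologyE)

lemma massey_sum_boundary:
  assumes ext: "mc_extendable D A r" and ws: "admissible ws" and b: "defining_system A ws b"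
  shows "\<exists>z\<in>comp A (massey_product_deg ws + 1). massey_sum A ws b 0 (length ws) = mul A [z]"
proof -
  let ?n = "length ws" and ?\<rho> = "massey_pot ws"
  have n: "2 \<le> ?n" "?n \<le> r" using ws by (auto simp: admissible_def)
  \<comment> \<open>The definition of a defining system says nothing about the corner and about
    pairs out of range; 0 is put there to obtain a graded matrix.\<close>
  define a where "a = (\<lambda>(u, v). if u < v \<and> v \<le> ?n \<and> (u, v) \<noteq> (0, ?n) then b u v else 0)"
  have deg: "massey_deg ws i j = edge_deg ?\<rho> (i, j)" if "i \<le> j" "j \<le> ?n" for i j
    using massey_deg_eq[of ws ?\<rho> 0, OF massey_pot that] by simp
  have b1: "b l (Suc l) \<in> cycles A (edge_deg ?\<rho> (l, Suc l))" if "l < ?n" for l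
    using b that homology_cycles[OF admissible_nth(2)[OF ws that]] massey_pot[OF that]
    by (simp add: defining_system_def)
  have b2: "b i j \<in> comp A (edge_deg ?\<rho> (i, j))" "mul A [b i j] = massey_sum A ws b i j"
    if "i + 1 < j" "j \<le> ?n" "(i, j) \<noteq> (0, ?n)" for i j
  proof -
    have "b i j \<in> comp A (massey_deg ws i j) \<and> mul A [b i j] = massey_sum A ws b i j"
      using b that unfolding defining_system_def by blast
    then show "b i j \<in> comp A (edge_deg ?\<rho> (i, j))" "mul A [b i j] = massey_sum A ws b i j"
      using deg[of i j] that by auto
  qed
  have a: "graded A (<) ?\<rho> a"
    unfolding graded_def
  proof (intro allI impI)
    fix u v :: nat assume "u < v"
    then show "a (u, v) \<in> comp A (edge_deg ?\<rho> (u, v))"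
      using b1[of u] b2(1)[of u v] comp_closed(1)[OF A] by (cases "v = Suc u") (auto simp: a_def cycles_def)
  qed
  have sum_eq: "massey_sum A ws b i j = - higher_sum (mul A) (<) ?\<rho> a (i, j)" if "i < j" "j \<le> ?n" for i j
  proof -
    have "massey_sum A ws b i j = - higher_sum (mul A) (<) ?\<rho> a (0 + i, 0 + j)"
      by (rule massey_sum_higher_sum[OF A dga a massey_pot that]) (use that in \<open>auto simp: a_def\<close>)
    then show ?thesis by simp
  qed
  have "mc_off_corner A ?\<rho> a 0 ?n"
    unfolding mc_off_corner_def
  proof (intro allI impI)
    fix u v assume uv: "0 \<le> u \<and> u < v \<and> v \<le> ?n \<and> (u, v) \<noteq> (0, ?n)"
    then have "mul A [b u v] = massey_sum A ws b u v"
      using b1[of u] b2(2)[of u v] by (cases "v = Suc u") (auto simp: cycles_def massey_sum_def greaterThanLessThan_Suc)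
    moreover have "a (u, v) = b u v" using uv by (simp add: a_def)
    ultimately show "path_sum (mul A) (<) ?\<rho> a (u, v) = 0"
      using nat_order.path_sum_split[of u v "mul A" ?\<rho> a] sum_eq[of u v] uv by simp
  qed
  moreover have "\<forall>l\<in>{0..<?n}. edge_deg ?\<rho> (l, Suc l) \<in> D"
    using admissible_nth(1)[OF ws] massey_pot[of _ ws] by simp
  ultimately obtain z where z: "z \<in> comp A (edge_deg ?\<rho> (0, ?n))" "mul A [z] + higher_sum (mul A) (<) ?\<rho> a (0, ?n) = 0"
    using ext[unfolded mc_extendable_def, rule_format, of 0 ?n ?\<rho> a] n a by auto
  have n0: "0 < ?n" using n by linarith
  moreover have "mul A [z] = - higher_sum (mul A) (<) ?\<rho> a (0, ?n)" using z(2) by (simp add: eq_neg_iff_add_eq_0)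
  ultimately have "massey_sum A ws b 0 ?n = mul A [z]" using sum_eq[of 0 ?n] by simp
  moreover have "edge_deg ?\<rho> (0, ?n) = massey_product_deg ws + 1"
    using deg[of 0 ?n] massey_product_deg_eq[of ws] n0 by auto
  ultimately show ?thesis using z(1) by metis
qed

text \<open>\<open>mc_extendable\<close> fills the proper subintervals in the order of their length.
  The representatives are prescribed because the product of two classes is formed over all pairs of
  representatives.\<close>

lemma defining_system_exists:
  assumes ext: "mc_extendable D A r" and ws: "admissible ws"
    and x: "\<And>l. l < length ws \<Longrightarrow> x l \<in> snd (ws ! l)"
  shows "\<exists>b. defining_system A ws b \<and> (\<forall>l<length ws. b l (Suc l) = x l)"
proof -
  let ?n = "length ws" and ?\<rho> = "massey_pot ws"
  have n: "2 \<le> ?n" "?n \<le> r" using ws by (auto simp: admissible_def)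
  have deg: "massey_deg ws i j = edge_deg ?\<rho> (i, j)" if "i \<le> j" "j \<le> ?n" for i j
    using massey_deg_eq[of ws ?\<rho> 0, OF massey_pot that] by simp
  have D: "edge_deg ?\<rho> (l, Suc l) \<in> D" if "l < ?n" for l
    using admissible_nth(1)[OF ws that] massey_pot[OF that] by simp
  have xc: "x l \<in> cycles A (edge_deg ?\<rho> (l, Suc l))" if "l < ?n" for l
    using homology_cycles[OF admissible_nth(2)[OF ws that] x[OF that]] massey_pot[OF that] by simp
  define sys where "sys L a \<longleftrightarrow> graded A (<) ?\<rho> a \<and> (\<forall>l<?n. a (l, Suc l) = x l) \<and>
      (\<forall>u v. u < v \<and> v \<le> ?n \<and> (u, v) \<noteq> (0, ?n) \<and> v - u \<le> L \<longrightarrow> path_sum (mul A) (<) ?\<rho> a (u, v) = 0)" for L a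
  have "\<exists>a. sys (Suc L) a" for L
  proof (induction L)
    case 0
    define a where "a = (\<lambda>(u, v). if u < ?n \<and> v = Suc u then x u else 0)"
    have a: "graded A (<) ?\<rho> a"
      using xc comp_closed(1)[OF A] by (auto simp: graded_def a_def cycles_def)
    have "path_sum (mul A) (<) ?\<rho> a (u, v) = 0" if "u < v" "v \<le> ?n" "v - u \<le> Suc 0" for u v
    proof -
      have v: "v = Suc u" "u < ?n" using that by auto
      have "higher_sum (mul A) (<) ?\<rho> a (u, v) = 0"
        using higher_sum_dga[OF A dga a that(1)] by (simp add: v greaterThanLessThan_Suc)
      then show ?thesis
        using nat_order.path_sum_split[OF that(1), of "mul A" ?\<rho> a] xc[OF v(2)] v by (simp add: a_def cycles_def)
    qed
    with a have "sys (Suc 0) a" by (auto simp: sys_def a_def)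
    then show ?case by blast
  next
    case (Suc L)
    then obtain a where a: "graded A (<) ?\<rho> a" "\<And>l. l < ?n \<Longrightarrow> a (l, Suc l) = x l"
      and zero: "\<And>u v. u < v \<Longrightarrow> v \<le> ?n \<Longrightarrow> (u, v) \<noteq> (0, ?n) \<Longrightarrow> v - u \<le> Suc L \<Longrightarrow>
         path_sum (mul A) (<) ?\<rho> a (u, v) = 0"
      by (auto simp: sys_def)
    define ok where "ok i \<longleftrightarrow> i + Suc (Suc L) \<le> ?n \<and> (i, i + Suc (Suc L)) \<noteq> (0, ?n)" for i
    have "\<exists>z. z \<in> comp A (edge_deg ?\<rho> (i, i + Suc (Suc L))) \<and>
        mul A [z] + higher_sum (mul A) (<) ?\<rho> a (i, i + Suc (Suc L)) = 0" if i: "ok i" for i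
    proof -
      let ?j = "i + Suc (Suc L)"
      have "mc_off_corner A ?\<rho> a i ?j" using zero i by (auto simp: mc_off_corner_def ok_def)
      moreover have "\<forall>l\<in>{i..<?j}. edge_deg ?\<rho> (l, Suc l) \<in> D" using D i by (auto simp: ok_def)
      moreover have "i + 2 \<le> ?j" "?j \<le> i + r" using i n by (auto simp: ok_def)
      ultimately show ?thesis using ext a(1) unfolding mc_extendable_def by blast
    qed
    then obtain z where z: "\<And>i. ok i \<Longrightarrow> z i \<in> comp A (edge_deg ?\<rho> (i, i + Suc (Suc L)))"
      "\<And>i. ok i \<Longrightarrow> mul A [z i] + higher_sum (mul A) (<) ?\<rho> a (i, i + Suc (Suc L)) = 0"
      by metis
    define a' where "a' = (\<lambda>(u, v). if ok u \<and> v = u + Suc (Suc L) then z u else a (u, v))"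
    have "graded A (<) ?\<rho> a'" using a(1) z(1) by (auto simp: graded_def a'_def)
    moreover have "a' (l, Suc l) = x l" if "l < ?n" for l using a(2)[OF that] by (simp add: a'_def)
    moreover have "path_sum (mul A) (<) ?\<rho> a' (u, v) = 0"
      if uv: "u < v" "v \<le> ?n" "(u, v) \<noteq> (0, ?n)" "v - u \<le> Suc (Suc L)" for u v
    proof (cases "v - u \<le> Suc L")
      case True
      have "path_sum (mul A) (<) ?\<rho> a' (u, v) = path_sum (mul A) (<) ?\<rho> a (u, v)"
        by (rule nat_order.path_sum_cong) (use uv True in \<open>auto simp: a'_def\<close>)
      then show ?thesis using zero uv True by simp
    next
      case False
      then have v: "v = u + Suc (Suc L)" using uv by simp
      then have ok: "ok u" using uv by (simp add: ok_def)
      have "higher_sum (mul A) (<) ?\<rho> a' (u, v) = higher_sum (mul A) (<) ?\<rho> a (u, v)"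
        by (rule nat_order.higher_sum_cong) (use v in \<open>auto simp: a'_def\<close>)
      then show ?thesis
        using nat_order.path_sum_split[OF uv(1), of "mul A" ?\<rho> a'] z(2)[OF ok] ok v by (simp add: a'_def)
    qed
    ultimately have "sys (Suc (Suc L)) a'" by (auto simp: sys_def)
    then show ?case by blast
  qed
  then obtain a where "sys (Suc ?n) a" by blast
  then have a: "graded A (<) ?\<rho> a" "\<And>l. l < ?n \<Longrightarrow> a (l, Suc l) = x l"
      and zero: "\<And>u v. u < v \<Longrightarrow> v \<le> ?n \<Longrightarrow> (u, v) \<noteq> (0, ?n) \<Longrightarrow> path_sum (mul A) (<) ?\<rho> a (u, v) = 0"
    by (auto simp: sys_def)
  define b where "b u v = a (u, v)" for u v
  have "b i j \<in> comp A (massey_deg ws i j) \<and> mul A [b i j] = massey_sum A ws b i j"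
    if ij: "i + 1 < j" "j \<le> ?n" "(i, j) \<noteq> (0, ?n)" for i j
  proof -
    have lt: "i < j" using ij by simp
    have "massey_sum A ws b i j = - higher_sum (mul A) (<) ?\<rho> a (i, j)"
      using massey_sum_higher_sum[where s=0, OF A dga a(1) massey_pot lt ij(2), of b] by (simp add: b_def)
    moreover have "mul A [a (i, j)] = - higher_sum (mul A) (<) ?\<rho> a (i, j)"
      using zero[OF lt ij(2,3)] nat_order.path_sum_split[OF lt, of "mul A" ?\<rho> a]
      by (simp add: eq_neg_iff_add_eq_0)
    ultimately have "mul A [b i j] = massey_sum A ws b i j" by (simp add: b_def)
    moreover have "b i j \<in> comp A (edge_deg ?\<rho> (i, j))" using a(1) lt by (simp add: graded_def b_def)
    ultimately show ?thesis using deg[of i j] ij by simp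
  qed
  then have "defining_system A ws b" using x a(2) by (auto simp: defining_system_def b_def)
  then show ?thesis using a(2) by (intro exI[of _ b]) (auto simp: b_def)
qed

text \<open>For two classes the Massey product is the plain product, while the sum over a defining
  system carries a bar. The two differ by a sign, which does not affect being a boundary.\<close>

lemma massey_sum_2:
  assumes "length ws = 2" "x \<in> comp A p" "y \<in> comp A q" "b 0 1 = x" "b 1 2 = y"
  shows "massey_sum A ws b 0 2 = sgn_pow (massey_deg ws 0 1 + 1) (mul A [x, y])"
proof -
  have "{0<..<2::nat} = {1}" by auto
  then have "massey_sum A ws b 0 2 = mul A ([] @ sgn_pow (massey_deg ws 0 1 + 1) x # [y])"
    using assms(4,5) by (simp add: massey_sum_def bar_def)
  also have "\<dots> = sgn_pow (massey_deg ws 0 1 + 1) (mul A ([] @ x # [y]))"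
    using comp_in_total[OF A] assms(2,3)
    by (intro multiadd_sgn_pow[OF ainf_algebraD(2)[OF A] add_closed_total[OF ainf_algebraD(1)[OF A]]]) auto
  finally show ?thesis by simp
qed

text \<open>Equality with a singleton has two parts: every defining system gives a boundary, and a
  defining system exists.\<close>

lemma massey_product_zero:
  assumes ext: "mc_extendable D A r" and ws: "admissible ws"
  shows "massey_product A ws = {hclass A (massey_product_deg ws) 0}"
proof -
  let ?n = "length ws" and ?d = "massey_product_deg ws"
  have "\<exists>x. x \<in> snd (ws ! l)" if "l < ?n" for l
    using admissible_nth(2)[OF ws that] hclass_self[OF A] by (metis homologyE)
  then obtain x where x: "\<And>l. l < ?n \<Longrightarrow> x l \<in> snd (ws ! l)" by metis
  have sys: "hclass A ?d (massey_sum A ws b 0 ?n) = hclass A ?d 0" if b: "defining_system A ws b" for b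
  proof -
    obtain z where "z \<in> comp A (?d + 1)" "massey_sum A ws b 0 ?n = mul A [z]"
      using massey_sum_boundary[OF ext ws b] by blast
    then show ?thesis using boundary_hclass[OF A] by simp
  qed
  show ?thesis
  proof (cases "?n = 2")
    case True
    have "hclass A ?d (mul A [x, y]) = hclass A ?d 0" if xy: "x \<in> snd (ws ! 0)" "y \<in> snd (ws ! 1)" for x y
    proof -
      have xc: "x \<in> comp A (fst (ws ! 0))" "y \<in> comp A (fst (ws ! 1))"
        using homology_cycles[OF admissible_nth(2)[OF ws]] xy True by (auto simp: cycles_def)
      have "(if l = 0 then x else y) \<in> snd (ws ! l)" if "l < ?n" for l
        using xy True that by (cases l) auto
      then obtain b where b: "defining_system A ws b" "\<And>l. l < ?n \<Longrightarrow> b l (Suc l) = (if l = 0 then x else y)"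
        using defining_system_exists[OF ext ws, of "\<lambda>l. if l = 0 then x else y"] by blast
      have "b 0 1 = x" "b 1 2 = y" using b(2)[of 0] b(2)[of 1] True by (auto simp: numeral_2_eq_2)
      note eq = massey_sum_2[where b=b, OF True xc this]
      obtain z where z: "z \<in> comp A (?d + 1)" "massey_sum A ws b 0 2 = mul A [z]"
        using massey_sum_boundary[OF ext ws b(1)] True by auto
      have "mul A [x, y] = mul A [sgn_pow (massey_deg ws 0 1 + 1) z]"
        using eq z(2) mul_single(5)[OF A z(1)] by (metis sgn_pow_twice)
      then show ?thesis using boundary_hclass[OF A comp_closed(5)[OF A z(1)]] by simp
    qed
    then have "massey_product A ws = {hclass A ?d 0 | x y. x \<in> snd (ws ! 0) \<and> y \<in> snd (ws ! 1)}"
      unfolding massey_product_def if_P[OF True] by (intro Collect_cong) metis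
    moreover have "x 0 \<in> snd (ws ! 0)" "x 1 \<in> snd (ws ! 1)" using x[of 0] x[of 1] True by auto
    ultimately show ?thesis by blast
  next
    case False
    obtain b where "defining_system A ws b" using defining_system_exists[OF ext ws x] by blast
    then show ?thesis using False sys unfolding massey_product_def by auto
  qed
qed

lemma massey_defined_admissible:
  assumes ext: "mc_extendable D A r"
  shows "admissible ws \<Longrightarrow> massey_defined A ws"
proof (induction "length ws" arbitrary: ws rule: less_induct)
  case less
  have sub: "admissible (take l (drop i ws))" if "2 \<le> l" "l < length ws" "i + l \<le> length ws" for i l
    using less.prems that set_take_subset set_drop_subset unfolding admissible_def
    by (fastforce dest: in_set_takeD in_set_dropD)
  have "massey_defined A (take l (drop i ws)) \<and>
      hclass A (massey_product_deg (take l (drop i ws))) 0 \<in> massey_product A (take l (drop i ws))"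
    if il: "2 \<le> l" "l < length ws" "i + l \<le> length ws" for i l
    using less.hyps[OF _ sub[OF il]] massey_product_zero[OF ext sub[OF il]] il by auto
  then show ?case by (subst massey_defined.simps) blast
qed

text \<open>The entries next to the diagonal are cycles, as there are no paths with two edges
  between neighbours. The rest of the matrix, renumbered to begin at 0, is a defining system for
  their classes, and a primitive of its Massey sum fills the corner.\<close>

lemma condition_B_imp_extendable:
  assumes cond: "condition_B_on D A r"
  shows "mc_extendable D A r"
  unfolding mc_extendable_def
proof (intro allI impI, elim conjE)
  fix \<rho> s e a
  assume se: "s + 2 \<le> e" "e \<le> s + r" and D: "\<forall>l\<in>{s..<e}. edge_deg \<rho> (l, Suc l) \<in> D"
    and a: "graded A (<) \<rho> a" and zero: "mc_off_corner A \<rho> a s e"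
  define ws where "ws = map (\<lambda>l. (edge_deg \<rho> (l, Suc l), hclass A (edge_deg \<rho> (l, Suc l)) (a (l, Suc l)))) [s..<e]"
  define b where "b u v = a (s + u, s + v)" for u v
  let ?d = "massey_product_deg ws" and ?H = "higher_sum (mul A) (<) \<rho> a (s, e)"
  have len: "length ws = e - s" by (simp add: ws_def)
  have wsl: "fst (ws ! l) = edge_deg \<rho> (s + l, Suc (s + l))"
      "snd (ws ! l) = hclass A (edge_deg \<rho> (s + l, Suc (s + l))) (a (s + l, Suc (s + l)))" if "l < length ws" for l
    using that by (auto simp: ws_def)
  have cyc: "a (l, Suc l) \<in> cycles A (edge_deg \<rho> (l, Suc l))" if l: "s \<le> l" "l < e" for l
  proof -
    have "(l, Suc l) \<noteq> (s, e)" using se by auto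
    then have "path_sum (mul A) (<) \<rho> a (l, Suc l) = 0" using zero l unfolding mc_off_corner_def by (meson Suc_leI lessI)
    moreover have "higher_sum (mul A) (<) \<rho> a (l, Suc l) = 0"
      using higher_sum_dga[OF A dga a, of l "Suc l"] by (simp add: greaterThanLessThan_Suc)
    ultimately have "mul A [a (l, Suc l)] = 0" using nat_order.path_sum_split[of l "Suc l" "mul A" \<rho> a] by simp
    then show ?thesis using a by (simp add: graded_def cycles_def)
  qed
  have adm: "2 \<le> length ws \<and> length ws \<le> r \<and> (\<forall>(p, c)\<in>set ws. p \<in> D \<and> c \<in> homology A p)"
    using se D hclass_in_homology[OF cyc] by (auto simp: ws_def)
  have deg: "massey_deg ws i j = edge_deg \<rho> (s + i, s + j)" if "i \<le> j" "j \<le> length ws" for i j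
    using massey_deg_eq[OF wsl(1) that] .
  have sum_eq: "massey_sum A ws b i j = - higher_sum (mul A) (<) \<rho> a (s + i, s + j)" if "i < j" "j \<le> length ws" for i j
    using massey_sum_higher_sum[OF A dga a wsl(1) that, of b] by (simp add: b_def)
  have prod: "massey_product A ws = {hclass A ?d 0}" using cond adm unfolding condition_B_on_def by blast
  have lt: "s < e" and ee: "s + length ws = e" using se len by auto
  have "ws \<noteq> []" using lt len by auto
  then have dd: "?d + 1 = edge_deg \<rho> (s, e)" "?d = \<rho> e - \<rho> s - 2"
    using massey_product_deg_eq[of ws] deg[of 0 "length ws"] ee lt len by (auto simp: edge_deg_def)
  \<comment> \<open>With 0 as corner entry the path sum at the corner is \<open>?H\<close> itself,
    so \<open>?H\<close> is a cycle. Equality of classes yields a primitive only for cycles.\<close>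
  have a0: "graded A (<) \<rho> (a((s, e) := 0))" by (rule graded_upd[OF a comp_closed(1)[OF A]])
  have "mc_off_corner A \<rho> (a((s, e) := 0)) s e"
    using zero path_sum_upd_other[of s _ _ e "mul A" \<rho> a 0] unfolding mc_off_corner_def by simp
  from path_sum_in_cycles[OF A a0 lt this] have Hc: "?H \<in> cycles A ?d"
    using path_sum_upd[OF lt, of "mul A" \<rho> a 0] mul_single(1)[OF A] dd(2) by simp
  have bdry: "\<exists>z\<in>comp A (edge_deg \<rho> (s, e)). y = mul A [z]" if "y \<in> cycles A ?d" "hclass A ?d y \<in> massey_product A ws" for y
    using that(2) hclass_eq_iff[OF A that(1) cycles_closed(1)[OF A]] unfolding prod dd(1) by simp
  have nHc: "- ?H \<in> cycles A ?d" using cycles_closed(2)[OF A cycles_closed(1)[OF A] Hc] by simp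
  have ms: "massey_sum A ws b 0 (length ws) = - ?H" using sum_eq[of 0 "length ws"] ee lt len by simp
  have "\<exists>z\<in>comp A (edge_deg \<rho> (s, e)). - ?H = mul A [z]"
  proof (cases "length ws = 2")
    case True
    let ?x = "b 0 1" and ?y = "b 1 2" and ?k = "massey_deg ws 0 1 + 1"
    have xc: "?x \<in> comp A (edge_deg \<rho> (s, Suc s))" "?y \<in> comp A (edge_deg \<rho> (Suc s, Suc (Suc s)))"
      using a by (auto simp: graded_def b_def)
    have H: "- ?H = sgn_pow ?k (mul A [?x, ?y])"
      using massey_sum_2[where b=b, OF True xc refl refl] ms True by simp
    then have m: "mul A [?x, ?y] = sgn_pow ?k (- ?H)" by (simp add: sgn_pow_twice)
    have mc: "mul A [?x, ?y] \<in> cycles A ?d"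
      unfolding m using nHc Hc by (simp add: sgn_pow_def)
    have "?x \<in> snd (ws ! 0)" "?y \<in> snd (ws ! 1)"
      using wsl(2)[of 0] wsl(2)[of 1] hclass_self[OF A cyc[of s]] hclass_self[OF A cyc[of "Suc s"]] True ee
      by (auto simp: b_def)
    then have "hclass A ?d (mul A [?x, ?y]) \<in> massey_product A ws"
      using True by (auto simp: massey_product_def)
    from bdry[OF mc this] obtain z where z: "z \<in> comp A (edge_deg \<rho> (s, e))" "mul A [?x, ?y] = mul A [z]" by blast
    have "- ?H = mul A [sgn_pow ?k z]" using H z(2) mul_single(5)[OF A z(1)] by simp
    then show ?thesis using comp_closed(5)[OF A z(1)] by blast
  next
    case False
    have "b i (Suc i) \<in> snd (ws ! i)" if "i < length ws" for i
      using wsl(2)[OF that] hclass_self[OF A cyc[of "s + i"]] that len by (simp add: b_def)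
    moreover have "b i j \<in> comp A (massey_deg ws i j) \<and> mul A [b i j] = massey_sum A ws b i j"
      if ij: "i + 1 < j" "j \<le> length ws" "(i, j) \<noteq> (0, length ws)" for i j
    proof -
      have lt': "i < j" using ij by simp
      have "path_sum (mul A) (<) \<rho> a (s + i, s + j) = 0"
        using zero ij ee unfolding mc_off_corner_def by auto
      then have "mul A [a (s + i, s + j)] = - higher_sum (mul A) (<) \<rho> a (s + i, s + j)"
        using nat_order.path_sum_split[of "s + i" "s + j" "mul A" \<rho> a] lt'
        by (simp add: eq_neg_iff_add_eq_0)
      then have "mul A [b i j] = massey_sum A ws b i j"
        using sum_eq[OF lt' ij(2)] by (simp add: b_def)
      then show ?thesis using a deg[of i j] ij by (simp add: graded_def b_def)
    qed
    ultimately have "defining_system A ws b" by (auto simp: defining_system_def)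
    then have "hclass A ?d (massey_sum A ws b 0 (length ws)) \<in> massey_product A ws"
      using False by (auto simp: massey_product_def)
    then show ?thesis using bdry[OF nHc] unfolding ms by blast
  qed
  then obtain z where "z \<in> comp A (edge_deg \<rho> (s, e))" "- ?H = mul A [z]" by blast
  then show "\<exists>z\<in>comp A (edge_deg \<rho> (s, e)). mul A [z] + ?H = 0"
    by (intro bexI[of _ z]) (auto simp: eq_neg_iff_add_eq_0[symmetric])
qed

lemma condition_B_iff_extendable: "condition_B_on D A r \<longleftrightarrow> mc_extendable D A r"
proof
  assume ext: "mc_extendable D A r"
  then show "condition_B_on D A r"
    using massey_defined_admissible[OF ext] massey_product_zero[OF ext]
    unfolding condition_B_on_def admissible_def by blast
qed (rule condition_B_imp_extendable)

end

section \<open>Minimal algebras\<close>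

lemma path_length: "path (<) x w y \<Longrightarrow> x \<le> y \<and> length w \<le> y - (x::nat)"
  by (induction w arbitrary: x) fastforce+

text \<open>Each edge raises the number by at least 1, so a path of maximal length has steps of
  exactly 1.\<close>

lemma unit_path:
  "path (<) x w y \<Longrightarrow> length w = y - x \<Longrightarrow> w = map (\<lambda>l. (l, Suc l)) [x..<y::nat]"
proof (induction w arbitrary: x)
  case Nil
  then show ?case by simp
next
  case (Cons e w)
  obtain z where e: "e = (x, z)" "x < z" "path (<) z w y" using Cons.prems(1) by (cases e) auto
  have "z \<le> y" "length w \<le> y - z" using path_length[OF e(3)] by auto
  then have z: "z = Suc x" "length w = y - z" "x < y" using Cons.prems(2) e(2) by auto
  have "w = map (\<lambda>l. (l, Suc l)) [Suc x..<y]" using Cons.IH[OF e(3) z(2)] z(1) by simp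
  then show ?case using z e(1) by (simp add: upt_conv_Cons)
qed

text \<open>If edges of degrees p and q follow each other, the edge joining the outer endpoints has
  degree p + q + 1, because \<rho> is additive and each edge subtracts 1.\<close>

lemma edge_deg_closed:
  assumes cl: "\<And>p q. p \<in> D \<Longrightarrow> q \<in> D \<Longrightarrow> p + q + 1 \<in> D"
    and D: "\<And>l. s \<le> l \<Longrightarrow> l < e \<Longrightarrow> edge_deg \<rho> (l, Suc l) \<in> D"
    and uv: "s \<le> u" "u < v" "v \<le> e"
  shows "edge_deg \<rho> (u, v) \<in> D"
  using uv(2,3)
proof (induction v)
  case (Suc v)
  show ?case
  proof (cases "u = v")
    case False
    then have "edge_deg \<rho> (u, v) \<in> D" "edge_deg \<rho> (v, Suc v) \<in> D" using Suc D[of v] uv(1) by auto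
    then have "edge_deg \<rho> (u, v) + edge_deg \<rho> (v, Suc v) + 1 \<in> D" by (rule cl)
    then show ?thesis by (simp add: edge_deg_def)
  qed (use D Suc uv in auto)
qed simp

text \<open>If the operations vanish, so does every summand of \<open>higher_sum\<close>.
  Conversely, by induction on the arity, the arguments of mu_n are placed next to the diagonal of a
  matrix that is 0 elsewhere. The lower operations vanish, so the matrix is Maurer-Cartan off its
  corner, and its corner obstruction is the given value of mu_n up to sign; as a boundary it is
  0.\<close>

lemma mc_extendable_minimal:
  assumes A: "ainf_algebra A" and min: "\<And>p x. x \<in> comp A p \<Longrightarrow> mul A [x] = 0"
    and cl: "\<And>p q. p \<in> D \<Longrightarrow> q \<in> D \<Longrightarrow> p + q + 1 \<in> D"
  shows "mc_extendable D A r \<longleftrightarrow>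
    (\<forall>ps xs. 2 \<le> length xs \<and> length xs \<le> r \<and> set ps \<subseteq> D \<and> homogeneous A ps xs \<longrightarrow> mul A xs = 0)"
proof
  assume van: "\<forall>ps xs. 2 \<le> length xs \<and> length xs \<le> r \<and> set ps \<subseteq> D \<and> homogeneous A ps xs \<longrightarrow> mul A xs = 0"
  show "mc_extendable D A r"
    unfolding mc_extendable_def
  proof (intro allI impI, elim conjE)
    fix \<rho> s e a
    assume se: "s + 2 \<le> e" "e \<le> s + r" and D: "\<forall>l\<in>{s..<e}. edge_deg \<rho> (l, Suc l) \<in> D"
      and a: "graded A (<) \<rho> a"
    have "higher_sum (mul A) (<) \<rho> a (s, e) = 0"
      unfolding higher_sum_def
    proof (rule sum.neutral, rule ballI)
      fix w assume "w \<in> paths (<) (fst (s, e)) (snd (s, e)) - {[(s, e)]}"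
      then have w: "path (<) s w e" "w \<noteq> [(s, e)]" by (auto simp: paths_def)
      have "w \<noteq> []" using w(1) se by auto
      moreover have "length w \<noteq> 1" using w by (auto simp: length_Suc_conv prod_eq_iff)
      ultimately have len: "2 \<le> length w" "length w \<le> r"
        using path_length[OF w(1)] se by (cases w, simp, cases "tl w", auto)
      have "set (map (edge_deg \<rho>) w) \<subseteq> D"
      proof clarsimp
        fix u v assume uv: "(u, v) \<in> set w"
        show "edge_deg \<rho> (u, v) \<in> D"
          by (rule edge_deg_closed[of D s e]) (use cl D nat_order.path_edge(1-3)[OF w(1) uv] in auto)
      qed
      then have "mul A (map a w) = 0" using van len homogeneous_path[OF a w(1)] by (metis length_map)
      then show "weight (mul A) \<rho> a w = 0" by (simp add: weight_def shifted_def)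
    qed
    then show "\<exists>z\<in>comp A (edge_deg \<rho> (s, e)). mul A [z] + higher_sum (mul A) (<) \<rho> a (s, e) = 0"
      using comp_closed(1)[OF A] mul_single(1)[OF A] by (intro bexI[of _ 0]) auto
  qed
next
  assume ext: "mc_extendable D A r"
  have "mul A xs = 0" if "2 \<le> length xs" "length xs \<le> r" "set ps \<subseteq> D" "homogeneous A ps xs" for ps xs
    using that
  proof (induction "length xs" arbitrary: ps xs rule: less_induct)
    case less
    let ?n = "length xs"
    define \<rho> where "\<rho> l = (\<Sum>k<l. if k < ?n then ps ! k + 1 else 0)" for l
    define a where "a = (\<lambda>(u, v). if v = Suc u \<and> u < ?n then xs ! u else 0)"
    have ps: "length ps = ?n" "\<And>l. l < ?n \<Longrightarrow> xs ! l \<in> comp A (ps ! l)"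
      using less.prems(4) by (auto simp: homogeneous_def list_all2_conv_all_nth)
    have deg: "edge_deg \<rho> (l, Suc l) = ps ! l" if "l < ?n" for l
      using that by (simp add: edge_deg_def \<rho>_def)
    have a: "graded A (<) \<rho> a"
      using ps(2) deg comp_closed(1)[OF A] by (auto simp: graded_def a_def)
    have D: "edge_deg \<rho> (l, Suc l) \<in> D" if "l < ?n" for l
      using deg[OF that] less.prems(3) ps(1) that nth_mem by fastforce
    \<comment> \<open>Paths through zero entries are included: the induction hypothesis only asks
      for degrees in D, and \<open>edge_deg_closed\<close> provides this for every edge.\<close>
    have W: "weight (mul A) \<rho> a w = 0" if w: "path (<) u w v" "u < v" "v \<le> ?n" "length w < ?n" for u v w
    proof -
      have "mul A (map a w) = 0"
      proof (cases "length w = 1")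
        case True
        then obtain e where e: "w = [e]" by (auto simp: length_Suc_conv)
        then show ?thesis using min homogeneous_path[OF a w(1)] by (simp add: homogeneous_def)
      next
        case False
        have "w \<noteq> []" using w by auto
        then have len: "2 \<le> length w" using False by (cases w, simp, cases "tl w", auto)
        have "set (map (edge_deg \<rho>) w) \<subseteq> D"
        proof clarsimp
          fix p q assume pq: "(p, q) \<in> set w"
          show "edge_deg \<rho> (p, q) \<in> D"
            by (rule edge_deg_closed[of D 0 ?n]) (use cl D w nat_order.path_edge(1-3)[OF w(1) pq] in auto)
        qed
        then show ?thesis
          using less.hyps[of "map a w" "map (edge_deg \<rho>) w"] len w(4) less.prems(2) homogeneous_path[OF a w(1)] by simp
      qed
      then show ?thesis by (simp add: weight_def shifted_def)
    qed
    have "mc_off_corner A \<rho> a 0 ?n"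
      unfolding mc_off_corner_def path_sum_def
    proof (intro allI impI sum.neutral ballI)
      fix u v w assume uv: "0 \<le> u \<and> u < v \<and> v \<le> ?n \<and> (u, v) \<noteq> (0, ?n)"
        and "w \<in> paths (<) (fst (u, v)) (snd (u, v))"
      then have w: "path (<) u w v" by (simp add: paths_def)
      show "weight (mul A) \<rho> a w = 0" using path_length[OF w] uv by (intro W[OF w]) auto
    qed
    then obtain z where z: "z \<in> comp A (edge_deg \<rho> (0, ?n))" "mul A [z] + higher_sum (mul A) (<) \<rho> a (0, ?n) = 0"
      using ext[unfolded mc_extendable_def, rule_format, of 0 ?n \<rho> a] less.prems D a by auto
    let ?u = "map (\<lambda>l. (l, Suc l)) [0..<?n]"
    have up: "path (<) 0 (map (\<lambda>l. (l, Suc l)) [0..<m]) m" for m :: nat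
      by (induction m) (auto simp: path_append)
    have "higher_sum (mul A) (<) \<rho> a (0, ?n) = (\<Sum>w\<in>{?u}. weight (mul A) \<rho> a w)"
      unfolding higher_sum_def
    proof (rule sum.mono_neutral_right)
      show "finite (paths (<) (fst (0, ?n)) (snd (0, ?n)) - {[(0, ?n)]})" by (simp add: nat_order.finite_paths)
      have "length ?u \<noteq> length [(0, ?n)]" using less.prems(1) by simp
      then have "?u \<noteq> [(0, ?n)]" by metis
      then show "{?u} \<subseteq> paths (<) (fst (0, ?n)) (snd (0, ?n)) - {[(0, ?n)]}" using up[of ?n] by (simp add: paths_def)
      show "\<forall>w\<in>paths (<) (fst (0, ?n)) (snd (0, ?n)) - {[(0, ?n)]} - {?u}. weight (mul A) \<rho> a w = 0"
      proof
        fix w assume "w \<in> paths (<) (fst (0, ?n)) (snd (0, ?n)) - {[(0, ?n)]} - {?u}"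
        then have w: "path (<) 0 w ?n" "w \<noteq> ?u" by (auto simp: paths_def)
        have "length w \<noteq> ?n - 0" using unit_path[OF w(1)] w(2) by blast
        then have "length w < ?n" using path_length[OF w(1)] by simp
        then show "weight (mul A) \<rho> a w = 0" using less.prems(1) by (intro W[OF w(1)]) auto
      qed
    qed
    moreover have "map a ?u = xs" by (rule nth_equalityI) (auto simp: a_def)
    ultimately show ?case using z(2) min[OF z(1)] by (simp add: weight_def shifted_def)
  qed
  then show "\<forall>ps xs. 2 \<le> length xs \<and> length xs \<le> r \<and> set ps \<subseteq> D \<and> homogeneous A ps xs \<longrightarrow> mul A xs = 0"
    by blast
qed


section \<open>Reduction of the resolution\<close>

lemma lookup_poly_map: "g 0 = 0 \<Longrightarrow> Poly_Mapping.lookup (Poly_Mapping.map g x) b = g (Poly_Mapping.lookup x b)"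
  by (auto simp: Poly_Mapping.map.rep_eq when_def)

lemma lookup_pm_scale: "Poly_Mapping.lookup (pm_scale c x) b = c * Poly_Mapping.lookup x b"
  by (simp add: pm_scale_def lookup_poly_map)

lemma lookup_reduce: "Poly_Mapping.lookup (reduce x) b = Poly_Mapping.lookup (Poly_Mapping.lookup x b) 0"
  by (simp add: reduce_def lookup_poly_map)

lemma lookup_const_lift: "Poly_Mapping.lookup (const_lift x) b = Const (Poly_Mapping.lookup x b)"
  by (simp add: const_lift_def lookup_poly_map Const_def)

lemma module_pm_scale: "module (pm_scale :: 's::comm_ring_1 \<Rightarrow> ('b \<Rightarrow>\<^sub>0 's) \<Rightarrow> _)"
  by unfold_locales (auto intro!: poly_mapping_eqI simp: lookup_pm_scale lookup_add algebra_simps)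

lemma sum_single_keys: "(\<Sum>b\<in>Poly_Mapping.keys x. Poly_Mapping.single b (Poly_Mapping.lookup x b)) = x"
proof (rule poly_mapping_eqI)
  fix k
  have "(\<Sum>b\<in>Poly_Mapping.keys x. Poly_Mapping.lookup (Poly_Mapping.single b (Poly_Mapping.lookup x b)) k) =
      (\<Sum>b\<in>Poly_Mapping.keys x. if b = k then Poly_Mapping.lookup x b else 0)"
    by (rule sum.cong) (auto simp: lookup_single when_def)
  also have "\<dots> = Poly_Mapping.lookup x k" by (simp add: in_keys_iff)
  finally show "Poly_Mapping.lookup (\<Sum>b\<in>Poly_Mapping.keys x. Poly_Mapping.single b (Poly_Mapping.lookup x b)) k =
      Poly_Mapping.lookup x k"
    by (simp add: lookup_sum)
qed

lemma exponent_sum_eq_0: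
  fixes e e' :: "'v \<Rightarrow>\<^sub>0 nat"
  assumes "e + e' = 0"
  shows "e = 0" "e' = 0"
proof -
  have "Poly_Mapping.lookup e v + Poly_Mapping.lookup e' v = 0" for v
    using assms by (metis lookup_add lookup_zero)
  then show "e = 0" "e' = 0" by (auto intro: poly_mapping_eqI)
qed

lemma constant_term_mult:
  fixes p q :: "('v, 'k::field) polyn"
  assumes "Poly_Mapping.lookup q 0 = 0"
  shows "Poly_Mapping.lookup (p * q) 0 = 0"
proof -
  have "(Poly_Mapping.lookup q e' when 0 = e + e') = 0" for e e'
    using assms exponent_sum_eq_0(2)[of e e'] by (auto simp: when_def)
  then show ?thesis by (simp add: lookup_mult)
qed

lemma constant_term_Var: "Poly_Mapping.lookup (Var v :: ('v, 'k::field) polyn) 0 = 0"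
proof -
  have "Poly_Mapping.single v 1 \<noteq> (0 :: 'v \<Rightarrow>\<^sub>0 nat)" by (metis lookup_single_eq lookup_zero zero_neq_one)
  then show ?thesis by (simp add: Var_def Monom_def lookup_single when_def)
qed

lemma reduce_zero_subspace: "module.subspace pm_scale {x :: 'b \<Rightarrow>\<^sub>0 ('v, 'k::field) polyn. reduce x = 0}"
proof -
  have eq: "reduce x = 0 \<longleftrightarrow> (\<forall>b. Poly_Mapping.lookup (Poly_Mapping.lookup x b) 0 = 0)"
    for x :: "'b \<Rightarrow>\<^sub>0 ('v, 'k) polyn"
    by (metis lookup_reduce lookup_zero poly_mapping_eqI)
  show ?thesis
    by (rule module.subspaceI[OF module_pm_scale]) (auto simp: eq lookup_add lookup_pm_scale constant_term_mult)
qed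

lemma vars_submodule_reduce:
  fixes x :: "'b \<Rightarrow>\<^sub>0 ('v, 'k::field) polyn"
  assumes "x \<in> vars_submodule B"
  shows "reduce x = 0"
proof -
  have "reduce (pm_scale (Var v) y) = 0" for v and y :: "'b \<Rightarrow>\<^sub>0 ('v, 'k) polyn"
    by (rule poly_mapping_eqI)
       (simp add: lookup_reduce lookup_pm_scale mult.commute[of "Var v"] constant_term_mult constant_term_Var)
  then have "vars_submodule B \<subseteq> {x :: 'b \<Rightarrow>\<^sub>0 ('v, 'k) polyn. reduce x = 0}"
    unfolding vars_submodule_def
    by (intro module.span_minimal[OF module_pm_scale _ reduce_zero_subspace]) auto
  then show ?thesis using assms by blast
qed

lemma vars_submodule_subspace: "module.subspace pm_scale (vars_submodule B :: ('b \<Rightarrow>\<^sub>0 ('v, 'k::field) polyn) set)"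
  unfolding vars_submodule_def by (rule module.subspace_span[OF module_pm_scale])

text \<open>Together with \<open>vars_submodule_reduce\<close> this identifies the submodule with
  the kernel of the reduction. A polynomial without constant term is a sum of monomials with nonzero
  exponent, and each of these is divisible by a variable.\<close>

lemma vars_submoduleI:
  fixes x :: "'b \<Rightarrow>\<^sub>0 ('v, 'k::field) polyn"
  assumes x: "x \<in> free_on B" "reduce x = 0"
  shows "x \<in> vars_submodule B"
proof -
  have term_in: "Poly_Mapping.single b (Poly_Mapping.single m c) \<in> vars_submodule B"
    if b: "b \<in> B" and m: "m \<noteq> 0" for b and m :: "'v \<Rightarrow>\<^sub>0 nat" and c :: 'k
  proof -
    obtain v where v: "Poly_Mapping.lookup m v \<noteq> 0" using m by (metis lookup_zero poly_mapping_eqI)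
    have "Poly_Mapping.single v 1 + (m - Poly_Mapping.single v 1) = m"
      using v by (intro poly_mapping_eqI) (auto simp: lookup_add lookup_minus lookup_single when_def)
    then have "(Var v :: ('v, 'k) polyn) * Poly_Mapping.single (m - Poly_Mapping.single v 1) c = Poly_Mapping.single m c"
      by (simp add: Var_def Monom_def mult_single)
    then have "Poly_Mapping.single b (Poly_Mapping.single m c) =
        pm_scale (Var v) (Poly_Mapping.single b (Poly_Mapping.single (m - Poly_Mapping.single v 1) c))"
      by (intro poly_mapping_eqI) (simp add: lookup_pm_scale lookup_single when_def)
    moreover have "Poly_Mapping.single b (Poly_Mapping.single (m - Poly_Mapping.single v 1) c) \<in> free_on B"
      using b by (simp add: free_on_def)
    ultimately show ?thesis
      unfolding vars_submodule_def by (intro module.span_base[OF module_pm_scale]) blast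
  qed
  have "Poly_Mapping.single b (Poly_Mapping.lookup x b) \<in> vars_submodule B" if "b \<in> Poly_Mapping.keys x" for b
  proof -
    let ?p = "Poly_Mapping.lookup x b"
    have b: "b \<in> B" using that x(1) by (auto simp: free_on_def)
    have "Poly_Mapping.lookup ?p 0 = 0" using x(2) by (metis lookup_reduce lookup_zero)
    then have ne: "m \<noteq> 0" if "m \<in> Poly_Mapping.keys ?p" for m using that by (auto simp: in_keys_iff)
    have "Poly_Mapping.single b ?p =
        (\<Sum>m\<in>Poly_Mapping.keys ?p. Poly_Mapping.single b (Poly_Mapping.single m (Poly_Mapping.lookup ?p m)))"
      (is "?l = ?r")
    proof (rule poly_mapping_eqI)
      fix k
      show "Poly_Mapping.lookup ?l k = Poly_Mapping.lookup ?r k"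
        using sum_single_keys[of ?p] by (cases "k = b") (simp_all add: lookup_sum lookup_single)
    qed
    also have "\<dots> \<in> vars_submodule B"
      by (rule module.subspace_sum[OF module_pm_scale vars_submodule_subspace]) (use term_in b ne in blast)
    finally show ?thesis .
  qed
  then have "(\<Sum>b\<in>Poly_Mapping.keys x. Poly_Mapping.single b (Poly_Mapping.lookup x b)) \<in> vars_submodule B"
    by (rule module.subspace_sum[OF module_pm_scale vars_submodule_subspace])
  then show ?thesis by (simp add: sum_single_keys)
qed

lemma single_homogeneous:
  "b \<in> B \<Longrightarrow> Poly_Mapping.single b c \<in> comp (based_ainf B deg \<mu>) (int (deg b))"
  by (simp add: based_ainf_def)

lemma free_on_total:
  fixes \<mu> :: "('b \<Rightarrow>\<^sub>0 's::comm_ring_1) list \<Rightarrow> ('b \<Rightarrow>\<^sub>0 's)"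
  assumes F: "ainf_algebra (based_ainf B deg \<mu>)"
  shows "free_on B \<subseteq> total (based_ainf B deg \<mu>)"
proof
  fix x :: "'b \<Rightarrow>\<^sub>0 's" assume "x \<in> free_on B"
  then have "Poly_Mapping.single b (Poly_Mapping.lookup x b) \<in> total (based_ainf B deg \<mu>)"
    if "b \<in> Poly_Mapping.keys x" for b
    using that by (intro comp_in_total[OF F single_homogeneous]) (auto simp: free_on_def)
  then have "(\<Sum>b\<in>Poly_Mapping.keys x. Poly_Mapping.single b (Poly_Mapping.lookup x b)) \<in> total (based_ainf B deg \<mu>)"
    by (rule add_closed_sum[OF add_closed_total[OF ainf_algebraD(1)[OF F]]])
  then show "x \<in> total (based_ainf B deg \<mu>)" by (simp add: sum_single_keys)
qed

lemma multilinear_on_scale: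
  assumes "multilinear_on s t V n f" "Suc (length xs + length ys) = n" "set xs \<subseteq> V" "set ys \<subseteq> V" "x \<in> V"
  shows "f (xs @ s c x # ys) = t c (f (xs @ x # ys))"
  using assms unfolding multilinear_on_def by blast

lemma homogeneous_singles:
  "set bs \<subseteq> B \<Longrightarrow>
     homogeneous (based_ainf B deg \<mu>) (map (\<lambda>b. int (deg b)) bs) (map (\<lambda>b. Poly_Mapping.single b c) bs)"
  by (induction bs) (simp_all add: homogeneous_def single_homogeneous)

text \<open>The arguments are expanded in the basis from the last to the first; \<open>bs\<close>
  lists the basis elements chosen so far. Linearity over the base ring moves the coefficients out of
  the operation.\<close>

lemma multilinear_basis:
  fixes \<mu> :: "('b \<Rightarrow>\<^sub>0 's::comm_ring_1) list \<Rightarrow> ('b \<Rightarrow>\<^sub>0 's)"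
  assumes F: "ainf_algebra (based_ainf B deg \<mu>)" and U: "module.subspace pm_scale U" and CB: "C \<subseteq> B"
    and basis: "\<And>bs. length bs = n \<Longrightarrow> set bs \<subseteq> C \<Longrightarrow> \<mu> (map (\<lambda>b. Poly_Mapping.single b 1) bs) \<in> U"
    and xs: "length xs = n" "set xs \<subseteq> free_on C"
  shows "\<mu> xs \<in> U"
proof -
  let ?F = "based_ainf B deg \<mu>" and ?s = "\<lambda>b. Poly_Mapping.single b 1 :: 'b \<Rightarrow>\<^sub>0 's"
  have tot: "free_on C \<subseteq> total ?F" using free_on_total[OF F] CB by (auto simp: free_on_def)
  have st: "?s b \<in> total ?F" if "b \<in> C" for b
    using that CB by (intro comp_in_total[OF F single_homogeneous]) auto
  have "\<mu> (xs @ map ?s bs) \<in> U" if "length xs + length bs = n" "set xs \<subseteq> free_on C" "set bs \<subseteq> C" for bs xs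
    using that
  proof (induction xs arbitrary: bs rule: rev_induct)
    case Nil
    then show ?case using basis by simp
  next
    case (snoc x xs)
    have "set xs \<subseteq> free_on C" using snoc.prems(2) by simp
    then have sub: "set xs \<subseteq> total ?F" "set (map ?s bs) \<subseteq> total ?F" using tot st snoc.prems(3) by auto
    have kx: "Poly_Mapping.keys x \<subseteq> C" using snoc.prems by (simp add: free_on_def)
    have sc: "Poly_Mapping.single b (Poly_Mapping.lookup x b) = pm_scale (Poly_Mapping.lookup x b) (?s b)" for b
      by (intro poly_mapping_eqI) (simp add: lookup_pm_scale lookup_single when_def)
    have "mul ?F (xs @ (\<Sum>b\<in>Poly_Mapping.keys x. Poly_Mapping.single b (Poly_Mapping.lookup x b)) # map ?s bs) =
      (\<Sum>b\<in>Poly_Mapping.keys x. mul ?F (xs @ Poly_Mapping.single b (Poly_Mapping.lookup x b) # map ?s bs))"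
    proof (rule multiadd_sum[OF ainf_algebraD(2)[OF F] add_closed_total[OF ainf_algebraD(1)[OF F]] sub])
      fix b assume "b \<in> Poly_Mapping.keys x"
      then have "b \<in> B" using kx CB by blast
      then show "Poly_Mapping.single b (Poly_Mapping.lookup x b) \<in> total ?F"
        by (rule comp_in_total[OF F single_homogeneous])
    qed
    then have "\<mu> (xs @ x # map ?s bs) =
      (\<Sum>b\<in>Poly_Mapping.keys x. \<mu> (xs @ Poly_Mapping.single b (Poly_Mapping.lookup x b) # map ?s bs))"
      by (simp add: sum_single_keys based_ainf_def)
    also have "\<dots> \<in> U"
    proof (rule module.subspace_sum[OF module_pm_scale U])
      fix b assume b: "b \<in> Poly_Mapping.keys x"
      have "multilinear_on pm_scale pm_scale (total ?F) n \<mu>"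
        using F snoc.prems(1) unfolding ainf_algebra_def by (simp add: based_ainf_def)
      moreover have "Suc (length xs + length (map ?s bs)) = n" using snoc.prems(1) by simp
      moreover have "?s b \<in> total ?F" using b kx st by blast
      ultimately have "\<mu> (xs @ pm_scale (Poly_Mapping.lookup x b) (?s b) # map ?s bs) =
          pm_scale (Poly_Mapping.lookup x b) (\<mu> (xs @ ?s b # map ?s bs))"
        by (rule multilinear_on_scale[OF _ _ sub])
      moreover have "\<mu> (xs @ map ?s (b # bs)) \<in> U"
        using snoc.prems kx b by (intro snoc.IH) auto
      ultimately show "\<mu> (xs @ Poly_Mapping.single b (Poly_Mapping.lookup x b) # map ?s bs) \<in> U"
        unfolding sc by (simp add: module.subspace_scale[OF module_pm_scale U])
    qed
    finally show ?case by simp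
  qed
  from this[of xs "[]"] show ?thesis using xs by simp
qed

text \<open>Both sides can be tested on tuples of basis elements, which are homogeneous;
  \<open>const_lift\<close> sends the basis over k to the basis over S, and membership in the
  submodule is vanishing of the reduction.\<close>

lemma minimal_op_iff:
  fixes \<mu> :: "('b \<Rightarrow>\<^sub>0 ('v, 'k::field) polyn) list \<Rightarrow> ('b \<Rightarrow>\<^sub>0 ('v, 'k) polyn)"
  assumes F: "ainf_algebra (based_ainf B deg \<mu>)" and n: "1 \<le> n"
  shows "minimal_op B (free_on {b\<in>B. int (deg b) \<in> D}) \<mu> n \<longleftrightarrow>
    (\<forall>ps xs. length xs = n \<and> set ps \<subseteq> D \<and> homogeneous (tensor_k B deg \<mu>) ps xs \<longrightarrow> mul (tensor_k B deg \<mu>) xs = 0)"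
    (is "minimal_op B (free_on ?C) \<mu> n \<longleftrightarrow> ?R")
proof
  assume min: "minimal_op B (free_on ?C) \<mu> n"
  show ?R
  proof (intro allI impI, elim conjE)
    fix ps xs assume xs: "length xs = n" "set ps \<subseteq> D" "homogeneous (tensor_k B deg \<mu>) ps xs"
    have "const_lift x \<in> free_on ?C" if x: "x \<in> set xs" for x
    proof -
      obtain l where l: "l < length xs" "x = xs ! l" using x by (metis in_set_conv_nth)
      then have "ps ! l \<in> D" "x \<in> comp (tensor_k B deg \<mu>) (ps ! l)"
        using xs(2,3) by (auto simp: homogeneous_def list_all2_conv_all_nth subset_iff)
      then have "Poly_Mapping.keys x \<subseteq> ?C" by (auto simp: tensor_k_def based_ainf_def)
      moreover have "Poly_Mapping.keys (const_lift x) \<subseteq> Poly_Mapping.keys x"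
        by (auto simp: in_keys_iff lookup_const_lift Const_def)
      ultimately show ?thesis by (auto simp: free_on_def)
    qed
    then have "set (map const_lift xs) \<subseteq> free_on ?C" by auto
    then have "\<mu> (map const_lift xs) \<in> vars_submodule B"
      using min[unfolded minimal_op_def, rule_format, of "map const_lift xs"] xs(1) by simp
    then show "mul (tensor_k B deg \<mu>) xs = 0"
      by (simp add: tensor_k_def based_ainf_def vars_submodule_reduce)
  qed
next
  assume R: ?R
  have "\<mu> (map (\<lambda>b. Poly_Mapping.single b 1) bs) \<in> vars_submodule B" if bs: "length bs = n" "set bs \<subseteq> ?C" for bs
  proof (rule vars_submoduleI)
    let ?s = "\<lambda>b. Poly_Mapping.single b 1 :: 'b \<Rightarrow>\<^sub>0 ('v, 'k) polyn"
    let ?sk = "\<lambda>b. Poly_Mapping.single b 1 :: 'b \<Rightarrow>\<^sub>0 'k"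
    let ?ps = "map (\<lambda>b. int (deg b)) bs"
    have "homogeneous (based_ainf B deg \<mu>) ?ps (map ?s bs)"
      using bs(2) by (intro homogeneous_singles) auto
    moreover have "map ?s bs \<noteq> []" using bs(1) n by auto
    ultimately have "\<mu> (map ?s bs) \<in> comp (based_ainf B deg \<mu>) (sum_list ?ps + int (length (map ?s bs)) - 2)"
      using ainf_algebraD(3)[OF F, of "map ?s bs" ?ps] by (simp add: based_ainf_def)
    then show "\<mu> (map ?s bs) \<in> free_on B" by (auto simp: based_ainf_def free_on_def)
    have "homogeneous (tensor_k B deg \<mu>) ?ps (map ?sk bs)"
      using bs(2) unfolding tensor_k_def by (intro homogeneous_singles) auto
    moreover have "length (map ?sk bs) = n" "set ?ps \<subseteq> D" using bs by auto
    ultimately have "mul (tensor_k B deg \<mu>) (map ?sk bs) = 0" using R by blast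
    moreover have "const_lift (?sk b) = ?s b" for b
      by (rule poly_mapping_eqI) (simp add: lookup_const_lift lookup_single when_def Const_def)
    ultimately show "reduce (\<mu> (map ?s bs)) = 0" by (simp add: tensor_k_def based_ainf_def o_def)
  qed
  then show "minimal_op B (free_on ?C) \<mu> n"
    unfolding minimal_op_def
    by (intro allI impI, elim conjE) (rule multilinear_basis[OF F vars_submodule_subspace, of ?C n], auto)
qed

section \<open>Comparison of the Koszul dga with the reduced resolution\<close>

text \<open>Arity 1 is minimality of the resolution, as mu_1 is its differential. The same fact
  makes the differential of the reduction zero, which \<open>mc_extendable_minimal\<close> requires;
  the arities from 2 on are then a matter of Massey products.\<close>

lemma condition_B_iff_minimal:
  fixes \<phi> :: "('v::{finite,linorder}, 'k::field) polyn \<Rightarrow> 'r::comm_ring"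
  assumes res: "minimal_free_resolution B deg d \<epsilon> \<phi>" and str: "ainf_structure_on B deg d \<mu>"
    and qi: "ainf_quasi_isomorphic TYPE('u::ab_group_add) (tensor_k B deg \<mu>) (koszul_dga \<phi>)"
    and cl: "\<And>p q. p \<in> D \<Longrightarrow> q \<in> D \<Longrightarrow> p + q + 1 \<in> D"
  shows "condition_B_on D (koszul_dga \<phi>) r \<longleftrightarrow>
    (\<forall>n\<in>{1..r}. minimal_op B (free_on {b\<in>B. int (deg b) \<in> D}) \<mu> n)"
proof -
  let ?H = "tensor_k B deg \<mu>" and ?C = "{b\<in>B. int (deg b) \<in> D}"
  have F: "ainf_algebra (based_ainf B deg \<mu>)" and d: "\<And>x. x \<in> free_on B \<Longrightarrow> \<mu> [x] = d x"
    using str by (auto simp: ainf_structure_on_def)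
  have one: "minimal_op B (free_on C) \<mu> 1" if "C \<subseteq> B" for C
  proof -
    have "\<mu> [x] \<in> vars_submodule B" if "x \<in> free_on C" for x
    proof -
      have "x \<in> free_on B" using that \<open>C \<subseteq> B\<close> by (auto simp: free_on_def)
      then show ?thesis using d res unfolding minimal_free_resolution_def by auto
    qed
    then show ?thesis by (auto simp: minimal_op_def length_Suc_conv)
  qed
  have min: "mul ?H [x] = 0" if x: "x \<in> comp ?H p" for x p
  proof -
    \<comment> \<open>The differential has to vanish in all degrees and not only in those of
      D.\<close>
    have "minimal_op B (free_on {b\<in>B. int (deg b) \<in> UNIV}) \<mu> 1" by (rule one) auto
    then show ?thesis
      unfolding minimal_op_iff[OF F order_refl] using x
      by (elim allE[of _ "[p]"] allE[of _ "[x]"]) (simp add: homogeneous_def)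
  qed
  have "condition_B_on D (koszul_dga \<phi>) r \<longleftrightarrow> mc_extendable D (koszul_dga \<phi>) r"
    by (rule condition_B_iff_extendable[OF mc_extendable_quasi_isomorphic(2)[OF qi]])
       (auto simp: koszul_dga_def split: list.split)
  also have "\<dots> \<longleftrightarrow> mc_extendable D ?H r" using mc_extendable_quasi_isomorphic(3)[OF qi] by blast
  also have "\<dots> \<longleftrightarrow> (\<forall>ps xs. 2 \<le> length xs \<and> length xs \<le> r \<and> set ps \<subseteq> D \<and> homogeneous ?H ps xs \<longrightarrow> mul ?H xs = 0)"
    by (rule mc_extendable_minimal[OF mc_extendable_quasi_isomorphic(1)[OF qi] min cl])
  also have "\<dots> \<longleftrightarrow> (\<forall>n\<in>{2..r}. minimal_op B (free_on ?C) \<mu> n)"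
    using minimal_op_iff[OF F, of _ D] by auto
  also have "\<dots> \<longleftrightarrow> (\<forall>n\<in>{1..r}. minimal_op B (free_on ?C) \<mu> n)"
  proof -
    have "n = 1 \<or> n \<in> {2..r}" if "n \<in> {1..r}" for n using that by auto
    then show ?thesis using one[of ?C] by fastforce
  qed
  finally show ?thesis .
qed

text \<open>The two conjuncts are the cases where D consists of all integers and of the positive
  integers; both sets are closed under p + q + 1.\<close>

theorem theorem1:
  fixes I :: "('v::{finite,linorder}, 'k::field) polyn set"
    and \<phi> :: "('v, 'k) polyn \<Rightarrow> 'r::comm_ring"
    and B :: "'b set" and deg :: "'b \<Rightarrow> nat"
    and d :: "('b \<Rightarrow>\<^sub>0 ('v, 'k) polyn) \<Rightarrow> ('b \<Rightarrow>\<^sub>0 ('v, 'k) polyn)"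
    and \<epsilon> :: "('b \<Rightarrow>\<^sub>0 ('v, 'k) polyn) \<Rightarrow> 'r"
    and \<mu> :: "('b \<Rightarrow>\<^sub>0 ('v, 'k) polyn) list \<Rightarrow> ('b \<Rightarrow>\<^sub>0 ('v, 'k) polyn)"
    and r :: nat
  assumes "monomial_ideal I"
    and "quotient_map I \<phi>"
    and "minimal_free_resolution B deg d \<epsilon> \<phi>"
    and "ainf_structure_on B deg d \<mu>"
    and "ainf_quasi_isomorphic TYPE('u::ab_group_add) (tensor_k B deg \<mu>) (koszul_dga \<phi>)"
  shows "(condition_B (koszul_dga \<phi>) r \<longleftrightarrow> (\<forall>n\<in>{1..r}. minimal_op B (free_on B) \<mu> n)) \<and>
         (condition_B_pos (koszul_dga \<phi>) r \<longleftrightarrow> (\<forall>n\<in>{1..r}. minimal_op B (free_pos B deg) \<mu> n))"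
  using condition_B_iff_minimal[OF assms(3-5), of UNIV r] condition_B_iff_minimal[OF assms(3-5), of "{0<..}" r]
  by (simp add: free_pos_def)

end
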